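(* For all non-negative integers $k,l,m$ with $(k,l,m)\ne(0,0,0)$ and all $z\in\mathfrak{U}$ (in particular for $0<z<1$), $$\begin{aligned} &\bar G_0(k+l+2m,\,l+m,\,m;\,z)+\bar G_0(k+l+2m,\,k+m,\,m;\,1-z)\\ &+\sum_{\substack{k'+k''=k\\ l'+l''=l\\ m'+m''=m}}\Big(\bar G_0(k'+l'+2m',\,l'+m',\,m';\,z)\;\bar G_0(k''+l''+2m'',\,k''+m'',\,m'';\,1-z)\\ &\qquad+\bar G_1(k'+l'+2m'-1,\,l'+m',\,m';\,z)\;G_1(k''+l''+2m''+1,\,k''+m''+1,\,m''+1;\,1-z)\Big)\\ &=\sum_{i=0}^{k}\sum_{j=0}^{l}\sum_{\mu=0}^{m}\binom{i+j}{i}P_{k-i}(\boldsymbol{\zeta})\,P_{l-j}(\boldsymbol{\zeta})\,P_{\mu}(-\boldsymbol{\zeta})\,P_{i+j+2m-\mu}(-\boldsymbol{\zeta})\,N_{i+j,\,m-\mu}, \end{aligned}$$ where the first sum runs over non-negative integers $k',k'',l',l'',m',m''$.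
   Context: Words are in two letters $x,y$. For a word $w$: the weight $|w|$ is the number of letters, the depth $d(w)$ is the number of $y$'s, and the height $h(w)$ is (the number of occurrences of $yx$ in $w$) $+1$. Let $\mathfrak{h}^1=\mathbf{C}+\mathbf{C}\langle x,y\rangle y$ and $\mathfrak{h}^0=\mathbf{C}+x\mathbf{C}\langle x,y\rangle y$. For $w=x^{k_1-1}y\cdots x^{k_r-1}y$, $\operatorname{Li}(w;z)=\operatorname{Li}_{k_1,\dots,k_r}(z)=\sum_{m_1>\cdots>m_r>0}\frac{z^{m_1}}{m_1^{k_1}\cdots m_r^{k_r}}$ for $|z|<1$. For $i=0,1$, $$G_i(k,n,s;z)=\sum_{w\in\mathfrak{h}^i\text{ word},\ |w|=k,\ d(w)=n,\ h(w)=s}\operatorname{Li}(w;z).$$ Set $G_0(k,n,s;z)=0$ if $k<n+s$, or $n<s$, or any of $k,n,s$ is $\le0$; set $G_1(k,n,s;z)=0$ if $k<n+s-1$, or $n<s$, or any of $k,n,s$ is $\le 0$. Put $\bar G_i(k,n,s;z)=G_i(k,n,s;z)-G_i(k,n,s+1;z)$. $\mathfrak{U}$ is the universal covering space of $\mathbf{P}^1-\{0,1,\infty\}$. Both $\operatorname{Li}(w;z)$ and $z\mapsto\operatorname{Li}(w;1-z)$ are continued to $\mathfrak{U}$ from their power series values on a fixed lift of the real interval $0<z<1$. For a sequence $\boldsymbol{a}=(a_1,a_2,\dots)$ of complex numbers, $P_n(\boldsymbol{a})$ is defined by $\exp\big(\sum_{n\ge1}a_nt^n\big)=\sum_{n\ge0}P_n(\boldsymbol{a})t^n$.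 Here $\boldsymbol{\zeta}=(0,\frac{\zeta(2)}2,\frac{\zeta(3)}3,\frac{\zeta(4)}4,\dots)$ with $\zeta$ the Riemann zeta function, and $-\boldsymbol{\zeta}$ is the termwise negative. The integers $N_{i,j}$ are: $N_{0,0}=1$, $N_{i,j}=0$ if $i<0$ or $j<0$, and for $n\ge1$, $a^n+b^n=\sum_{i+2j=n,\ i,j\ge 0}N_{i,j}(a+b)^i(ab)^j$ as polynomials in $a,b$. *)

theory Defs
  imports
    "HOL-Complex_Analysis.Complex_Analysis"
    "HOL-Computational_Algebra.Computational_Algebra"
begin

datatype letter = Lx | Ly

type_synonym word = "letter list"

definition depth :: "word \<Rightarrow> nat" where
  "depth w = count_list w Ly"

definition height :: "word \<Rightarrow> nat" where
  "height w = card {i. Suc i < length w \<and> w ! i = Ly \<and> w ! Suc i = Lx} + 1"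

definition h0_words :: "word set" where
  "h0_words = {[]} \<union> {Lx # v @ [Ly] | v. True}"

definition h1_words :: "word set" where
  "h1_words = {[]} \<union> {v @ [Ly] | v. True}"

definition word_of_index :: "nat list \<Rightarrow> word" where
  "word_of_index ks = concat (map (\<lambda>k. replicate (k - 1) Lx @ [Ly]) ks)"

text \<open>The first argument of the following function is one more than the number of letters
  \<open>Lx\<close> read since the last \<open>Ly\<close>.\<close>

fun index_aux :: "nat \<Rightarrow> word \<Rightarrow> nat list" where
  "index_aux c [] = []"
| "index_aux c (Lx # w) = index_aux (Suc c) w"
| "index_aux c (Ly # w) = c # index_aux 1 w"

definition index_of_word :: "word \<Rightarrow> nat list" where
  "index_of_word w = index_aux 1 w"

lemma index_aux_block: "index_aux c (replicate j Lx @ Ly # w) = (c + j) # index_aux 1 w"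
  by (induction j arbitrary: c) auto

lemma index_of_word_of_index:
  "(\<forall>k\<in>set ks. 1 \<le> k) \<Longrightarrow> index_of_word (word_of_index ks) = ks"
  by (induction ks) (auto simp: index_of_word_def word_of_index_def index_aux_block)

text \<open>The summation variable \<open>ms\<close> is the list \<open>m\<^sub>1 > \<dots> > m\<^sub>r > 0\<close>. For the
  empty index the only summand is \<open>1\<close>.\<close>

definition polylog :: "nat list \<Rightarrow> complex \<Rightarrow> complex" where
  "polylog ks z =
     (\<Sum>\<^sub>\<infinity>ms\<in>{ms. length ms = length ks \<and> sorted_wrt (>) ms \<and> 0 \<notin> set ms}.
        z ^ (case ms of [] \<Rightarrow> 0 | m # _ \<Rightarrow> m) / (\<Prod>i<length ks. of_nat (ms ! i) ^ (ks ! i)))"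

definition Li :: "word \<Rightarrow> complex \<Rightarrow> complex" where
  "Li w z = polylog (index_of_word w) z"

text \<open>The thrice punctured sphere is the complex plane without \<open>0\<close> and \<open>1\<close>. Its universal
  covering space is taken to be the set of homotopy classes, with fixed end points, of paths
  that start at the base point \<open>1/2\<close>.\<close>

definition punctured :: "complex set" where
  "punctured = - {0, 1}"

quotient_type ucover = "real \<Rightarrow> complex" / partial:
  "\<lambda>\<gamma> \<delta>. pathstart \<gamma> = 1 / 2 \<and> homotopic_paths punctured \<gamma> \<delta>"
proof (rule part_equivpI)
  have "homotopic_paths punctured (linepath (1 / 2) (1 / 2)) (linepath (1 / 2) (1 / 2))"
    by (simp add: punctured_def)
  then show "\<exists>\<gamma>. pathstart \<gamma> = 1 / 2 \<and> homotopic_paths punctured \<gamma> \<gamma>"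
    by (metis pathstart_linepath)
  show "symp (\<lambda>\<gamma> \<delta>. pathstart \<gamma> = 1 / 2 \<and> homotopic_paths punctured \<gamma> \<delta>)"
    by (rule sympI) (metis homotopic_paths_imp_pathstart homotopic_paths_sym)
  show "transp (\<lambda>\<gamma> \<delta>. pathstart \<gamma> = 1 / 2 \<and> homotopic_paths punctured \<gamma> \<delta>)"
    by (rule transpI) (metis homotopic_paths_trans)
qed

lift_definition proj :: "ucover \<Rightarrow> complex" is pathfinish
  by (metis homotopic_paths_imp_pathfinish)

text \<open>If the segment from \<open>proj u\<close> to \<open>z\<close> avoids the punctures, \<open>shift u z\<close> is the end point of
  its lift starting at \<open>u\<close>. For a disc around \<open>proj u\<close> in the base, \<open>shift u\<close> is thus the
  inverse of \<open>proj\<close> on the sheet over that disc that contains \<open>u\<close>.\<close>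

definition shift :: "ucover \<Rightarrow> complex \<Rightarrow> ucover" where
  "shift u z = abs_ucover (rep_ucover u +++ linepath (proj u) z)"

definition holomorphic_cover :: "(ucover \<Rightarrow> complex) \<Rightarrow> bool" where
  "holomorphic_cover F \<longleftrightarrow>
     (\<forall>u r. 0 < r \<longrightarrow> ball (proj u) r \<subseteq> punctured \<longrightarrow>
        (\<lambda>z. F (shift u z)) holomorphic_on ball (proj u) r)"

lemma proj_shift:
  assumes "closed_segment (proj u) z \<subseteq> punctured"
  shows "proj (shift u z) = z"
proof -
  define \<gamma> where "\<gamma> = rep_ucover u"
  have g: "pathstart \<gamma> = 1 / 2" "homotopic_paths punctured \<gamma> \<gamma>"
    using Quotient3_rep_reflp[OF Quotient3_ucover, of u] by (auto simp: \<gamma>_def)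
  have p: "proj u = pathfinish \<gamma>"
    by (simp add: proj_def \<gamma>_def)
  have "homotopic_paths punctured (\<gamma> +++ linepath (proj u) z) (\<gamma> +++ linepath (proj u) z)"
    using assms p g(2) by (intro homotopic_paths_join) auto
  then show ?thesis
    using proj.abs_eq[of "\<gamma> +++ linepath (proj u) z"] g(1)
    by (simp add: shift_def \<gamma>_def eq_onp_def)
qed

text \<open>The fixed lift of the real interval between \<open>0\<close> and \<open>1\<close>.\<close>

definition lift01 :: "real \<Rightarrow> ucover" where
  "lift01 t = abs_ucover (linepath (1 / 2) (of_real t))"

lemma proj_lift01:
  assumes "0 < t" "t < 1"
  shows "proj (lift01 t) = of_real t"
proof -
  have "closed_segment (1 / 2) (complex_of_real t) = complex_of_real ` closed_segment (1 / 2) t"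
    using closed_segment_of_real[of "1 / 2" t, where ?'a = complex] by simp
  moreover have "0 \<notin> closed_segment (1 / 2) t" "1 \<notin> closed_segment (1 / 2) t"
    using assms by (auto simp: closed_segment_eq_real_ivl split: if_splits)
  ultimately have "closed_segment (1 / 2) (complex_of_real t) \<subseteq> punctured"
    by (auto simp: punctured_def)
  then have "homotopic_paths punctured (linepath (1 / 2) (complex_of_real t)) (linepath (1 / 2) (of_real t))"
    by simp
  then show ?thesis
    using proj.abs_eq[of "linepath (1 / 2) (of_real t)"] by (simp add: lift01_def eq_onp_def)
qed

text \<open>Analytic continuation from the fixed lift of the interval to the whole covering space; it
  is unique by the identity theorem.\<close>

definition continuation :: "(complex \<Rightarrow> complex) \<Rightarrow> ucover \<Rightarrow> complex" where
  "continuation f =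
     (THE F. holomorphic_cover F \<and> (\<forall>t. 0 < t \<and> t < 1 \<longrightarrow> F (lift01 t) = f (of_real t)))"

definition Li_cover :: "word \<Rightarrow> ucover \<Rightarrow> complex" where
  "Li_cover w = continuation (\<lambda>z. Li w z)"

definition Li_refl_cover :: "word \<Rightarrow> ucover \<Rightarrow> complex" where
  "Li_refl_cover w = continuation (\<lambda>z. Li w (1 - z))"

text \<open>The first argument \<open>L\<close> is the polylogarithm to be used: \<open>Li\<close> in the unit disc, and
  \<open>Li_cover\<close> or \<open>Li_refl_cover\<close> for the functions of \<open>z\<close> or \<open>1 - z\<close> on the covering space.\<close>

definition G0 :: "(word \<Rightarrow> 'p \<Rightarrow> complex) \<Rightarrow> int \<Rightarrow> int \<Rightarrow> int \<Rightarrow> 'p \<Rightarrow> complex" where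
  "G0 L k n s z =
     (if k < n + s \<or> n < s \<or> k \<le> 0 \<or> n \<le> 0 \<or> s \<le> 0 then 0
      else \<Sum>w\<in>{w\<in>h0_words. int (length w) = k \<and> int (depth w) = n \<and> int (height w) = s}. L w z)"

definition G1 :: "(word \<Rightarrow> 'p \<Rightarrow> complex) \<Rightarrow> int \<Rightarrow> int \<Rightarrow> int \<Rightarrow> 'p \<Rightarrow> complex" where
  "G1 L k n s z =
     (if k < n + s - 1 \<or> n < s \<or> k \<le> 0 \<or> n \<le> 0 \<or> s \<le> 0 then 0
      else \<Sum>w\<in>{w\<in>h1_words. int (length w) = k \<and> int (depth w) = n \<and> int (height w) = s}. L w z)"

definition Gbar0 :: "(word \<Rightarrow> 'p \<Rightarrow> complex) \<Rightarrow> int \<Rightarrow> int \<Rightarrow> int \<Rightarrow> 'p \<Rightarrow> complex" where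
  "Gbar0 L k n s z = G0 L k n s z - G0 L k n (s + 1) z"

definition Gbar1 :: "(word \<Rightarrow> 'p \<Rightarrow> complex) \<Rightarrow> int \<Rightarrow> int \<Rightarrow> int \<Rightarrow> 'p \<Rightarrow> complex" where
  "Gbar1 L k n s z = G1 L k n s z - G1 L k n (s + 1) z"

text \<open>Only used for \<open>n \<ge> 2\<close>, where the series converges.\<close>

definition zeta :: "nat \<Rightarrow> complex" where
  "zeta n = (\<Sum>m. 1 / of_nat (Suc m) ^ n)"

text \<open>Sequences are indexed from \<open>1\<close>; the value at \<open>0\<close> is never used.\<close>

definition zeta_seq :: "nat \<Rightarrow> complex" where
  "zeta_seq n = (if n \<le> 1 then 0 else zeta n / of_nat n)"

definition P_exp :: "nat \<Rightarrow> (nat \<Rightarrow> complex) \<Rightarrow> complex" where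
  "P_exp n a = fps_nth (fps_exp 1 oo Abs_fps (\<lambda>i. if i = 0 then 0 else a i)) n"

text \<open>The two indeterminates of the polynomial ring in \<open>a\<close> and \<open>b\<close> over the integers,
  realised as polynomials in \<open>b\<close> whose coefficients are polynomials in \<open>a\<close>.\<close>

definition var_a :: "int poly poly" where
  "var_a = [:[:0, 1:]:]"

definition var_b :: "int poly poly" where
  "var_b = [:0, 1:]"

definition is_N :: "(int \<Rightarrow> int \<Rightarrow> int) \<Rightarrow> bool" where
  "is_N f \<longleftrightarrow> f 0 0 = 1 \<and> (\<forall>i j. i < 0 \<or> j < 0 \<longrightarrow> f i j = 0) \<and>
     (\<forall>n\<ge>1. var_a ^ n + var_b ^ n =
        (\<Sum>(i, j)\<in>{(i, j). i + 2 * j = n}.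
           of_int (f (int i) (int j)) * (var_a + var_b) ^ i * (var_a * var_b) ^ j))"

definition N_coeff :: "int \<Rightarrow> int \<Rightarrow> int" where
  "N_coeff = (THE f. is_N f)"

end

theory Submission
  imports Defs "HOL-Real_Asymp.Real_Asymp"
begin

text \<open>For complex numbers \<open>u\<close>, \<open>v\<close>, \<open>W\<close> give the index \<open>(k, l, m)\<close> the weight \<open>u^k v^l W^m T^(k+l+2m)\<close>.
  With this weighting one plus the generating series of the numbers \<open>Gbar0\<close> is the hypergeometric function
  \<open>F(z) = F(\<alpha> - u, \<beta> - u; 1 - u; z)\<close>, where \<open>\<alpha> + \<beta> = u + v\<close> and \<open>\<alpha> \<beta> = W\<close> (all four parameters
  scaled by \<open>T\<close>), and one plus the generating series of the left-hand side is a Wronskian of the hypergeometric equation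
  at \<open>z\<close> and of its companion, with \<open>u\<close> and \<open>v\<close> exchanged, at \<open>1 - z\<close>. Hence it does not depend on \<open>z\<close>,
  and letting \<open>z\<close> tend to \<open>1\<close> it equals \<open>F(1)\<close>. Gauss's contiguous relation turns \<open>F(1)\<close> into the product of
  \<open>(n - \<alpha>)(n - \<beta>) / ((n - u)(n - v))\<close> over \<open>n \<ge> 1\<close>, and the logarithmic derivative in \<open>T\<close> of that product is
  the one of the right-hand side. Working with power series in \<open>T\<close> avoids all convergence conditions on
  \<open>u\<close>, \<open>v\<close>, \<open>W\<close>, and coefficients are compared at the end since the three numbers are arbitrary.

  The identity extends to the covering space by the identity theorem. The continuations are
  iterated primitives; a primitive on the covering space exists because the increments of the local
  primitives form a cocycle, which is a coboundary on an interval and, for the independence of the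
  path, on the square of a homotopy.\<close>

text \<open>With c = W - u v, the series F (for \<open>Gbar0\<close>, plus one) and G (for
  \<open>G1\<close>) satisfy F' = c G / z and G' = u G / z + (F + v G) / (1 - z). The companion pair
  at 1 - z solves the adjoint system; hence the left-hand side pairs \<open>Gbar1\<close>, which
  carries the factor c, with \<open>G1\<close>, which does not. The delicate point is the limit at
  1, where G may diverge. Its companion vanishes to first order there, so it is enough that (1 - z)
  c G tends to 0. The infinite product is Gamma(1 - u) Gamma(1 - v) / (Gamma(1 - a) Gamma(1 - b)),
  with a, b the two roots. The relation a + b = u + v removes Euler's constant, whence the leading 0
  of the zeta sequence. On the right-hand side the binomial coefficients come from powers of u + v,
  and the numbers N from rewriting symmetric functions of a, b in terms of a + b and a b. Points of
  the covering space are only homotopy classes, so statements about them are proved by walking along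
  a representing path in steps short enough to stay inside one disc.\<close>

unbundle no vec_syntax
unbundle fps_syntax

section \<open>Multiple polylogarithms as power series\<close>

lemma summable_power_poly:
  fixes x :: "'a::{real_normed_field,banach}"
  assumes "norm x < 1"
  shows "summable (\<lambda>n. of_nat n ^ r * x ^ n)"
  using assms
proof (induction r arbitrary: x)
  case 0
  then show ?case by (simp add: summable_geometric)
next
  case (Suc r)
  have "summable (\<lambda>n. diffs (\<lambda>n. of_nat n ^ r) n * x ^ n)"
    by (rule termdiff_converges[where K = 1]) (use Suc in auto)
  then have "summable (\<lambda>n. x * (diffs (\<lambda>n. of_nat n ^ r) n * x ^ n))"
    by (rule summable_mult)
  then have "summable (\<lambda>n. of_nat (Suc n) ^ Suc r * x ^ Suc n)"
    by (simp add: diffs_def algebra_simps)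
  then show ?case
    by (subst (asm) summable_Suc_iff)
qed

text \<open>The coefficient of \<open>z ^ N\<close> in \<open>polylog ks z\<close> and, for admissible words, in \<open>Li w z\<close>.\<close>

fun index_coeff :: "nat list \<Rightarrow> nat \<Rightarrow> real" where
  "index_coeff [] N = (if N = 0 then 1 else 0)"
| "index_coeff (k # ks) N = (\<Sum>M<N. index_coeff ks M) / real N ^ k"

fun word_coeff :: "word \<Rightarrow> nat \<Rightarrow> real" where
  "word_coeff [] N = (if N = 0 then 1 else 0)"
| "word_coeff (Lx # w) N = word_coeff w N / real N"
| "word_coeff (Ly # w) N = (\<Sum>M<N. word_coeff w M) / real N"

lemma index_coeff_nonneg: "0 \<le> index_coeff ks N"
  by (induction ks arbitrary: N) (auto intro!: divide_nonneg_nonneg sum_nonneg)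

text \<open>Dropping the denominators leaves N summands of the previous bound. Polynomial growth
  suffices for absolute convergence in the open unit disc.\<close>

lemma index_coeff_bound: "index_coeff ks N \<le> (1 + real N) ^ length ks"
proof (induction ks arbitrary: N)
  case (Cons k ks)
  show ?case
  proof (cases "N = 0")
    case False
    have "index_coeff (k # ks) N \<le> (\<Sum>M<N. index_coeff ks M) / 1"
      unfolding index_coeff.simps
      by (rule divide_left_mono) (use False in \<open>auto intro!: sum_nonneg index_coeff_nonneg one_le_power\<close>)
    also have "\<dots> \<le> (\<Sum>M<N. (1 + real N) ^ length ks)"
      unfolding div_by_1
    proof (rule sum_mono)
      fix M assume "M \<in> {..<N}"
      then have "(1 + real M) ^ length ks \<le> (1 + real N) ^ length ks"
        by (intro power_mono) auto
      with Cons[of M] show "index_coeff ks M \<le> (1 + real N) ^ length ks" by simp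
    qed
    also have "\<dots> \<le> (1 + real N) ^ length (k # ks)"
      by (auto intro!: mult_right_mono)
    finally show ?thesis .
  qed simp
qed auto

text \<open>The summation indices of \<open>polylog\<close> sorted by their leading entry, which is
  the exponent of z. The empty list counts as having leading entry 0, as in
  \<open>polylog\<close>.\<close>

definition index_lists :: "nat \<Rightarrow> nat \<Rightarrow> nat list set" where
  "index_lists r N = {ms. length ms = r \<and> sorted_wrt (>) ms \<and> 0 \<notin> set ms \<and>
     (case ms of [] \<Rightarrow> 0 | m # _ \<Rightarrow> m) = N}"

lemma index_lists_0: "index_lists 0 N = (if N = 0 then {[]} else {})"
  by (auto simp: index_lists_def)

lemma index_lists_Suc:
  "index_lists (Suc r) N = (if N = 0 then {} else (\<lambda>ms. N # ms) ` (\<Union>M<N. index_lists r M))"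
proof (cases "N = 0")
  case True
  then show ?thesis by (auto simp: index_lists_def length_Suc_conv)
next
  case False
  have "ms \<in> index_lists (Suc r) N \<longleftrightarrow> ms \<in> (\<lambda>ms. N # ms) ` (\<Union>M<N. index_lists r M)" for ms
  proof
    assume "ms \<in> index_lists (Suc r) N"
    then obtain ns where ns: "ms = N # ns" "length ns = r" "sorted_wrt (>) ns" "0 \<notin> set ns"
        "\<forall>n\<in>set ns. n < N"
      by (auto simp: index_lists_def length_Suc_conv)
    define M where "M = (case ns of [] \<Rightarrow> 0 | m # _ \<Rightarrow> m)"
    have "M < N" using ns False by (auto simp: M_def split: list.splits)
    moreover have "ns \<in> index_lists r M" using ns by (simp add: index_lists_def M_def)
    ultimately show "ms \<in> (\<lambda>ms. N # ms) ` (\<Union>M<N. index_lists r M)" using ns by blast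
  next
    assume "ms \<in> (\<lambda>ms. N # ms) ` (\<Union>M<N. index_lists r M)"
    then obtain M ns where ns: "ms = N # ns" "M < N" "ns \<in> index_lists r M" by auto
    then have "\<forall>n\<in>set ns. n \<le> M" by (auto simp: index_lists_def split: list.splits)
    with ns False show "ms \<in> index_lists (Suc r) N"
      by (fastforce simp: index_lists_def)
  qed
  with False show ?thesis by auto
qed

lemma index_lists_disjoint: "M \<noteq> N \<Longrightarrow> index_lists r M \<inter> index_lists r N = {}"
  by (auto simp: index_lists_def)

lemma finite_index_lists: "finite (index_lists r N)"
  by (induction r arbitrary: N) (auto simp: index_lists_0 index_lists_Suc)

lemma sum_index_lists:
  "(\<Sum>ms\<in>index_lists (length ks) N. 1 / (\<Prod>i<length ks. real (ms ! i) ^ (ks ! i))) = index_coeff ks N"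
proof (induction ks arbitrary: N)
  case (Cons k ks)
  show ?case
  proof (cases "N = 0")
    case False
    have "(\<Sum>ms\<in>index_lists (length (k # ks)) N. 1 / (\<Prod>i<length (k # ks). real (ms ! i) ^ ((k # ks) ! i)))
        = (\<Sum>ms\<in>(\<Union>M<N. index_lists (length ks) M). (1 / (\<Prod>i<length ks. real (ms ! i) ^ (ks ! i))) / real N ^ k)"
      using False
      by (simp add: index_lists_Suc sum.reindex prod.lessThan_Suc_shift mult.commute del: prod.lessThan_Suc)
    also have "\<dots> = (\<Sum>M<N. \<Sum>ms\<in>index_lists (length ks) M. (1 / (\<Prod>i<length ks. real (ms ! i) ^ (ks ! i))) / real N ^ k)"
      by (rule sum.UNION_disjoint) (auto simp: finite_index_lists dest: index_lists_disjoint)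
    also have "\<dots> = index_coeff (k # ks) N"
      unfolding sum_divide_distrib[symmetric] Cons by simp
    finally show ?thesis .
  qed (simp add: index_lists_Suc)
qed (simp add: index_lists_0)

text \<open>\<open>polylog\<close> is an unordered sum over lists. Absolute convergence allows
  grouping by the leading entry, and each group is a finite sum equal to
  \<open>index_coeff\<close>.\<close>

lemma polylog_sums:
  assumes "norm z < 1"
  shows "(\<lambda>N. of_real (index_coeff ks N) * z ^ N) sums polylog ks z"
    and "summable (\<lambda>N. norm (of_real (index_coeff ks N) * z ^ N))"
proof -
  let ?r = "length ks"
  define f where "f ms = z ^ (case ms of [] \<Rightarrow> 0 | m # _ \<Rightarrow> m) / (\<Prod>i<?r. of_nat (ms ! i) ^ (ks ! i))"
    for ms :: "nat list"
  define g where "g ms = 1 / (\<Prod>i<?r. real (ms ! i) ^ (ks ! i))" for ms :: "nat list"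
  have g0: "0 \<le> g ms" for ms by (auto simp: g_def intro!: prod_nonneg divide_nonneg_nonneg)
  have fg: "f ms = of_real (g ms) * z ^ N" if "ms \<in> index_lists ?r N" for ms N
    using that by (simp add: f_def g_def index_lists_def)
  have sum_f: "(\<Sum>ms\<in>index_lists ?r N. f ms) = of_real (index_coeff ks N) * z ^ N" for N
    unfolding sum_index_lists[symmetric] of_real_sum sum_distrib_right
    by (rule sum.cong) (simp_all add: fg g_def)
  have sum_nf: "(\<Sum>ms\<in>index_lists ?r N. norm (f ms)) = norm (of_real (index_coeff ks N) * z ^ N)" for N
  proof -
    have "norm (of_real (index_coeff ks N) * z ^ N) = index_coeff ks N * norm z ^ N"
      by (simp add: norm_mult norm_power index_coeff_nonneg)
    also have "\<dots> = (\<Sum>ms\<in>index_lists ?r N. g ms * norm z ^ N)"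
      unfolding sum_index_lists[symmetric] sum_distrib_right by (rule sum.cong) (simp_all add: g_def)
    also have "\<dots> = (\<Sum>ms\<in>index_lists ?r N. norm (f ms))"
      by (rule sum.cong) (simp_all add: fg g0 norm_mult norm_power)
    finally show ?thesis by simp
  qed
  show summ: "summable (\<lambda>N. norm (of_real (index_coeff ks N) * z ^ N))"
  \<comment> \<open>From n = 1 on, 1 + n <= 2 n turns the bound into a power of n.\<close>
  proof (rule summable_comparison_test'[where N = 1])
    have "summable (\<lambda>n. 2 ^ ?r * (of_nat n ^ ?r * norm z ^ n))"
      by (intro summable_mult summable_power_poly) (use assms in simp)
    then show "summable (\<lambda>n. 2 ^ ?r * (real n ^ ?r * norm z ^ n))" by simp
    fix n :: nat assume n: "1 \<le> n"
    have "index_coeff ks n \<le> (1 + real n) ^ ?r" by (rule index_coeff_bound)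
    also have "\<dots> \<le> (2 * real n) ^ ?r" using n by (intro power_mono) auto
    finally have "index_coeff ks n * norm z ^ n \<le> (2 * real n) ^ ?r * norm z ^ n"
      by (intro mult_right_mono) auto
    then show "norm (norm (of_real (index_coeff ks n) * z ^ n)) \<le> 2 ^ ?r * (real n ^ ?r * norm z ^ n)"
      by (simp add: norm_mult norm_power index_coeff_nonneg power_mult_distrib mult.assoc)
  qed
  let ?S = "{ms :: nat list. length ms = ?r \<and> sorted_wrt (>) ms \<and> 0 \<notin> set ms}"
  have bij: "bij_betw snd (Sigma UNIV (index_lists ?r)) ?S"
    by (auto simp: bij_betw_def inj_on_def index_lists_def image_iff)
  have abs: "(\<lambda>x. norm (f (snd x))) summable_on (Sigma UNIV (index_lists ?r))"
    unfolding Infinite_Sum.abs_summable_on_Sigma_iff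
    using summ by (auto simp: finite_index_lists sum_nf summable_on_UNIV_nonneg_real_iff)
  then have smb: "(\<lambda>x. f (snd x)) summable_on (Sigma UNIV (index_lists ?r))"
    by (rule abs_summable_summable)
  have "polylog ks z = infsum f ?S" by (simp add: polylog_def f_def[abs_def])
  also have "\<dots> = infsum (\<lambda>x. f (snd x)) (Sigma UNIV (index_lists ?r))"
    by (rule infsum_reindex_bij_betw[OF bij, symmetric])
  also have "\<dots> = (\<Sum>\<^sub>\<infinity>N. \<Sum>\<^sub>\<infinity>ms\<in>index_lists ?r N. f ms)"
    using infsum_Sigma_banach[OF smb] by simp
  also have "\<dots> = (\<Sum>\<^sub>\<infinity>N. of_real (index_coeff ks N) * z ^ N)"
    by (simp add: finite_index_lists sum_f)
  also have "\<dots> = (\<Sum>N. of_real (index_coeff ks N) * z ^ N)"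
    by (intro infsumI norm_summable_imp_has_sum[OF summ] summable_sums summable_norm_cancel[OF summ])
  finally show "(\<lambda>N. of_real (index_coeff ks N) * z ^ N) sums polylog ks z"
    using summable_sums[OF summable_norm_cancel[OF summ]] by simp
qed

lemma index_coeff_index_aux:
  assumes "w \<in> h1_words" "w \<noteq> [] \<or> c = 1" "c \<ge> 1"
  shows "index_coeff (index_aux c w) N = word_coeff w N / real N ^ (c - 1)"
  using assms
proof (induction c w arbitrary: N rule: index_aux.induct)
  case (1 c)
  then show ?case by simp
next
  case (2 c w)
  then have "w \<in> h1_words" "w \<noteq> []"
    by (auto simp: h1_words_def Cons_eq_append_conv)
  with 2 show ?case by (cases c) simp_all
next
  case (3 c w)
  then have "w \<in> h1_words"
    by (auto simp: h1_words_def Cons_eq_append_conv)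
  then have "index_coeff (index_aux 1 w) M = word_coeff w M" for M
    using "3.IH" by simp
  with 3(4) show ?case by (cases c) simp_all
qed

lemma Li_sums:
  assumes "norm z < 1" "w \<in> h1_words"
  shows "(\<lambda>N. of_real (word_coeff w N) * z ^ N) sums Li w z"
    and "summable (\<lambda>N. norm (of_real (word_coeff w N) * z ^ N))"
proof -
  have eq: "index_coeff (index_of_word w) N = word_coeff w N" for N
    using index_coeff_index_aux[of w 1 N] assms(2) by (simp add: index_of_word_def)
  show "(\<lambda>N. of_real (word_coeff w N) * z ^ N) sums Li w z"
    and "summable (\<lambda>N. norm (of_real (word_coeff w N) * z ^ N))"
    using polylog_sums[OF assms(1), of "index_of_word w"] by (simp_all add: eq Li_def)
qed

lemma Li_Nil [simp]: "norm z < 1 \<Longrightarrow> Li [] z = 1"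
proof -
  assume z: "norm z < 1"
  have "(\<lambda>N. of_real (word_coeff [] N) * z ^ N) sums Li [] z"
    by (rule Li_sums) (use z in \<open>auto simp: h1_words_def\<close>)
  moreover have "(\<lambda>N. of_real (word_coeff [] N) * z ^ N) = (\<lambda>N. if N = 0 then 1 else 0)"
    by auto
  ultimately show ?thesis using sums_unique2[OF _ sums_single[of 0 "\<lambda>_. 1::complex"]]
    by (simp add: if_distrib cong: if_cong)
qed

section \<open>Derivatives of the polylogarithms in the open unit disc\<close>

lemma Li_has_field_derivative_diffs:
  assumes "norm z < 1" "w \<in> h1_words"
  shows "(Li w has_field_derivative (\<Sum>N. diffs (\<lambda>N. of_real (word_coeff w N)) N * z ^ N)) (at z)"
    and "summable (\<lambda>N. diffs (\<lambda>N. of_real (word_coeff w N) :: complex) N * z ^ N)"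
proof -
  have s: "summable (\<lambda>N. of_real (word_coeff w N) * z ^ N)" if "norm z < 1" for z :: complex
    using Li_sums[OF that assms(2)] by (simp add: sums_iff)
  have d: "((\<lambda>z. \<Sum>N. of_real (word_coeff w N) * z ^ N) has_field_derivative
      (\<Sum>N. diffs (\<lambda>N. of_real (word_coeff w N)) N * z ^ N)) (at z)"
    by (rule termdiffs_strong'[OF s assms(1)])
  have "\<forall>\<^sub>F x in nhds z. (\<Sum>N. of_real (word_coeff w N) * x ^ N) = Li w x"
  proof -
    have "\<forall>\<^sub>F x in nhds z. x \<in> ball 0 1"
      using assms(1) by (intro eventually_nhds_in_open) auto
    then show ?thesis
      by eventually_elim (use Li_sums assms(2) in \<open>simp add: sums_iff\<close>)
  qed
  with d show "(Li w has_field_derivative (\<Sum>N. diffs (\<lambda>N. of_real (word_coeff w N)) N * z ^ N)) (at z)"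
    by (subst (asm) DERIV_cong_ev[OF refl _ refl]) auto
  show "summable (\<lambda>N. diffs (\<lambda>N. of_real (word_coeff w N) :: complex) N * z ^ N)"
    by (rule termdiff_converges[OF assms(1) s])
qed

lemma h1_words_Cons: "a # w \<in> h1_words \<longleftrightarrow> w \<in> h1_words \<and> (w = [] \<longrightarrow> a = Ly)"
  by (auto simp: h1_words_def Cons_eq_append_conv)

lemma word_coeff_0: "w \<noteq> [] \<Longrightarrow> word_coeff w 0 = 0"
proof (cases w)
  case (Cons a v)
  then show ?thesis by (cases a) auto
qed simp

text \<open>Differentiation cancels the division by N that the letter x introduces. Multiplying by z
  restores the exponents, and no constant term is lost because \<open>w\<close> is nonempty.\<close>

lemma Li_Lx_deriv:
  assumes "norm z < 1" "z \<noteq> 0" "w \<in> h1_words" "w \<noteq> []"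
  shows "(Li (Lx # w) has_field_derivative Li w z / z) (at z)"
proof -
  have h: "Lx # w \<in> h1_words" using assms by (simp add: h1_words_Cons)
  let ?d = "diffs (\<lambda>N. of_real (word_coeff (Lx # w) N) :: complex)"
  define S where "S = (\<Sum>N. ?d N * z ^ N)"
  have d: "?d N = of_real (word_coeff w (Suc N))" for N
    unfolding diffs_def word_coeff.simps of_real_divide by (simp del: of_nat_Suc)
  have "(\<lambda>N. ?d N * z ^ N * z) sums (S * z)"
    using Li_has_field_derivative_diffs(2)[OF assms(1) h] unfolding S_def
    by (intro sums_mult2 summable_sums)
  then have "(\<lambda>N. of_real (word_coeff w (Suc N)) * z ^ Suc N) sums (S * z)"
    by (simp only: d power_Suc mult_ac)
  then have "(\<lambda>N. of_real (word_coeff w N) * z ^ N) sums (S * z)"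
    by (subst (asm) sums_Suc_iff) (simp add: word_coeff_0 assms)
  then have "Li w z = S * z"
    using Li_sums(1)[OF assms(1,3)] sums_unique2 by blast
  with Li_has_field_derivative_diffs(1)[OF assms(1) h] assms(2) show ?thesis
    by (simp add: S_def)
qed

text \<open>Here differentiation leaves the partial sums of the coefficients of
  \<open>Li w z\<close>, that is, the Cauchy product with the geometric series 1 / (1 - z).\<close>

lemma Li_Ly_deriv:
  assumes "norm z < 1" "w \<in> h1_words"
  shows "(Li (Ly # w) has_field_derivative Li w z / (1 - z)) (at z)"
proof -
  have h: "Ly # w \<in> h1_words" using assms by (simp add: h1_words_Cons)
  let ?d = "diffs (\<lambda>N. of_real (word_coeff (Ly # w) N) :: complex)"
  let ?c = "\<lambda>N. of_real (word_coeff w N) * z ^ N"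
  have d: "?d N = (\<Sum>M\<le>N. of_real (word_coeff w M))" for N
    unfolding diffs_def word_coeff.simps of_real_divide
    by (simp add: lessThan_Suc_atMost del: sum.lessThan_Suc of_nat_Suc)
  have "(\<lambda>N. \<Sum>M\<le>N. ?c M * z ^ (N - M)) sums ((\<Sum>N. ?c N) * (\<Sum>N. z ^ N))"
    by (rule Cauchy_product_sums)
       (use assms Li_sums(2)[OF assms] in \<open>auto simp: norm_power summable_geometric\<close>)
  moreover have "(\<Sum>M\<le>N. ?c M * z ^ (N - M)) = ?d N * z ^ N" for N
    unfolding d sum_distrib_right by (intro sum.cong) (auto simp: mult.assoc simp flip: power_add)
  ultimately have "(\<Sum>N. ?d N * z ^ N) = Li w z / (1 - z)"
    using Li_sums(1)[OF assms] suminf_geometric[OF assms(1)] by (simp add: sums_iff)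
  with Li_has_field_derivative_diffs(1)[OF assms(1) h] show ?thesis by simp
qed

section \<open>Generating functions over words\<close>

lemma height_Nil: "height [] = 1"
  by (simp add: height_def)

lemma height_Cons:
  "height (a # w) = height w + (if a = Ly \<and> w \<noteq> [] \<and> hd w = Lx then 1 else 0)"
proof -
  let ?S = "\<lambda>w. {i. Suc i < length w \<and> w ! i = Ly \<and> w ! Suc i = Lx}"
  let ?Z = "if a = Ly \<and> w \<noteq> [] \<and> hd w = Lx then {0} else ({} :: nat set)"
  have "i \<in> ?S (a # w) \<longleftrightarrow> i \<in> Suc ` ?S w \<union> ?Z" for i
    by (cases i) (auto simp: hd_conv_nth)
  then have eq: "?S (a # w) = Suc ` ?S w \<union> ?Z" by blast
  have fin: "finite (?S w)" by (rule finite_subset[of _ "{..<length w}"]) auto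
  have "card (?S (a # w)) = card (?S w) + card ?Z"
    unfolding eq by (subst card_Un_disjoint) (auto simp: fin card_image)
  then show ?thesis by (simp add: height_def)
qed

lemma height_ge_1: "1 \<le> height w"
  by (simp add: height_def)

text \<open>Every occurrence of yx has its own y, and the final y is one more; it also has its own
  x, and an initial x is one more. These bounds make the truncated subtractions in the weights below
  exact.\<close>

lemma height_bounds:
  assumes "w \<in> h1_words" "w \<noteq> []"
  shows "height w \<le> depth w"
    and "height w \<le> Suc (count_list w Lx)"
    and "hd w = Lx \<Longrightarrow> height w \<le> count_list w Lx"
proof -
  have "height w \<le> depth w \<and> height w \<le> Suc (count_list w Lx) \<and> (hd w = Lx \<longrightarrow> height w \<le> count_list w Lx)"
    using assms
  proof (induction w)
    case (Cons a w)
    show ?case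
    proof (cases "w = []")
      case True
      with Cons(2) show ?thesis by (simp add: h1_words_Cons height_Cons height_Nil depth_def)
    next
      case False
      with Cons have IH: "height w \<le> depth w" "height w \<le> Suc (count_list w Lx)"
          "hd w = Lx \<longrightarrow> height w \<le> count_list w Lx"
        by (simp_all add: h1_words_Cons)
      show ?thesis
        by (cases a) (use IH False in \<open>auto simp: height_Cons depth_def\<close>)
    qed
  qed simp
  then show "height w \<le> depth w" "height w \<le> Suc (count_list w Lx)"
    and "hd w = Lx \<Longrightarrow> height w \<le> count_list w Lx" by auto
qed

lemma length_eq_count: "length w = count_list w Lx + depth w"
proof (induction w)
  case (Cons a w)
  then show ?case by (cases a) (auto simp: depth_def)
qed (simp add: depth_def)

text \<open>Sorted by the first letter because that letter decides both the derivative of the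
  polylogarithm and the normalisation of the weight.\<close>

definition words_from :: "letter \<Rightarrow> nat \<Rightarrow> word set" where
  "words_from a n = {w \<in> h1_words. length w = n \<and> w \<noteq> [] \<and> hd w = a}"

lemma h0_words_iff: "w \<in> h0_words \<longleftrightarrow> w = [] \<or> w \<in> h1_words \<and> hd w = Lx"
proof (cases w)
  case (Cons a v)
  show ?thesis
  proof (cases v rule: rev_cases)
    case (snoc v' b)
    with Cons show ?thesis by (auto simp: h0_words_def h1_words_def)
  qed (use Cons in \<open>auto simp: h0_words_def h1_words_def\<close>)
qed (simp add: h0_words_def)

lemma finite_letters: "finite (UNIV :: letter set)"
proof -
  have "(UNIV :: letter set) = {Lx, Ly}" using letter.exhaust by auto
  then show ?thesis by (metis finite.emptyI finite_insert)
qed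

lemma finite_words_from [simp]: "finite (words_from a n)"
proof (rule finite_subset)
  show "words_from a n \<subseteq> {w. set w \<subseteq> UNIV \<and> length w = n}" by (auto simp: words_from_def)
  show "finite {w :: word. set w \<subseteq> UNIV \<and> length w = n}"
    by (rule finite_lists_length_eq[OF finite_letters])
qed

lemma words_from_disjoint: "words_from Lx n \<inter> words_from Ly m = {}"
  by (auto simp: words_from_def)

lemma words_from_0 [simp]: "words_from a 0 = {}"
  by (auto simp: words_from_def)

lemma words_from_Lx_1 [simp]: "words_from Lx (Suc 0) = {}"
  by (auto simp: words_from_def length_Suc_conv h1_words_def)

lemma words_from_Ly_1 [simp]: "words_from Ly (Suc 0) = {[Ly]}"
  by (auto simp: words_from_def length_Suc_conv h1_words_def)

lemma words_from_Lx_Suc: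
  "words_from Lx (Suc n) = (\<lambda>w. Lx # w) ` (words_from Lx n \<union> words_from Ly n)"
proof -
  have "w \<in> words_from Lx (Suc n) \<longleftrightarrow> w \<in> (\<lambda>w. Lx # w) ` (words_from Lx n \<union> words_from Ly n)" for w
    by (cases w) (auto simp: words_from_def h1_words_Cons image_iff intro: letter.exhaust)
  then show ?thesis by blast
qed

lemma words_from_Ly_Suc:
  assumes "n > 0"
  shows "words_from Ly (Suc n) = (\<lambda>w. Ly # w) ` (words_from Lx n \<union> words_from Ly n)"
proof -
  have "w \<in> words_from Ly (Suc n) \<longleftrightarrow> w \<in> (\<lambda>w. Ly # w) ` (words_from Lx n \<union> words_from Ly n)" for w
    using assms by (cases w) (auto simp: words_from_def h1_words_Cons image_iff intro: letter.exhaust)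
  then show ?thesis by blast
qed

text \<open>The exponents in \<open>wtx\<close> (words starting with x) and \<open>wty\<close>
  (words starting with y) are such that prefixing a letter multiplies the weight by one factor: u
  for x before x, 1 for x before y, W for y before x, v for y before y.\<close>

definition wtx :: "complex \<Rightarrow> complex \<Rightarrow> complex \<Rightarrow> word \<Rightarrow> complex" where
  "wtx u v W w = u ^ (count_list w Lx - height w) * v ^ (depth w - height w) * W ^ (height w - 1)"

definition wty :: "complex \<Rightarrow> complex \<Rightarrow> complex \<Rightarrow> word \<Rightarrow> complex" where
  "wty u v W w = u ^ (Suc (count_list w Lx) - height w) * v ^ (depth w - height w) * W ^ (height w - 1)"

lemma wtx_Lx_Lx: "w \<in> words_from Lx n \<Longrightarrow> wtx u v W (Lx # w) = u * wtx u v W w"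
  using height_bounds[of w] by (auto simp: words_from_def wtx_def height_Cons Suc_diff_le depth_def)

lemma wtx_Lx_Ly: "w \<in> words_from Ly n \<Longrightarrow> wtx u v W (Lx # w) = wty u v W w"
  by (auto simp: words_from_def wtx_def wty_def height_Cons depth_def)

lemma wty_Ly_Lx: "w \<in> words_from Lx n \<Longrightarrow> wty u v W (Ly # w) = W * wtx u v W w"
  using height_ge_1[of w]
  by (cases "height w") (auto simp: words_from_def wtx_def wty_def height_Cons depth_def)

lemma wty_Ly_Ly: "w \<in> words_from Ly n \<Longrightarrow> wty u v W (Ly # w) = v * wty u v W w"
  using height_bounds[of w]
  by (auto simp: words_from_def wty_def height_Cons depth_def Suc_diff_le)

text \<open>Counting W twice, \<open>wtx\<close> is homogeneous of degree length - 2 and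
  \<open>wty\<close> of degree length - 1. This degree is the exponent of T; the shortest words xy
  and y get exponent 0.\<close>

definition FX :: "complex \<Rightarrow> complex \<Rightarrow> complex \<Rightarrow> (word \<Rightarrow> complex) \<Rightarrow> complex fps" where
  "FX u v W L = Abs_fps (\<lambda>d. \<Sum>w\<in>words_from Lx (d + 2). wtx u v W w * L w)"

definition FY :: "complex \<Rightarrow> complex \<Rightarrow> complex \<Rightarrow> (word \<Rightarrow> complex) \<Rightarrow> complex fps" where
  "FY u v W L = Abs_fps (\<lambda>d. \<Sum>w\<in>words_from Ly (d + 1). wty u v W w * L w)"

abbreviation lin :: "complex \<Rightarrow> complex fps" where
  "lin u \<equiv> fps_const u * fps_X"

abbreviation quad :: "complex \<Rightarrow> complex fps" where
  "quad W \<equiv> fps_const W * fps_X ^ 2"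

lemma lin_mult_nth: "(lin u * f) $ d = (if d = 0 then 0 else u * f $ (d - 1))"
  by (simp add: mult.assoc)

lemma quad_mult_nth: "(quad W * f) $ d = (if d < 2 then 0 else W * f $ (d - 2))"
  by (simp add: mult.assoc fps_X_power_mult_nth)

lemma FX_cong:
  "(\<And>w. w \<in> h1_words \<Longrightarrow> w \<noteq> [] \<Longrightarrow> hd w = Lx \<Longrightarrow> L w = L' w) \<Longrightarrow> FX u v W L = FX u v W L'"
  unfolding FX_def by (intro arg_cong[of _ _ Abs_fps] ext sum.cong) (auto simp: words_from_def)

lemma FY_cong:
  "(\<And>w. w \<in> h1_words \<Longrightarrow> w \<noteq> [] \<Longrightarrow> hd w = Ly \<Longrightarrow> L w = L' w) \<Longrightarrow> FY u v W L = FY u v W L'"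
  unfolding FY_def by (intro arg_cong[of _ _ Abs_fps] ext sum.cong) (auto simp: words_from_def)

lemma FX_scale: "FX u v W (\<lambda>w. c * L w) = fps_const c * FX u v W L"
  by (intro fps_ext) (simp add: FX_def sum_distrib_left mult_ac)

lemma FY_scale: "FY u v W (\<lambda>w. c * L w) = fps_const c * FY u v W L"
  by (intro fps_ext) (simp add: FY_def sum_distrib_left mult_ac)

lemma FX_sum: "FX u v W (\<lambda>w. \<Sum>i\<in>I. L i w) = (\<Sum>i\<in>I. FX u v W (L i))"
  by (intro fps_ext) (simp add: FX_def sum_distrib_left fps_sum_nth sum.swap[of _ I])

lemma FY_sum: "FY u v W (\<lambda>w. \<Sum>i\<in>I. L i w) = (\<Sum>i\<in>I. FY u v W (L i))"
  by (intro fps_ext) (simp add: FY_def sum_distrib_left fps_sum_nth sum.swap[of _ I])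

text \<open>Remove the first x and split by the next letter. \<open>L\<close> is an arbitrary
  function of words because the recursion is applied both to derivatives of polylogarithms and to
  their power series coefficients.\<close>

lemma FX_rec:
  "FX u v W L = lin u * FX u v W (\<lambda>w. L (Lx # w)) + FY u v W (\<lambda>w. L (Lx # w))"
proof (rule fps_ext)
  fix d
  have "FX u v W L $ d = (\<Sum>w\<in>words_from Lx (d + 1) \<union> words_from Ly (d + 1). wtx u v W (Lx # w) * L (Lx # w))"
    by (simp add: FX_def words_from_Lx_Suc[of "d + 1", simplified] sum.reindex)
  also have "\<dots> = (\<Sum>w\<in>words_from Lx (d + 1). wtx u v W (Lx # w) * L (Lx # w))
                + (\<Sum>w\<in>words_from Ly (d + 1). wtx u v W (Lx # w) * L (Lx # w))"
    by (rule sum.union_disjoint) (use words_from_disjoint in auto)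
  also have "(\<Sum>w\<in>words_from Ly (d + 1). wtx u v W (Lx # w) * L (Lx # w)) = FY u v W (\<lambda>w. L (Lx # w)) $ d"
    unfolding FY_def by (simp, intro sum.cong) (auto simp: wtx_Lx_Ly)
  also have "(\<Sum>w\<in>words_from Lx (d + 1). wtx u v W (Lx # w) * L (Lx # w)) = (lin u * FX u v W (\<lambda>w. L (Lx # w))) $ d"
    unfolding lin_mult_nth
    by (cases d) (auto simp: FX_def wtx_Lx_Lx sum_distrib_left mult.assoc intro!: sum.cong)
  finally show "FX u v W L $ d = (lin u * FX u v W (\<lambda>w. L (Lx # w)) + FY u v W (\<lambda>w. L (Lx # w))) $ d"
    by simp
qed

text \<open>The constant belongs to the word y, whose tail is empty.\<close>

lemma FY_rec:
  "FY u v W L = fps_const (L [Ly]) + lin v * FY u v W (\<lambda>w. L (Ly # w)) + quad W * FX u v W (\<lambda>w. L (Ly # w))"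
proof (rule fps_ext)
  fix d
  show "FY u v W L $ d = (fps_const (L [Ly]) + lin v * FY u v W (\<lambda>w. L (Ly # w))
      + quad W * FX u v W (\<lambda>w. L (Ly # w))) $ d"
  proof (cases d)
    case 0
    then show ?thesis
      by (simp add: FY_def wty_def height_Cons height_Nil depth_def quad_mult_nth lin_mult_nth)
  next
    case (Suc e)
    have "FY u v W L $ d = (\<Sum>w\<in>words_from Lx d \<union> words_from Ly d. wty u v W (Ly # w) * L (Ly # w))"
      by (simp add: FY_def Suc words_from_Ly_Suc[of "Suc e", simplified] sum.reindex)
    also have "\<dots> = (\<Sum>w\<in>words_from Lx d. wty u v W (Ly # w) * L (Ly # w))
                  + (\<Sum>w\<in>words_from Ly d. wty u v W (Ly # w) * L (Ly # w))"
      by (rule sum.union_disjoint) (use words_from_disjoint in auto)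
    also have "(\<Sum>w\<in>words_from Ly d. wty u v W (Ly # w) * L (Ly # w)) = (lin v * FY u v W (\<lambda>w. L (Ly # w))) $ d"
      unfolding lin_mult_nth
      by (auto simp: Suc FY_def wty_Ly_Ly sum_distrib_left mult.assoc intro!: sum.cong)
    also have "(\<Sum>w\<in>words_from Lx d. wty u v W (Ly # w) * L (Ly # w)) = (quad W * FX u v W (\<lambda>w. L (Ly # w))) $ d"
      unfolding quad_mult_nth
      by (cases e) (auto simp: Suc FX_def wty_Ly_Lx sum_distrib_left mult.assoc intro!: sum.cong)
    finally show ?thesis by (simp add: Suc)
  qed
qed

section \<open>The hypergeometric system\<close>

definition fps_has_deriv :: "(complex \<Rightarrow> complex fps) \<Rightarrow> complex fps \<Rightarrow> complex \<Rightarrow> bool" where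
  "fps_has_deriv f f' z \<longleftrightarrow> (\<forall>d. ((\<lambda>z. f z $ d) has_field_derivative f' $ d) (at z))"

lemma fps_has_deriv_const: "fps_has_deriv (\<lambda>_. c) 0 z"
  by (simp add: fps_has_deriv_def)

lemma fps_has_deriv_add:
  "fps_has_deriv f f' z \<Longrightarrow> fps_has_deriv g g' z \<Longrightarrow> fps_has_deriv (\<lambda>z. f z + g z) (f' + g') z"
  by (auto simp: fps_has_deriv_def intro!: derivative_eq_intros)

lemma fps_has_deriv_mult:
  assumes "fps_has_deriv f f' z" "fps_has_deriv g g' z"
  shows "fps_has_deriv (\<lambda>z. f z * g z) (f' * g z + f z * g') z"
  unfolding fps_has_deriv_def
proof
  fix d
  have "((\<lambda>z. \<Sum>i=0..d. f z $ i * g z $ (d - i)) has_field_derivative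
      (\<Sum>i=0..d. f' $ i * g z $ (d - i) + f z $ i * g' $ (d - i))) (at z)"
    using assms unfolding fps_has_deriv_def
    by (intro DERIV_sum) (auto intro!: derivative_eq_intros)
  then show "((\<lambda>z. (f z * g z) $ d) has_field_derivative (f' * g z + f z * g') $ d) (at z)"
    by (simp add: fps_mult_nth sum.distrib)
qed

lemma fps_has_deriv_reflect:
  assumes "fps_has_deriv f f' (1 - z)"
  shows "fps_has_deriv (\<lambda>z. f (1 - z)) (- f') z"
  unfolding fps_has_deriv_def
proof
  fix d
  have "((\<lambda>z. f z $ d) has_field_derivative f' $ d) (at (1 - z))"
    using assms by (simp add: fps_has_deriv_def)
  moreover have "((\<lambda>z. 1 - z :: complex) has_field_derivative -1) (at z)"
    by (auto intro!: derivative_eq_intros)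
  ultimately show "((\<lambda>z. f (1 - z) $ d) has_field_derivative (- f') $ d) (at z)"
    using DERIV_chain2[of "\<lambda>z. f z $ d" "f' $ d" "\<lambda>z. 1 - z" z "-1"] by simp
qed

lemma FX_has_deriv:
  assumes "\<And>w. w \<in> h1_words \<Longrightarrow> w \<noteq> [] \<Longrightarrow> ((\<lambda>z. L z w) has_field_derivative L' w) (at z)"
  shows "fps_has_deriv (\<lambda>z. FX u v W (L z)) (FX u v W L') z"
  unfolding fps_has_deriv_def FX_def fps_nth_Abs_fps
  by (intro allI DERIV_sum DERIV_cmult assms) (auto simp: words_from_def)

lemma FY_has_deriv:
  assumes "\<And>w. w \<in> h1_words \<Longrightarrow> w \<noteq> [] \<Longrightarrow> ((\<lambda>z. L z w) has_field_derivative L' w) (at z)"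
  shows "fps_has_deriv (\<lambda>z. FY u v W (L z)) (FY u v W L') z"
  unfolding fps_has_deriv_def FY_def fps_nth_Abs_fps
  by (intro allI DERIV_sum DERIV_cmult assms) (auto simp: words_from_def)

text \<open>\<open>hypF\<close> generates the differences \<open>Gbar0\<close> and is a hypergeometric function of the
  argument of \<open>L\<close>; \<open>hypG\<close> generates \<open>G1\<close>.\<close>

definition hypc :: "complex \<Rightarrow> complex \<Rightarrow> complex \<Rightarrow> complex fps" where
  "hypc u v W = quad W - lin u * lin v"

definition hypF :: "complex \<Rightarrow> complex \<Rightarrow> complex \<Rightarrow> (word \<Rightarrow> complex) \<Rightarrow> complex fps" where
  "hypF u v W L = 1 + hypc u v W * FX u v W L"

definition hypG :: "complex \<Rightarrow> complex \<Rightarrow> complex \<Rightarrow> (word \<Rightarrow> complex) \<Rightarrow> complex fps" where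
  "hypG u v W L = lin u * FX u v W L + FY u v W L"

lemma hypc_commute: "hypc u v W = hypc v u W"
  by (simp add: hypc_def mult.commute)

definition Li_at :: "complex \<Rightarrow> word \<Rightarrow> complex" where "Li_at z w = Li w z"

definition dLi :: "complex \<Rightarrow> word \<Rightarrow> complex" where
  "dLi z w = (if hd w = Lx then Li (tl w) z / z else Li (tl w) z / (1 - z))"

lemma Li_at_deriv:
  assumes "norm z < 1" "z \<noteq> 0" "w \<in> h1_words" "w \<noteq> []"
  shows "((\<lambda>z. Li_at z w) has_field_derivative dLi z w) (at z)"
proof (cases w)
  case (Cons a v)
  show ?thesis
    by (cases a)
       (use assms Cons Li_Lx_deriv[of z v] Li_Ly_deriv[of z v] in
         \<open>auto simp: h1_words_Cons dLi_def Li_at_def\<close>)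
qed (use assms in simp)

lemma FX_Li_deriv:
  assumes "norm z < 1" "z \<noteq> 0"
  shows "fps_has_deriv (\<lambda>z. FX u v W (Li_at z)) (fps_const (1 / z) * hypG u v W (Li_at z)) z"
proof -
  have "FX u v W (dLi z) = lin u * FX u v W (\<lambda>w. 1 / z * Li_at z w) + FY u v W (\<lambda>w. 1 / z * Li_at z w)"
    by (subst FX_rec) (simp add: dLi_def Li_at_def)
  also have "\<dots> = fps_const (1 / z) * hypG u v W (Li_at z)"
    unfolding FX_scale FY_scale hypG_def by (simp add: algebra_simps)
  finally show ?thesis
    using FX_has_deriv[of Li_at "dLi z" z u v W] Li_at_deriv[OF assms] by simp
qed

lemma FY_Li_deriv:
  assumes "norm z < 1" "z \<noteq> 0"
  shows "fps_has_deriv (\<lambda>z. FY u v W (Li_at z))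
    (fps_const (1 / (1 - z)) * (1 + lin v * FY u v W (Li_at z) + quad W * FX u v W (Li_at z))) z"
proof -
  have "FY u v W (dLi z) = fps_const (1 / (1 - z)) + lin v * FY u v W (\<lambda>w. 1 / (1 - z) * Li_at z w)
      + quad W * FX u v W (\<lambda>w. 1 / (1 - z) * Li_at z w)"
    by (subst FY_rec) (simp add: dLi_def Li_at_def assms)
  also have "\<dots> = fps_const (1 / (1 - z)) * (1 + lin v * FY u v W (Li_at z) + quad W * FX u v W (Li_at z))"
    unfolding FX_scale FY_scale by (simp add: algebra_simps)
  finally show ?thesis
    using FY_has_deriv[of Li_at "dLi z" z u v W] Li_at_deriv[OF assms] by simp
qed

lemma hypF_Li_deriv:
  assumes "norm z < 1" "z \<noteq> 0"
  shows "fps_has_deriv (\<lambda>z. hypF u v W (Li_at z))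
    (hypc u v W * fps_const (1 / z) * hypG u v W (Li_at z)) z"
proof -
  have "fps_has_deriv (\<lambda>z. 1 + hypc u v W * FX u v W (Li_at z))
    (0 + (0 * FX u v W (Li_at z) + hypc u v W * (fps_const (1 / z) * hypG u v W (Li_at z)))) z"
    by (intro fps_has_deriv_add fps_has_deriv_mult fps_has_deriv_const FX_Li_deriv assms)
  then show ?thesis unfolding hypF_def by (simp add: mult.assoc)
qed

lemma hypG_Li_deriv:
  assumes "norm z < 1" "z \<noteq> 0"
  shows "fps_has_deriv (\<lambda>z. hypG u v W (Li_at z))
    (fps_const (1 / z) * lin u * hypG u v W (Li_at z)
     + fps_const (1 / (1 - z)) * (hypF u v W (Li_at z) + lin v * hypG u v W (Li_at z))) z"
proof -
  have "fps_has_deriv (\<lambda>z. lin u * FX u v W (Li_at z) + FY u v W (Li_at z))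
    ((0 * FX u v W (Li_at z) + lin u * (fps_const (1 / z) * hypG u v W (Li_at z)))
     + fps_const (1 / (1 - z)) * (1 + lin v * FY u v W (Li_at z) + quad W * FX u v W (Li_at z))) z"
    by (intro fps_has_deriv_add fps_has_deriv_mult fps_has_deriv_const FX_Li_deriv FY_Li_deriv assms)
  moreover have "1 + lin v * FY u v W (Li_at z) + quad W * FX u v W (Li_at z)
      = hypF u v W (Li_at z) + lin v * hypG u v W (Li_at z)"
    by (simp add: hypF_def hypG_def hypc_def algebra_simps)
  moreover have "0 * FX u v W (Li_at z) + lin u * (fps_const (1 / z) * hypG u v W (Li_at z))
      = fps_const (1 / z) * lin u * hypG u v W (Li_at z)"
    by (simp add: mult_ac)
  ultimately show ?thesis by (simp only: hypG_def[symmetric])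
qed

text \<open>Read the equations for (F, G) as a linear system with matrix A. For the companion
  functions H, K at 1 - z the row R = (H, c K) satisfies R' = - R A, so its pairing with (F, G) has
  derivative zero.\<close>

definition wronskian :: "complex \<Rightarrow> complex \<Rightarrow> complex \<Rightarrow> (word \<Rightarrow> complex) \<Rightarrow> (word \<Rightarrow> complex) \<Rightarrow> complex fps" where
  "wronskian u v W L L' = hypF u v W L * hypF v u W L' + hypc u v W * (hypG u v W L * hypG v u W L')"

text \<open>To be read with a = 1 / z, b = 1 / (1 - z), U = u T, V = v T. Over letters instead of
  power series the cancellation is plain ring normalisation.\<close>

lemma wronskian_deriv_cancel:
  fixes F :: "'a :: comm_ring_1"
  shows "(c * a * G) * F' + F * (- (c * b * G')) + (0 * (G * G') + c * ((a * U * G + b * (F + V * G)) * G'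
        + G * (- (b * V * G' + a * (F' + U * G'))))) = 0"
  by (simp add: algebra_simps)

lemma wronskian_deriv:
  assumes "norm z < 1" "norm (1 - z) < 1"
  shows "fps_has_deriv (\<lambda>z. wronskian u v W (Li_at z) (Li_at (1 - z))) 0 z"
proof -
  let ?c = "hypc u v W"
  let ?F = "hypF u v W (Li_at z)" and ?G = "hypG u v W (Li_at z)"
  let ?F' = "hypF v u W (Li_at (1 - z))" and ?G' = "hypG v u W (Li_at (1 - z))"
  let ?a = "fps_const (1 / z)" and ?b = "fps_const (1 / (1 - z))"
  have z: "z \<noteq> 0" "1 - z \<noteq> 0" using assms by auto
  have F: "fps_has_deriv (\<lambda>z. hypF u v W (Li_at z)) (?c * ?a * ?G) z"
    by (rule hypF_Li_deriv) (use assms z in auto)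
  have G: "fps_has_deriv (\<lambda>z. hypG u v W (Li_at z)) (?a * lin u * ?G + ?b * (?F + lin v * ?G)) z"
    by (rule hypG_Li_deriv) (use assms z in auto)
  have F': "fps_has_deriv (\<lambda>z. hypF v u W (Li_at (1 - z))) (- (?c * ?b * ?G')) z"
    using fps_has_deriv_reflect[OF hypF_Li_deriv[OF assms(2) z(2), of v u W]]
    by (simp add: hypc_commute)
  have G': "fps_has_deriv (\<lambda>z. hypG v u W (Li_at (1 - z))) (- (?b * lin v * ?G' + ?a * (?F' + lin u * ?G'))) z"
    using fps_has_deriv_reflect[OF hypG_Li_deriv[OF assms(2) z(2), of v u W]] by simp
  have "fps_has_deriv (\<lambda>z. wronskian u v W (Li_at z) (Li_at (1 - z)))
    ((?c * ?a * ?G) * ?F' + ?F * (- (?c * ?b * ?G'))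
     + (0 * (?G * ?G') + ?c * ((?a * lin u * ?G + ?b * (?F + lin v * ?G)) * ?G'
        + ?G * (- (?b * lin v * ?G' + ?a * (?F' + lin u * ?G')))))) z"
    unfolding wronskian_def
    by (intro fps_has_deriv_add fps_has_deriv_mult fps_has_deriv_const F G F' G')
  then show ?thesis unfolding wronskian_deriv_cancel .
qed

section \<open>Constancy of the Wronskian where z and 1 - z both lie in the unit disc\<close>

definition lens :: "complex set" where "lens = ball 0 1 \<inter> ball 1 1"

lemma lens_iff: "z \<in> lens \<longleftrightarrow> norm z < 1 \<and> norm (1 - z) < 1"
  by (simp add: lens_def dist_norm)

lemma of_real_in_lens: "0 < t \<Longrightarrow> t < 1 \<Longrightarrow> of_real t \<in> lens"
  using norm_of_real[of "1 - t", where ?'a = complex] by (simp add: lens_iff)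

lemma wronskian_constant:
  assumes "z \<in> lens" "z' \<in> lens"
  shows "wronskian u v W (Li_at z) (Li_at (1 - z)) = wronskian u v W (Li_at z') (Li_at (1 - z'))"
proof (rule fps_ext)
  fix d
  have "\<exists>c. \<forall>z\<in>lens. wronskian u v W (Li_at z) (Li_at (1 - z)) $ d = c"
  proof (rule has_field_derivative_zero_constant)
    show "convex lens" by (auto simp: lens_def intro!: convex_Int)
    fix z assume "z \<in> lens"
    then show "((\<lambda>z. wronskian u v W (Li_at z) (Li_at (1 - z)) $ d) has_field_derivative 0) (at z within lens)"
      using wronskian_deriv[of z u v W]
      by (auto simp: lens_iff fps_has_deriv_def intro: has_field_derivative_at_within)
  qed
  with assms show "wronskian u v W (Li_at z) (Li_at (1 - z)) $ d
      = wronskian u v W (Li_at z') (Li_at (1 - z')) $ d" by metis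
qed

text \<open>The coefficients of the hypergeometric series, shifted by \<open>M\<close> in the lower parameter.\<close>

fun hyp_coeff :: "complex \<Rightarrow> complex \<Rightarrow> complex \<Rightarrow> nat \<Rightarrow> nat \<Rightarrow> complex fps" where
  "hyp_coeff u v W M 0 = 1"
| "hyp_coeff u v W M (Suc N) = hyp_coeff u v W M N
     * (of_nat (N ^ 2) + of_nat N * (lin v - lin u) + hypc u v W)
     * (inverse (of_nat (N + 1 + M) - lin u) * fps_const (1 / of_nat (N + 1)))"

lemma inverse_lin: "n > 0 \<Longrightarrow> (of_nat n - lin u) * inverse (of_nat n - lin u) = 1"
  by (subst mult.commute, rule inverse_mult_eq_1) (simp add: fps_of_nat[symmetric])

text \<open>The quadratic factor is (N + a - u)(N + b - u) for a + b = u + v and a b = W (parameters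
  scaled by T), written without the roots.\<close>

lemma hyp_coeff_Suc:
  "of_nat (N + 1) * (of_nat (N + 1 + M) - lin u) * hyp_coeff u v W M (Suc N)
   = (of_nat (N ^ 2) + of_nat N * (lin v - lin u) + hypc u v W) * hyp_coeff u v W M N"
proof -
  let ?q = "of_nat (N ^ 2) + of_nat N * (lin v - lin u) + hypc u v W"
  have 1: "of_nat (N + 1) * fps_const (1 / of_nat (N + 1)) = (1 :: complex fps)"
    by (simp add: fps_of_nat[symmetric] del: of_nat_add of_nat_Suc fps_of_nat)
  have "of_nat (N + 1) * (of_nat (N + 1 + M) - lin u) * hyp_coeff u v W M (Suc N)
    = hyp_coeff u v W M N * ?q * ((of_nat (N + 1) * fps_const (1 / of_nat (N + 1)))
      * ((of_nat (N + 1 + M) - lin u) * inverse (of_nat (N + 1 + M) - lin u)))"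
    unfolding hyp_coeff.simps by (simp only: mult_ac)
  also have "\<dots> = ?q * hyp_coeff u v W M N"
    unfolding 1 by (subst inverse_lin) simp_all
  finally show ?thesis .
qed

section \<open>Power series coefficients of the generating functions\<close>

abbreviation cw :: "nat \<Rightarrow> word \<Rightarrow> complex" where
  "cw N w \<equiv> of_real (word_coeff w N)"

lemma FX_cw_0: "FX u v W (cw 0) = 0"
proof -
  have "FX u v W (cw 0) = FX u v W (\<lambda>w. 0 * cw 0 w)" by (rule FX_cong) (simp add: word_coeff_0)
  then show ?thesis by (simp only: FX_scale) simp
qed

lemma FY_cw_0: "FY u v W (cw 0) = 0"
proof -
  have "FY u v W (cw 0) = FY u v W (\<lambda>w. 0 * cw 0 w)" by (rule FY_cong) (simp add: word_coeff_0)
  then show ?thesis by (simp only: FY_scale) simp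
qed

lemma FX_cw: "of_nat N * FX u v W (cw N) = hypG u v W (cw N)"
proof (cases "N = 0")
  case False
  have "FX u v W (cw N) = lin u * FX u v W (\<lambda>w. 1 / of_nat N * cw N w) + FY u v W (\<lambda>w. 1 / of_nat N * cw N w)"
    by (subst FX_rec) simp
  also have "\<dots> = fps_const (1 / of_nat N) * hypG u v W (cw N)"
    unfolding FX_scale FY_scale hypG_def by (simp add: algebra_simps)
  finally have "of_nat N * FX u v W (cw N) = (of_nat N * fps_const (1 / of_nat N)) * hypG u v W (cw N)"
    by (simp add: mult.assoc)
  also have "of_nat N * fps_const (1 / of_nat N) = (1 :: complex fps)"
    using False by (simp add: fps_of_nat[symmetric] del: fps_of_nat)
  finally show ?thesis by simp
qed (simp add: hypG_def FX_cw_0 FY_cw_0)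

lemma FY_cw:
  assumes "N > 0"
  shows "of_nat N * FY u v W (cw N) = 1 + (\<Sum>M<N. lin v * FY u v W (cw M) + quad W * FX u v W (cw M))"
proof -
  let ?S = "\<lambda>w. \<Sum>M<N. cw M w"
  have "FY u v W (cw N) = fps_const (1 / of_nat N) + lin v * FY u v W (\<lambda>w. 1 / of_nat N * ?S w)
      + quad W * FX u v W (\<lambda>w. 1 / of_nat N * ?S w)"
    using assms by (subst FY_rec) (simp add: sum.If_cases lessThan_def)
  also have "\<dots> = fps_const (1 / of_nat N) * (1 + lin v * FY u v W ?S + quad W * FX u v W ?S)"
    unfolding FX_scale FY_scale by (simp add: algebra_simps)
  also have "1 + lin v * FY u v W ?S + quad W * FX u v W ?S
     = 1 + (\<Sum>M<N. lin v * FY u v W (cw M) + quad W * FX u v W (cw M))"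
    unfolding FX_sum FY_sum by (simp add: sum_distrib_left sum.distrib)
  finally have "of_nat N * FY u v W (cw N) = (of_nat N * fps_const (1 / of_nat N)) *
      (1 + (\<Sum>M<N. lin v * FY u v W (cw M) + quad W * FX u v W (cw M)))"
    by (simp add: mult.assoc)
  also have "of_nat N * fps_const (1 / of_nat N) = (1 :: complex fps)"
    using assms by (simp add: fps_of_nat[symmetric] del: fps_of_nat)
  finally show ?thesis by simp
qed

text \<open>Subtracting \<open>FY_cw\<close> at N from \<open>FY_cw\<close> at N + 1 removes the
  partial sums, and \<open>FX_cw\<close> expresses the y-part as N - u times the x-part. At
  \<open>N = 0\<close> there is nothing to subtract, so the constant 1 survives.\<close>

lemma FX_cw_Suc:
  "of_nat (N + 1) * (of_nat (N + 1) - lin u) * FX u v W (cw (Suc N))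
   = (if N = 0 then 1 else 0) + (of_nat (N ^ 2) + of_nat N * (lin v - lin u) + hypc u v W) * FX u v W (cw N)"
proof -
  let ?X = "\<lambda>N. FX u v W (cw N)" and ?Y = "\<lambda>N. FY u v W (cw N)"
  have Y: "?Y N = (of_nat N - lin u) * ?X N" for N
    using FX_cw[of N u v W] by (simp add: hypG_def algebra_simps)
  have rec: "of_nat (Suc N) * ?Y (Suc N) = (if N = 0 then 1 else 0) + of_nat N * ?Y N + lin v * ?Y N + quad W * ?X N"
  proof (cases "N = 0")
    case True
    then show ?thesis by (simp add: FY_cw FX_cw_0 FY_cw_0 del: of_nat_Suc)
  next
    case False
    have "of_nat (Suc N) * ?Y (Suc N) = of_nat N * ?Y N + (lin v * ?Y N + quad W * ?X N)"
      unfolding FY_cw[of "Suc N" u v W, OF zero_less_Suc] sum.lessThan_Suc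
      using False by (subst FY_cw[of N u v W]) (simp_all only: add.assoc neq0_conv)
    with False show ?thesis by (simp del: of_nat_Suc add: add.assoc)
  qed
  have "of_nat (N + 1) * (of_nat (N + 1) - lin u) * ?X (Suc N) = of_nat (Suc N) * ?Y (Suc N)"
    by (simp add: Y[of "Suc N"] mult.assoc)
  also have "\<dots> = (if N = 0 then 1 else 0) + ((of_nat N + lin v) * (of_nat N - lin u) + quad W) * ?X N"
    unfolding rec by (simp add: Y[of N] algebra_simps)
  also have "(of_nat N + lin v) * (of_nat N - lin u) + quad W
      = of_nat (N ^ 2) + of_nat N * (lin v - lin u) + hypc u v W"
    by (simp add: hypc_def algebra_simps power2_eq_square)
  finally show ?thesis .
qed

text \<open>Multiplication by c turns the inhomogeneous 1 at \<open>N = 0\<close> into the numerator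
  c of the first hypergeometric coefficient. From then on both sides obey the same recursion, whose
  leading factor can be cancelled.\<close>

lemma hypc_FX_cw_Suc: "hypc u v W * FX u v W (cw (Suc N)) = hyp_coeff u v W 0 (Suc N)"
proof -
  have cancel: "a = b" if "of_nat (N + 1) * (of_nat (N + 1) - lin u) * a
       = of_nat (N + 1) * (of_nat (N + 1) - lin u) * b" for a b :: "complex fps" and N
  proof -
    have "of_nat (N + 1) - lin u \<noteq> 0" using inverse_lin[of "N + 1" u] by auto
    moreover have "of_nat (N + 1) \<noteq> (0 :: complex fps)" by (simp del: of_nat_add of_nat_Suc)
    ultimately show ?thesis using that by (simp only: mult_cancel_left mult_eq_0_iff) simp
  qed
  show ?thesis
  proof (induction N)
    case 0
    have "of_nat (0 + 1) * (of_nat (0 + 1) - lin u) * (hypc u v W * FX u v W (cw (Suc 0)))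
        = of_nat (0 + 1) * (of_nat (0 + 1) - lin u) * hyp_coeff u v W 0 (Suc 0)"
      using FX_cw_Suc[of 0 u v W] hyp_coeff_Suc[of 0 0 u v W]
      by (simp add: FX_cw_0 mult.left_commute del: hyp_coeff.simps(2))
    then show ?case by (rule cancel)
  next
    case (Suc N)
    let ?q = "of_nat ((Suc N) ^ 2) + of_nat (Suc N) * (lin v - lin u) + hypc u v W"
    have "of_nat (Suc N + 1) * (of_nat (Suc N + 1) - lin u) * (hypc u v W * FX u v W (cw (Suc (Suc N))))
       = hypc u v W * (of_nat (Suc N + 1) * (of_nat (Suc N + 1) - lin u) * FX u v W (cw (Suc (Suc N))))"
      by (simp only: mult_ac)
    also have "\<dots> = ?q * (hypc u v W * FX u v W (cw (Suc N)))"
      unfolding FX_cw_Suc by (simp only: nat.distinct if_False add_0_left mult.left_commute)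
    also have "\<dots> = of_nat (Suc N + 1) * (of_nat (Suc N + 1 + 0) - lin u) * hyp_coeff u v W 0 (Suc (Suc N))"
      unfolding hyp_coeff_Suc Suc ..
    finally show ?case unfolding add_0_right by (rule cancel[where N = "Suc N"])
  qed
qed

lemma hypF_cw: "(if N = 0 then 1 else 0) + hypc u v W * FX u v W (cw N) = hyp_coeff u v W 0 N"
  by (cases N) (simp_all add: FX_cw_0 hypc_FX_cw_Suc del: hyp_coeff.simps(2))

lemma Li_at_sums:
  assumes "norm z < 1"
  shows "(\<lambda>N. FX u v W (cw N) $ d * z ^ N) sums (FX u v W (Li_at z) $ d)"
    and "(\<lambda>N. FY u v W (cw N) $ d * z ^ N) sums (FY u v W (Li_at z) $ d)"
proof -
  have *: "(\<lambda>N. (\<Sum>w\<in>words_from a n. c w * cw N w) * z ^ N) sums (\<Sum>w\<in>words_from a n. c w * Li_at z w)"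
    for c a n
    unfolding sum_distrib_right mult.assoc Li_at_def
    by (intro sums_sum sums_mult Li_sums(1)[OF assms]) (auto simp: words_from_def)
  show "(\<lambda>N. FX u v W (cw N) $ d * z ^ N) sums (FX u v W (Li_at z) $ d)"
    and "(\<lambda>N. FY u v W (cw N) $ d * z ^ N) sums (FY u v W (Li_at z) $ d)"
    using * by (simp_all add: FX_def FY_def)
qed

lemma fps_mult_nth_sums:
  fixes z :: complex
  assumes "\<And>d. (\<lambda>N. f N $ d * z ^ N) sums (F $ d)"
  shows "(\<lambda>N. (c * f N) $ d * z ^ N) sums ((c * F) $ d)"
  unfolding fps_mult_nth sum_distrib_right mult.assoc
  by (intro sums_sum sums_mult assms)

lemma hypF_sums:
  assumes "norm z < 1"
  shows "(\<lambda>N. hyp_coeff u v W 0 N $ d * z ^ N) sums (hypF u v W (Li_at z) $ d)"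
proof -
  have "(\<lambda>N. (if N = 0 then (1 :: complex fps) $ d else 0)) sums ((1 :: complex fps) $ d)"
    by (rule sums_single)
  then have "(\<lambda>N. (if N = 0 then 1 $ d else 0) + (hypc u v W * FX u v W (cw N)) $ d * z ^ N)
      sums (1 $ d + (hypc u v W * FX u v W (Li_at z)) $ d)"
    by (intro sums_add fps_mult_nth_sums Li_at_sums[OF assms])
  moreover have "(if N = 0 then 1 $ d else 0) + (hypc u v W * FX u v W (cw N)) $ d * z ^ N
      = hyp_coeff u v W 0 N $ d * z ^ N" for N
    by (cases "N = 0") (simp_all add: hypF_cw[symmetric] FX_cw_0)
  ultimately show ?thesis by (simp add: hypF_def)
qed

lemma hypG_sums:
  assumes "norm z < 1"
  shows "(\<lambda>N. hypG u v W (cw N) $ d * z ^ N) sums (hypG u v W (Li_at z) $ d)"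
  unfolding hypG_def fps_add_nth distrib_right
  by (intro sums_add fps_mult_nth_sums Li_at_sums[OF assms])

text \<open>The relation c G = z F' read off coefficientwise. It links G to the hypergeometric
  coefficients through the product c G, so the limit of G at 1 below carries the factor c.\<close>

lemma hypc_hypG_sums:
  assumes "norm z < 1"
  shows "(\<lambda>N. of_nat N * hyp_coeff u v W 0 N $ d * z ^ N) sums ((hypc u v W * hypG u v W (Li_at z)) $ d)"
proof -
  have "hypc u v W * hypG u v W (cw N) = of_nat N * hyp_coeff u v W 0 N" for N
    by (cases "N = 0")
       (simp_all add: FX_cw[symmetric] hypF_cw[symmetric] mult.left_commute)
  then have "(hypc u v W * hypG u v W (cw N)) $ d = of_nat N * hyp_coeff u v W 0 N $ d" for N
    by (simp add: fps_of_nat[symmetric] del: fps_of_nat)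
  then show ?thesis
    using fps_mult_nth_sums[OF hypG_sums[OF assms], of "hypc u v W" u v W d] by simp
qed

section \<open>Gauss's contiguous relation\<close>

text \<open>Submultiplicative for every \<open>D\<close>, so it bounds the coefficients of long products; \<open>r\<close> will be small
  in terms of \<open>u\<close>, \<open>v\<close>, \<open>W\<close>.\<close>

definition fps_tnorm :: "real \<Rightarrow> nat \<Rightarrow> complex fps \<Rightarrow> real" where
  "fps_tnorm r D f = (\<Sum>d\<le>D. norm (f $ d) * r ^ d)"

context
  fixes r :: real and D :: nat
  assumes r: "r > 0"
begin

lemma fps_tnorm_nonneg: "0 \<le> fps_tnorm r D f"
  unfolding fps_tnorm_def using r by (intro sum_nonneg) auto

lemma fps_tnorm_add: "fps_tnorm r D (f + g) \<le> fps_tnorm r D f + fps_tnorm r D g"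
  unfolding fps_tnorm_def sum.distrib[symmetric] distrib_right[symmetric]
  using r by (intro sum_mono mult_right_mono) (auto intro: norm_triangle_ineq)

lemma fps_tnorm_minus: "fps_tnorm r D (- f) = fps_tnorm r D f"
  unfolding fps_tnorm_def by simp

lemma fps_tnorm_diff: "fps_tnorm r D (f - g) \<le> fps_tnorm r D f + fps_tnorm r D g"
  using fps_tnorm_add[of f "- g"] by (simp add: fps_tnorm_minus)

lemma fps_tnorm_mult: "fps_tnorm r D (f * g) \<le> fps_tnorm r D f * fps_tnorm r D g"
proof -
  let ?a = "\<lambda>i. norm (f $ i) * r ^ i" and ?b = "\<lambda>i. norm (g $ i) * r ^ i"
  have "fps_tnorm r D (f * g) \<le> (\<Sum>d\<le>D. \<Sum>i\<le>d. ?a i * ?b (d - i))"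
    unfolding fps_tnorm_def
  proof (rule sum_mono)
    fix d
    have "norm ((f * g) $ d) * r ^ d \<le> (\<Sum>i\<le>d. norm (f $ i * g $ (d - i))) * r ^ d"
      unfolding fps_mult_nth atLeast0AtMost using r by (intro mult_right_mono norm_sum) auto
    also have "\<dots> = (\<Sum>i\<le>d. ?a i * ?b (d - i))"
      unfolding sum_distrib_right
      by (intro sum.cong) (auto simp: norm_mult simp flip: power_add)
    finally show "norm ((f * g) $ d) * r ^ d \<le> (\<Sum>i\<le>d. ?a i * ?b (d - i))" .
  qed
  also have "\<dots> = (\<Sum>(i, j)\<in>{(i, j). i + j \<le> D}. ?a i * ?b j)"
    by (rule sum.triangle_reindex_eq[symmetric])
  also have "\<dots> \<le> (\<Sum>(i, j)\<in>{..D} \<times> {..D}. ?a i * ?b j)"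
    using r by (intro sum_mono2) auto
  also have "\<dots> = fps_tnorm r D f * fps_tnorm r D g"
    by (simp add: fps_tnorm_def sum_product sum.cartesian_product)
  finally show ?thesis .
qed

lemma fps_tnorm_const: "fps_tnorm r D (fps_const c) = norm c"
proof -
  have "fps_tnorm r D (fps_const c) = (\<Sum>d\<le>D. if d = 0 then norm c else 0)"
    unfolding fps_tnorm_def by (intro sum.cong) auto
  then show ?thesis by simp
qed

lemma fps_tnorm_of_nat: "fps_tnorm r D (of_nat n) = real n"
  using fps_tnorm_const[of "of_nat n"] by (simp add: fps_of_nat)

lemma fps_tnorm_monom: "fps_tnorm r D (fps_const c * fps_X ^ k) \<le> norm c * r ^ k"
proof -
  have "fps_tnorm r D (fps_const c * fps_X ^ k) = (\<Sum>d\<le>D. if d = k then norm c * r ^ k else 0)"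
    unfolding fps_tnorm_def by (intro sum.cong) (auto simp: fps_X_power_nth)
  then show ?thesis using r by simp
qed

lemma norm_nth_le_fps_tnorm:
  assumes "d \<le> D"
  shows "norm (f $ d) \<le> fps_tnorm r D f / r ^ d"
proof -
  have "norm (f $ d) * r ^ d \<le> fps_tnorm r D f"
    unfolding fps_tnorm_def using r assms
    by (intro member_le_sum[where f = "\<lambda>d. norm (f $ d) * r ^ d"]) auto
  then show ?thesis using r by (simp add: field_simps)
qed

text \<open>The inverse I of n - u T satisfies n I = 1 + u T I, hence n |I| <= 1 + e |I|, which can
  be solved for |I| because e < n.\<close>

lemma fps_tnorm_inverse_lin:
  assumes "fps_tnorm r D (lin u) \<le> e" "e < real n"
  shows "fps_tnorm r D (inverse (of_nat n - lin u)) \<le> 1 / (real n - e)"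
proof -
  let ?I = "inverse (of_nat n - lin u)"
  have e0: "0 \<le> e" using assms(1) fps_tnorm_nonneg[of "lin u"] by linarith
  then have n0: "n > 0" using assms(2) by (cases n) auto
  have "?I = fps_const (1 / of_nat n) * (of_nat n * ?I)"
    using n0 by (simp add: fps_of_nat[symmetric] mult.assoc[symmetric] del: fps_of_nat)
  also have "of_nat n * ?I = 1 + lin u * ?I"
    using inverse_lin[OF n0, of u] by (simp add: left_diff_distrib algebra_simps)
  finally have "fps_tnorm r D ?I = fps_tnorm r D (fps_const (1 / of_nat n) * (1 + lin u * ?I))" by simp
  also have "\<dots> \<le> fps_tnorm r D (fps_const (1 / of_nat n)) * fps_tnorm r D (1 + lin u * ?I)"
    by (rule fps_tnorm_mult)
  also have "\<dots> \<le> 1 / real n * (1 + e * fps_tnorm r D ?I)"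
  proof -
    have "fps_tnorm r D (1 + lin u * ?I) \<le> fps_tnorm r D 1 + fps_tnorm r D (lin u * ?I)"
      by (rule fps_tnorm_add)
    also have "\<dots> \<le> 1 + fps_tnorm r D (lin u) * fps_tnorm r D ?I"
      using fps_tnorm_mult[of "lin u" ?I] fps_tnorm_const[of 1] by simp
    also have "\<dots> \<le> 1 + e * fps_tnorm r D ?I"
      using assms(1) by (intro add_left_mono mult_right_mono fps_tnorm_nonneg)
    finally show ?thesis unfolding fps_tnorm_const
      by (simp add: norm_divide divide_right_mono)
  qed
  finally have "real n * fps_tnorm r D ?I \<le> 1 + e * fps_tnorm r D ?I"
    using n0 by (simp add: field_simps)
  then show ?thesis using assms(2) by (simp add: field_simps)
qed

text \<open>For small parameters the quotient of consecutive coefficients is about 1 - 2 / N or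
  smaller, so it stays below (N / (N + 1))^(3/2). The exponent exceeds 1, which gives summability
  and lets N times the coefficient tend to 0; its distance from 2 leaves room for perturbations of
  size 1/20.\<close>

lemma fps_tnorm_hyp_coeff:
  assumes u: "fps_tnorm r D (lin u) \<le> 1 / 20" and v: "fps_tnorm r D (lin v) \<le> 1 / 20"
    and W: "fps_tnorm r D (quad W) \<le> 1 / 20"
    and N: "N \<ge> 1"
  shows "fps_tnorm r D (hyp_coeff u v W M N) \<le> 1 / real (M + 1) * real N powr (-3/2)"
proof -
  let ?n = "fps_tnorm r D"
  have step: "?n (hyp_coeff u v W M (Suc N)) \<le> ?n (hyp_coeff u v W M N) *
      ((real N ^ 2 + real N / 10 + 1 / 10) / ((real (N + M) + 19/20) * real (N + 1)))" for N M
  proof -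
    have "?n (lin v - lin u) \<le> 1 / 10"
      using fps_tnorm_diff[of "lin v" "lin u"] u v by linarith
    then have 1: "?n (of_nat N * (lin v - lin u)) \<le> real N * (1 / 10)"
      using fps_tnorm_mult[of "of_nat N" "lin v - lin u"]
      by (smt (verit) fps_tnorm_of_nat mult_left_mono of_nat_0_le_iff)
    have "?n (lin u * lin v) \<le> (1 / 20) * (1 / 20)"
      using fps_tnorm_mult[of "lin u" "lin v"] mult_mono[OF u v] fps_tnorm_nonneg by fastforce
    then have 2: "?n (hypc u v W) \<le> 1 / 10"
      using fps_tnorm_diff[of "quad W" "lin u * lin v"] W unfolding hypc_def by linarith
    have a: "?n (of_nat (N ^ 2) + of_nat N * (lin v - lin u) + hypc u v W) \<le> real N ^ 2 + real N / 10 + 1 / 10"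
      using fps_tnorm_add[of "of_nat (N ^ 2) + of_nat N * (lin v - lin u)" "hypc u v W"]
        fps_tnorm_add[of "of_nat (N ^ 2)" "of_nat N * (lin v - lin u)"] 1 2 fps_tnorm_of_nat[of "N ^ 2"]
      by simp
    have "?n (inverse (of_nat (N + 1 + M) - lin u) * fps_const (1 / of_nat (N + 1)))
        \<le> ?n (inverse (of_nat (N + 1 + M) - lin u)) * (1 / real (N + 1))"
      using fps_tnorm_mult[of "inverse (of_nat (N + 1 + M) - lin u)" "fps_const (1 / of_nat (N + 1))"]
      unfolding fps_tnorm_const by (simp add: norm_divide del: of_nat_Suc of_nat_add)
    also have "\<dots> \<le> (1 / (real (N + 1 + M) - 1 / 20)) * (1 / real (N + 1))"
      by (intro mult_right_mono fps_tnorm_inverse_lin[OF u]) auto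
    also have "\<dots> = 1 / ((real (N + M) + 19/20) * real (N + 1))"
      by (simp add: field_simps)
    finally have b: "?n (inverse (of_nat (N + 1 + M) - lin u) * fps_const (1 / of_nat (N + 1)))
        \<le> 1 / ((real (N + M) + 19/20) * real (N + 1))" .
    have "?n (hyp_coeff u v W M (Suc N)) \<le> ?n (hyp_coeff u v W M N) *
        ?n (of_nat (N ^ 2) + of_nat N * (lin v - lin u) + hypc u v W) *
        ?n (inverse (of_nat (N + 1 + M) - lin u) * fps_const (1 / of_nat (N + 1)))"
      unfolding hyp_coeff.simps
      by (rule order_trans[OF fps_tnorm_mult mult_right_mono[OF fps_tnorm_mult fps_tnorm_nonneg]])
    also have "\<dots> \<le> ?n (hyp_coeff u v W M N) * (real N ^ 2 + real N / 10 + 1 / 10) *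
        (1 / ((real (N + M) + 19/20) * real (N + 1)))"
      by (intro mult_mono mult_left_mono a b mult_nonneg_nonneg fps_tnorm_nonneg) auto
    finally show ?thesis by simp
  qed
  show ?thesis using N
  proof (induction N rule: dec_induct)
    case base
    \<comment> \<open>The gain 1 / (M + 1) comes entirely from this first step, whose numerator is
      only c. The later steps bound the quotient by its value at M = 0.\<close>
    have "?n (hyp_coeff u v W M 1) \<le> 1 * ((1 / 10) / (real M + 19/20))"
      using step[of M 0] fps_tnorm_const[of 1] by simp
    also have "\<dots> \<le> 1 / real (M + 1)" by (simp add: field_simps)
    finally show ?case by simp
  next
    case (step N)
    have N: "real N \<ge> 1" using step by simp
    have q: "(real N ^ 2 + real N / 10 + 1 / 10) / ((real (N + M) + 19/20) * real (N + 1))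
        \<le> (real N / real (N + 1)) powr (3/2)" (is "?q \<le> ?p")
    proof -
      define x where "x = real N"
      have x: "x \<ge> 1" using N by (simp add: x_def)
      have "?q \<le> (x ^ 2 + x / 10 + 1 / 10) / ((x + 19/20) * (x + 1))"
        unfolding x_def by (intro divide_left_mono mult_mono) (auto intro!: mult_pos_pos add_nonneg_pos)
      also have "\<dots> \<le> ?p"
      \<comment> \<open>Squaring removes the half-integer exponent and leaves a polynomial
        inequality for x >= 1.\<close>
      proof (rule power2_le_imp_le)
        have "(x\<^sup>2 + x / 10 + 1 / 10)\<^sup>2 * (x + 1) \<le> x ^ 3 * (x + 19 / 20)\<^sup>2"
        proof -
          have "x ^ 2 \<le> x ^ 4" "x \<le> x ^ 4" "1 \<le> x ^ 4" "0 \<le> x ^ 3"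
            using power_increasing[of 2 4 x] power_increasing[of 1 4 x] power_increasing[of 0 4 x] x by auto
          \<comment> \<open>The negative coefficients add up to 27/100 in absolute value, less than
            7/10.\<close>
          moreover have "x ^ 3 * (x + 19 / 20)\<^sup>2 - (x\<^sup>2 + x / 10 + 1 / 10)\<^sup>2 * (x + 1)
             = 7/10 * x ^ 4 + 197/400 * x ^ 3 - 23/100 * x ^ 2 - 3/100 * x - 1/100"
            by (simp add: power2_eq_square power3_eq_cube power4_eq_xxxx field_simps)
          ultimately show ?thesis by linarith
        qed
        moreover have "((x ^ 2 + x / 10 + 1 / 10) / ((x + 19/20) * (x + 1)))\<^sup>2 \<le> x ^ 3 / (x + 1) ^ 3" if "(x\<^sup>2 + x / 10 + 1 / 10)\<^sup>2 * (x + 1) \<le> x ^ 3 * (x + 19 / 20)\<^sup>2"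
        proof -
          have "(x\<^sup>2 + x / 10 + 1 / 10)\<^sup>2 * (x + 1) ^ 3 \<le> x ^ 3 * ((x + 19/20) * (x + 1))\<^sup>2"
            using mult_right_mono[OF that, of "(x + 1)\<^sup>2"]
            by (simp add: power2_eq_square power3_eq_cube mult_ac)
          then have "(x\<^sup>2 + x / 10 + 1 / 10)\<^sup>2 \<le> x ^ 3 / (x + 1) ^ 3 * ((x + 19/20) * (x + 1))\<^sup>2"
            using x by (simp add: pos_le_divide_eq)
          moreover have "((x + 19/20) * (x + 1))\<^sup>2 > 0" using x by (intro zero_less_power mult_pos_pos) auto
          ultimately show ?thesis unfolding power_divide by (intro mult_imp_div_pos_le)
        qed
        ultimately have "((x ^ 2 + x / 10 + 1 / 10) / ((x + 19/20) * (x + 1)))\<^sup>2 \<le> x ^ 3 / (x + 1) ^ 3" by blast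
        also have "x ^ 3 / (x + 1) ^ 3 = ?p\<^sup>2"
        proof -
          have "?p\<^sup>2 = ?p * ?p" by (rule power2_eq_square)
          also have "\<dots> = (x / (x + 1)) powr 3"
            by (simp add: powr_add[symmetric] x_def add.commute)
          also have "\<dots> = (x / (x + 1)) ^ 3"
            using x powr_realpow[of "x / (x + 1)" 3] by simp
          finally show ?thesis by (simp add: power_divide)
        qed
        finally show "((x ^ 2 + x / 10 + 1 / 10) / ((x + 19/20) * (x + 1)))\<^sup>2 \<le> ?p\<^sup>2" .
      qed simp
      finally show ?thesis .
    qed
    have "?n (hyp_coeff u v W M (Suc N)) \<le> ?n (hyp_coeff u v W M N) * ?p"
      by (rule order_trans[OF \<open>\<And>N M. ?n (hyp_coeff u v W M (Suc N)) \<le> _\<close>])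
         (intro mult_left_mono q fps_tnorm_nonneg)
    also have "\<dots> \<le> (1 / real (M + 1) * real N powr (-3/2)) * ?p"
      by (intro mult_right_mono step.IH) auto
    also have "\<dots> = 1 / real (M + 1) * real (Suc N) powr (-3/2)"
    proof -
      have "real N powr (-3/2) * ?p = real (Suc N) powr (-3/2)"
        using N by (simp add: powr_divide powr_minus) (simp add: field_simps)
      then show ?thesis by (simp only: mult.assoc)
    qed
    finally show ?case .
  qed
qed

end

text \<open>The constant depends on u, v, W and the degree d, but neither on M nor on N: r is fixed,
  and passing from the norm to a single coefficient costs the factor 1 / r^d.\<close>

lemma hyp_coeff_nth_bound:
  obtains C where "\<And>M N. N \<ge> 1 \<Longrightarrow> norm (hyp_coeff u v W M N $ d) \<le> C / real (M + 1) * real N powr (-3/2)"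
    and "C \<ge> 0"
proof -
  \<comment> \<open>Makes r times the norm of each of u, v, W at most 1/20; the bound r <= 1 then
    covers W r^2.\<close>
  define r where "r = 1 / (20 * (1 + norm u + norm v + norm W))"
  define s where "s = 1 + norm u + norm v + norm W"
  have s: "s \<ge> 1" by (simp add: s_def)
  have r: "r > 0" "r \<le> 1"
    using s unfolding r_def s_def[symmetric] by simp_all
  have bnd: "norm x * r \<le> 1 / 20" if "x \<in> {u, v, W}" for x
  proof -
    have "norm x \<le> s" using that by (auto simp: s_def)
    then show ?thesis using s unfolding r_def s_def[symmetric] by (simp add: field_simps)
  qed
  have lin: "fps_tnorm r d (lin x) \<le> 1 / 20" if "x \<in> {u, v}" for x
    using fps_tnorm_monom[OF r(1), of d x 1] bnd[of x] that by auto
  have "norm W * r ^ 2 \<le> norm W * r"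
    using r by (intro mult_left_mono) (auto simp: power2_eq_square mult_left_le)
  then have quad: "fps_tnorm r d (quad W) \<le> 1 / 20"
    using fps_tnorm_monom[OF r(1), of d W 2] bnd[of W] by auto
  show thesis
  proof (rule that[of "1 / r ^ d"])
    fix M N :: nat assume N: "N \<ge> 1"
    have "norm (hyp_coeff u v W M N $ d) \<le> fps_tnorm r d (hyp_coeff u v W M N) / r ^ d"
      by (rule norm_nth_le_fps_tnorm) (use r in auto)
    also have "\<dots> \<le> (1 / real (M + 1) * real N powr (-3/2)) / r ^ d"
      using r by (intro divide_right_mono fps_tnorm_hyp_coeff lin quad N) auto
    finally show "norm (hyp_coeff u v W M N $ d) \<le> 1 / r ^ d / real (M + 1) * real N powr (-3/2)"
      by (simp add: field_simps)
  qed (use r in auto)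
qed

lemma summable_powr_three_halves: "summable (\<lambda>N. real N powr (-3/2))"
  by (simp add: summable_real_powr_iff)

lemma hyp_coeff_summable: "summable (\<lambda>N. norm (hyp_coeff u v W M N $ d))"
proof -
  obtain C where C: "\<And>M N. N \<ge> 1 \<Longrightarrow> norm (hyp_coeff u v W M N $ d) \<le> C / real (M + 1) * real N powr (-3/2)"
    using hyp_coeff_nth_bound by blast
  show ?thesis
    by (rule summable_comparison_test'[OF summable_mult[OF summable_powr_three_halves, of "C / real (M + 1)"], where N = 1])
       (use C in auto)
qed

text \<open>Makes the boundary term of the telescoping sum in the contiguous relation
  vanish.\<close>

lemma hyp_coeff_times_index_tendsto: "(\<lambda>N. of_nat N * hyp_coeff u v W M N $ d) \<longlonglongrightarrow> 0"
proof -
  obtain C where C: "\<And>M N. N \<ge> 1 \<Longrightarrow> norm (hyp_coeff u v W M N $ d) \<le> C / real (M + 1) * real N powr (-3/2)"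
    using hyp_coeff_nth_bound by blast
  show ?thesis
  proof (rule tendsto_0_le[where K = "C / real (M + 1)"])
    show "(\<lambda>N. real N powr (-1/2)) \<longlonglongrightarrow> 0" by real_asymp
    show "\<forall>\<^sub>F N in sequentially. norm (of_nat N * hyp_coeff u v W M N $ d) \<le> norm (real N powr (-1/2)) * (C / real (M + 1))"
      using eventually_ge_at_top[of 1]
    proof eventually_elim
      case (elim N)
      have "real N powr (-1/2) = real N powr (1 + -3/2)" by simp
      also have "\<dots> = real N * real N powr (-3/2)"
        using elim by (subst powr_add) simp
      finally show ?case
        using mult_left_mono[OF C[OF elim, of M], of "real N"] by (simp add: norm_mult mult_ac)
    qed
  qed
qed

text \<open>The hypergeometric series with lower parameter 1 + M - u, evaluated at z = 1.\<close>

definition hyp_value :: "complex \<Rightarrow> complex \<Rightarrow> complex \<Rightarrow> nat \<Rightarrow> complex fps" where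
  "hyp_value u v W M = Abs_fps (\<lambda>d. \<Sum>N. hyp_coeff u v W M N $ d)"

lemma hyp_value_sums: "(\<lambda>N. hyp_coeff u v W M N $ d) sums (hyp_value u v W M $ d)"
  unfolding hyp_value_def fps_nth_Abs_fps
  by (intro summable_sums summable_norm_cancel[OF hyp_coeff_summable])

lemma hyp_value_mult_sums: "(\<lambda>N. (c * hyp_coeff u v W M N) $ d) sums ((c * hyp_value u v W M) $ d)"
  using fps_mult_nth_sums[of "hyp_coeff u v W M" 1 "hyp_value u v W M" c d] hyp_value_sums by simp

text \<open>Every term but the first carries the factor 1 / (M + 1), with a bound summable in N, so
  raising the lower parameter leaves only the initial term 1.\<close>

lemma hyp_value_tendsto: "(\<lambda>M. hyp_value u v W M $ d) \<longlonglongrightarrow> 1 $ d"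
proof -
  obtain C where C: "\<And>M N. N \<ge> 1 \<Longrightarrow> norm (hyp_coeff u v W M N $ d) \<le> C / real (M + 1) * real N powr (-3/2)"
    using hyp_coeff_nth_bound by blast
  define S where "S = (\<Sum>N. real (Suc N) powr (-3/2))"
  have sS: "summable (\<lambda>N. real (Suc N) powr (-3/2))"
    using summable_powr_three_halves by (subst summable_Suc_iff)
  have *: "norm (hyp_value u v W M $ d - 1 $ d) \<le> C / real (M + 1) * S" for M
  proof -
    have "(\<lambda>N. hyp_coeff u v W M (Suc N) $ d) sums (hyp_value u v W M $ d - 1 $ d)"
      using hyp_value_sums[of u v W M d] by (subst sums_Suc_iff) simp
    then have "norm (hyp_value u v W M $ d - 1 $ d) = norm (\<Sum>N. hyp_coeff u v W M (Suc N) $ d)"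
      by (simp add: sums_iff)
    also have "\<dots> \<le> (\<Sum>N. C / real (M + 1) * real (Suc N) powr (-3/2))"
    proof (rule norm_suminf_le)
      fix N show "norm (hyp_coeff u v W M (Suc N) $ d) \<le> C / real (M + 1) * real (Suc N) powr (-3/2)"
        by (rule C) simp
    qed (intro summable_mult sS)
    also have "\<dots> = C / real (M + 1) * S" unfolding S_def by (rule suminf_mult[OF sS])
    finally show ?thesis .
  qed
  have "(\<lambda>M. C / real (M + 1) * S) \<longlonglongrightarrow> 0" by real_asymp
  then have "(\<lambda>M. hyp_value u v W M $ d - 1 $ d) \<longlonglongrightarrow> 0"
    by (rule Lim_null_comparison[rotated]) (use * in simp)
  then show ?thesis by (simp add: LIM_zero_iff)
qed

lemma lin_factor_nonzero: "n > 0 \<Longrightarrow> of_nat n - lin u \<noteq> 0"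
  using inverse_lin[of n u] by auto

text \<open>A quotient of Pochhammer symbols: with q = M + 1 - u, the rising products of length N
  from q and from q + 1 have quotient q / (q + N).\<close>

lemma hyp_coeff_shift:
  "(of_nat (M + 1 + N) - lin u) * hyp_coeff u v W (Suc M) N = (of_nat (M + 1) - lin u) * hyp_coeff u v W M N"
proof (induction N)
  case (Suc N)
  let ?q = "of_nat (N ^ 2) + of_nat N * (lin v - lin u) + hypc u v W"
  let ?n = "of_nat (N + 1) :: complex fps" and ?a = "of_nat (N + 1 + M) - lin u"
  have "(?n * ?a) * ((of_nat (M + 1 + Suc N) - lin u) * hyp_coeff u v W (Suc M) (Suc N))
      = ?a * (?n * (of_nat (N + 1 + Suc M) - lin u) * hyp_coeff u v W (Suc M) (Suc N))"
    by (simp only: mult_ac add_Suc_right add_Suc add_ac)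
  also have "\<dots> = ?q * ((of_nat (M + 1 + N) - lin u) * hyp_coeff u v W (Suc M) N)"
    unfolding hyp_coeff_Suc by (simp only: mult_ac add_ac)
  also have "\<dots> = (of_nat (M + 1) - lin u) * (?n * ?a * hyp_coeff u v W M (Suc N))"
    unfolding Suc hyp_coeff_Suc by (simp only: mult_ac)
  also have "\<dots> = (?n * ?a) * ((of_nat (M + 1) - lin u) * hyp_coeff u v W M (Suc N))"
    by (simp only: mult_ac)
  moreover have "?n * ?a \<noteq> 0"
    using lin_factor_nonzero[of "N + 1 + M" u] by (simp del: of_nat_add of_nat_Suc)
  ultimately show ?case by simp
qed simp

lemma of_nat_fps_mult_nth: "(of_nat n * f) $ d = of_nat n * f $ d" for f :: "complex fps"
  by (simp add: fps_of_nat[symmetric] del: fps_of_nat)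

text \<open>The algebra behind the contiguous relation, multiplied by the denominator a; n1 and B1
  are n and B at the next index, B' is the coefficient for the raised lower parameter. The key is
  the identity a (m - V) - Q = n a - q.\<close>

lemma contiguous_cancel:
  fixes a m n U V Wt :: "'a :: comm_ring_1"
  assumes a: "a = (m - U) + n" and shift: "a * B' = (m - U) * B"
    and step: "n1 * (a * B1) = (n ^ 2 + n * (V - U) + (Wt - U * V)) * B"
  shows "a * ((m - U) * (m - V) * B - (m ^ 2 - m * (U + V) + Wt) * B')
    = a * (- ((m - U) * (n1 * B1)) - - ((m - U) * (n * B)))"
proof -
  let ?Q = "m ^ 2 - m * (U + V) + Wt" and ?q = "n ^ 2 + n * (V - U) + (Wt - U * V)"
  have e: "a * (m - V) - ?Q = n * a - ?q"
    unfolding a by (simp add: algebra_simps power2_eq_square)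
  have "a * ((m - U) * (m - V) * B - ?Q * B') = a * (m - V) * ((m - U) * B) - ?Q * (a * B')"
    by (subst right_diff_distrib) (simp only: mult_ac)
  also have "\<dots> = (n * a - ?q) * ((m - U) * B)"
    unfolding shift e[symmetric] by (simp only: left_diff_distrib)
  also have "\<dots> = n * a * ((m - U) * B) - (m - U) * (?q * B)"
    by (subst left_diff_distrib) (simp only: mult_ac)
  also have "\<dots> = a * (- ((m - U) * (n1 * B1)) - - ((m - U) * (n * B)))"
    unfolding step[symmetric] by (subst right_diff_distrib) (simp only: mult_minus_right mult_ac
      diff_minus_eq_add uminus_add_conv_diff)
  finally show ?thesis .
qed

text \<open>Gauss's contiguous relation; the termwise difference of the two sides telescopes.\<close>

lemma hyp_value_contiguous:
  "(of_nat (M + 1) - lin u) * (of_nat (M + 1) - lin v) * hyp_value u v W M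
   = (of_nat (M + 1) ^ 2 - of_nat (M + 1) * (lin u + lin v) + quad W) * hyp_value u v W (Suc M)"
proof (rule fps_ext)
  fix d
  let ?m = "of_nat (M + 1) :: complex fps"
  let ?c = "?m - lin u" and ?Q = "?m ^ 2 - ?m * (lin u + lin v) + quad W"
  let ?B = "hyp_coeff u v W"
  \<comment> \<open>The antidifference: N times the coefficient, up to a constant factor. It
    vanishes at \<open>N = 0\<close> and in the limit, so both boundary terms disappear.\<close>
  let ?G = "\<lambda>N. - (?c * (of_nat N * ?B M N))"
  have tel: "?c * (?m - lin v) * ?B M N - ?Q * ?B (Suc M) N = ?G (Suc N) - ?G N" for N
  proof -
    let ?n = "of_nat N :: complex fps"
    let ?a = "of_nat (M + 1 + N) - lin u"
    have a: "?a = ?c + ?n" by simp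
    have 1: "of_nat (Suc N) * (?a * ?B M (Suc N)) = (?n ^ 2 + ?n * (lin v - lin u) + hypc u v W) * ?B M N"
      using hyp_coeff_Suc[of N M u v W] by (simp only: mult.assoc Suc_eq_plus1 add_ac of_nat_power)
    have "?a * (?c * (?m - lin v) * ?B M N - ?Q * ?B (Suc M) N) = ?a * (?G (Suc N) - ?G N)"
      by (rule contiguous_cancel[OF a hyp_coeff_shift 1[unfolded hypc_def]])
    then show ?thesis using lin_factor_nonzero[of "M + 1 + N" u] by (simp only: mult_cancel_left) simp
  qed
  have "(\<lambda>N. (?c * (?m - lin v) * ?B M N) $ d - (?Q * ?B (Suc M) N) $ d)
      sums ((?c * (?m - lin v) * hyp_value u v W M) $ d - (?Q * hyp_value u v W (Suc M)) $ d)"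
    by (intro sums_diff hyp_value_mult_sums)
  moreover have "(\<lambda>N. (?c * (?m - lin v) * ?B M N) $ d - (?Q * ?B (Suc M) N) $ d) sums (0 - ?G 0 $ d)"
  proof -
    have "(\<lambda>N. - (\<Sum>i=0..d. ?c $ i * (of_nat N * ?B M N $ (d - i)))) \<longlonglongrightarrow> - (\<Sum>i=0..d. ?c $ i * 0)"
      by (intro tendsto_intros hyp_coeff_times_index_tendsto)
    moreover have "- (\<Sum>i=0..d. ?c $ i * (of_nat N * ?B M N $ (d - i))) = ?G N $ d" for N
      by (simp only: fps_mult_nth[of ?c] fps_neg_nth of_nat_fps_mult_nth)
    ultimately have "(\<lambda>N. ?G N $ d) \<longlonglongrightarrow> 0" by simp
    from telescope_sums[OF this] show ?thesis
      unfolding fps_sub_nth[symmetric] tel .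
  qed
  ultimately have "(?c * (?m - lin v) * hyp_value u v W M) $ d - (?Q * hyp_value u v W (Suc M)) $ d = 0 - ?G 0 $ d"
    by (rule sums_unique2)
  then show "(?c * (?m - lin v) * hyp_value u v W M) $ d = (?Q * hyp_value u v W (Suc M)) $ d"
    by simp
qed

section \<open>Gauss's summation formula\<close>

text \<open>The Euler operator T d/dT. It preserves degrees, and logarithmic derivatives taken with
  it turn the product over n into power sums.\<close>

definition fps_theta :: "complex fps \<Rightarrow> complex fps" where
  "fps_theta f = fps_X * fps_deriv f"

lemma fps_theta_nth: "fps_theta f $ d = of_nat d * f $ d"
  by (cases d) (simp_all add: fps_theta_def)

lemma fps_theta_mult: "fps_theta (f * g) = fps_theta f * g + f * fps_theta g"
  by (simp add: fps_theta_def algebra_simps)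

lemma fps_theta_factor:
  assumes "fps_theta f = A * f" "fps_theta g = B * g"
  shows "fps_theta (f * g) = (A + B) * (f * g)"
  unfolding fps_theta_mult assms by (simp add: algebra_simps)

text \<open>The expansion of u T / (n - u T), which is minus the logarithmic derivative of n - u
  T.\<close>

definition geom :: "nat \<Rightarrow> complex \<Rightarrow> complex fps" where
  "geom n u = Abs_fps (\<lambda>k. if k = 0 then 0 else u ^ k / of_nat n ^ k)"

lemma lin_factor_geom:
  assumes "n > 0"
  shows "(of_nat n - lin u) * geom n u = lin u"
proof (rule fps_ext)
  fix d
  show "((of_nat n - lin u) * geom n u) $ d = lin u $ d"
    unfolding left_diff_distrib fps_sub_nth of_nat_fps_mult_nth lin_mult_nth
    using assms by (cases d; cases "d - 1") (auto simp: geom_def)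
qed

lemma fps_theta_lin: "fps_theta (of_nat n - lin u) = - geom n u * (of_nat n - lin u)" if "n > 0"
proof -
  have "fps_theta (of_nat n - lin u) = - lin u"
    by (simp add: fps_theta_def mult.commute fps_of_nat[symmetric] del: fps_of_nat)
  then show ?thesis using lin_factor_geom[OF that, of u] by (simp add: mult.commute)
qed

lemma fps_theta_inverse_lin:
  assumes n: "n > 0"
  shows "fps_theta (inverse (of_nat n - lin u)) = geom n u * inverse (of_nat n - lin u)"
proof -
  let ?f = "of_nat n - lin u" and ?I = "inverse (of_nat n - lin u)"
  have "?f * fps_theta ?I + fps_theta ?f * ?I = 0"
    using fps_theta_mult[of ?f ?I] unfolding inverse_lin[OF n] by (simp add: fps_theta_def algebra_simps)
  then have "?f * (fps_theta ?I - geom n u * ?I) = 0"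
    unfolding fps_theta_lin[OF n] by (simp add: algebra_simps)
  then show ?thesis using lin_factor_nonzero[OF n, of u] by simp
qed

definition gauss_prod :: "complex \<Rightarrow> complex \<Rightarrow> complex \<Rightarrow> complex \<Rightarrow> nat \<Rightarrow> complex fps" where
  "gauss_prod u v a b L = (\<Prod>n<L. (of_nat (n + 1) - lin a) * (of_nat (n + 1) - lin b)
     * (inverse (of_nat (n + 1) - lin u) * inverse (of_nat (n + 1) - lin v)))"

lemma hyp_value_gauss_prod:
  assumes "a + b = u + v" "a * b = W"
  shows "hyp_value u v W 0 = gauss_prod u v a b L * hyp_value u v W L"
proof (induction L)
  case (Suc L)
  let ?m = "of_nat (L + 1) :: complex fps"
  let ?U = "?m - lin u" and ?V = "?m - lin v"
  let ?I = "inverse ?U * inverse ?V"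
  have UV: "?U * inverse ?U = 1" "?V * inverse ?V = 1" by (simp_all only: inverse_lin zero_less_Suc Suc_eq_plus1[symmetric])
  have ab: "lin a + lin b = lin u + lin v" "lin a * lin b = quad W"
    unfolding assms(2)[symmetric] distrib_right[symmetric] fps_const_add assms(1)
    by (simp_all only: power2_eq_square fps_const_mult[symmetric] mult_ac)
  have "(?m - lin a) * (?m - lin b) = ?m ^ 2 - ?m * (lin a + lin b) + lin a * lin b"
    by (simp only: algebra_simps power2_eq_square)
  then have q: "?m ^ 2 - ?m * (lin u + lin v) + quad W = (?m - lin a) * (?m - lin b)"
    unfolding ab by simp
  have "hyp_value u v W L = (?U * inverse ?U) * (?V * inverse ?V) * hyp_value u v W L"
    unfolding UV by simp
  also have "\<dots> = ?I * (?U * ?V * hyp_value u v W L)"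
    by (simp only: mult_ac)
  also have "\<dots> = ((?m - lin a) * (?m - lin b) * ?I) * hyp_value u v W (Suc L)"
    unfolding hyp_value_contiguous q by (simp only: mult_ac)
  finally show ?case unfolding gauss_prod_def prod.lessThan_Suc
    using Suc by (simp only: gauss_prod_def mult.assoc)
qed (simp add: gauss_prod_def)

text \<open>With s k the truncated or full zeta sum, this is the logarithmic derivative of the
  truncated or full product; u and v have the plus sign because their factors stand in the
  denominator.\<close>

definition power_sums :: "complex \<Rightarrow> complex \<Rightarrow> complex \<Rightarrow> complex \<Rightarrow> (nat \<Rightarrow> complex) \<Rightarrow> complex fps" where
  "power_sums u v a b s = Abs_fps (\<lambda>k. if k = 0 then 0 else s k * (u ^ k + v ^ k - a ^ k - b ^ k))"

lemma fps_theta_gauss_prod: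
  "fps_theta (gauss_prod u v a b L)
   = power_sums u v a b (\<lambda>k. \<Sum>n<L. 1 / of_nat (n + 1) ^ k) * gauss_prod u v a b L"
proof (induction L)
  case 0
  have "power_sums u v a b (\<lambda>k. 0) = 0" by (intro fps_ext) (simp add: power_sums_def)
  then show ?case by (simp add: gauss_prod_def fps_theta_def)
next
  case (Suc L)
  let ?n = "L + 1"
  have "fps_theta (gauss_prod u v a b (Suc L)) = (power_sums u v a b (\<lambda>k. \<Sum>n<L. 1 / of_nat (n + 1) ^ k)
     + ((- geom ?n a + - geom ?n b) + (geom ?n u + geom ?n v))) * gauss_prod u v a b (Suc L)"
    unfolding gauss_prod_def prod.lessThan_Suc
    by (intro fps_theta_factor fps_theta_lin fps_theta_inverse_lin Suc[unfolded gauss_prod_def]) simp_all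
  also have "power_sums u v a b (\<lambda>k. \<Sum>n<L. 1 / of_nat (n + 1) ^ k)
     + ((- geom ?n a + - geom ?n b) + (geom ?n u + geom ?n v))
     = power_sums u v a b (\<lambda>k. \<Sum>n<Suc L. 1 / of_nat (n + 1) ^ k)"
    by (intro fps_ext) (auto simp: power_sums_def geom_def algebra_simps diff_divide_distrib add_divide_distrib)
  finally show ?case .
qed

lemma gauss_prod_nth_0: "gauss_prod u v a b L $ 0 = 1"
proof -
  have "((of_nat (n + 1) - lin a) * (of_nat (n + 1) - lin b)
     * (inverse (of_nat (n + 1) - lin u) * inverse (of_nat (n + 1) - lin v))) $ 0 = 1" for n
    by (simp add: fps_of_nat[symmetric] field_simps del: fps_of_nat of_nat_Suc of_nat_add)
  then show ?thesis unfolding gauss_prod_def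
    by (induction L) (simp_all del: of_nat_Suc of_nat_add)
qed

text \<open>\<open>E\<close> will be the right-hand side of the theorem, with \<open>a\<close>, \<open>b\<close> the roots of \<open>X^2 - (u + v) X + W\<close>.
  The divergent harmonic sum is multiplied by \<open>u + v - a - b = 0\<close>.\<close>

theorem gauss_summation:
  assumes ab: "a + b = u + v" "a * b = W"
    and E0: "E $ 0 = 1"
    and E: "fps_theta E = power_sums u v a b (\<lambda>k. if k \<le> 1 then 0 else zeta k) * E"
  shows "hyp_value u v W 0 = E"
proof (rule fps_ext)
  fix d
  let ?H = "\<lambda>L k. \<Sum>n<L. 1 / of_nat (n + 1) ^ k"
  let ?S = "\<lambda>L. power_sums u v a b (?H L)" and ?S' = "power_sums u v a b (\<lambda>k. if k \<le> 1 then 0 else zeta k)"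
  have S: "(\<lambda>L. ?S L $ k) \<longlonglongrightarrow> ?S' $ k" for k
  proof (cases "k \<le> 1")
    case True
    then have "?S L $ k = ?S' $ k" for L
    proof (cases k)
      case (Suc j)
      with True have "k = 1" by simp
      moreover have "u + v - a - b = 0" using ab(1) by (simp add: diff_diff_eq)
      ultimately show ?thesis by (simp add: power_sums_def)
    qed (simp add: power_sums_def)
    then show ?thesis by simp
  next
    case False
    have "summable (\<lambda>n. inverse (of_nat n ^ k) :: complex)"
      using False by (intro inverse_power_summable) simp
    then have "summable (\<lambda>n. 1 / of_nat (Suc n) ^ k :: complex)"
      by (subst summable_Suc_iff) (simp add: inverse_eq_divide)
    then have "(\<lambda>L. ?H L k) \<longlonglongrightarrow> zeta k"
      unfolding zeta_def by (simp add: summable_LIMSEQ del: of_nat_Suc)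
    then show ?thesis using False by (auto simp: power_sums_def intro!: tendsto_intros)
  qed
  \<comment> \<open>If \<open>fps_theta F = T * F\<close> and \<open>T $ 0 = 0\<close>, coefficient
    d of F is computed from lower coefficients of F and from those of T. So convergence passes from
    T to F degree by degree.\<close>
  have P: "(\<lambda>L. gauss_prod u v a b L $ d) \<longlonglongrightarrow> E $ d" for d
  proof (induction d rule: less_induct)
    case (less d)
    show ?case
    proof (cases "d = 0")
      case True
      then show ?thesis by (simp add: gauss_prod_nth_0 E0)
    next
      case False
      have rec: "of_nat d * F $ d = (\<Sum>i=1..d. T $ i * F $ (d - i))"
        if "fps_theta F = T * F" "T $ 0 = 0" for F T :: "complex fps"
      proof -
        have "of_nat d * F $ d = (T * F) $ d" using that(1) by (simp add: fps_theta_nth[symmetric])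
        also have "\<dots> = (\<Sum>i=1..d. T $ i * F $ (d - i))"
          using that(2) by (simp add: fps_mult_nth sum.atLeast_Suc_atMost)
        finally show ?thesis .
      qed
      have "(\<lambda>L. (\<Sum>i=1..d. ?S L $ i * gauss_prod u v a b L $ (d - i)) / of_nat d)
         \<longlonglongrightarrow> (\<Sum>i=1..d. ?S' $ i * E $ (d - i)) / of_nat d"
        using False by (intro tendsto_intros S less) auto
      moreover have "(\<Sum>i=1..d. ?S L $ i * gauss_prod u v a b L $ (d - i)) / of_nat d = gauss_prod u v a b L $ d" for L
        using rec[OF fps_theta_gauss_prod[of u v a b L]] False by (simp add: power_sums_def field_simps)
      moreover have "(\<Sum>i=1..d. ?S' $ i * E $ (d - i)) / of_nat d = E $ d"
        using rec[OF E] False by (simp add: power_sums_def field_simps)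
      ultimately show ?thesis by simp
    qed
  qed
  \<comment> \<open>The product equals F(1) for every L, while its second factor tends to 1.\<close>
  have "(\<lambda>L. (gauss_prod u v a b L * hyp_value u v W L) $ d) \<longlonglongrightarrow> (E * 1) $ d"
    unfolding fps_mult_nth by (intro tendsto_intros P hyp_value_tendsto)
  then have "(\<lambda>L. hyp_value u v W 0 $ d) \<longlonglongrightarrow> E $ d"
    by (simp add: hyp_value_gauss_prod[OF ab, symmetric])
  then show "hyp_value u v W 0 $ d = E $ d"
    by (simp add: LIMSEQ_const_iff)
qed

section \<open>Limits at 1 and at 0, and the value of the Wronskian\<close>

lemma hypF_tendsto_1:
  assumes z: "\<And>n. 0 \<le> z n" "\<And>n. z n < 1" "z \<longlonglongrightarrow> 1"
  shows "(\<lambda>n. hypF u v W (Li_at (of_real (z n))) $ d) \<longlonglongrightarrow> hyp_value u v W 0 $ d"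
proof -
  have nz: "norm (complex_of_real (z n)) < 1" for n using z by simp
  \<comment> \<open>The coefficients are absolutely summable at z = 1 itself, so they dominate the
    series for all z in [0, 1).\<close>
  have "(\<lambda>n. \<Sum>N. hyp_coeff u v W 0 N $ d * of_real (z n) ^ N) \<longlonglongrightarrow> (\<Sum>N. hyp_coeff u v W 0 N $ d)"
  proof (rule conjunct2[OF conjunct2[OF tannerys_theorem]])
    fix N
    have "(\<lambda>n. hyp_coeff u v W 0 N $ d * of_real (z n) ^ N) \<longlonglongrightarrow> hyp_coeff u v W 0 N $ d * of_real 1 ^ N"
      by (intro tendsto_intros z)
    then show "(\<lambda>n. hyp_coeff u v W 0 N $ d * of_real (z n) ^ N) \<longlonglongrightarrow> hyp_coeff u v W 0 N $ d" by simp
  next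
    have "norm (hyp_coeff u v W 0 N $ d * of_real (z n) ^ N) \<le> norm (hyp_coeff u v W 0 N $ d)" for N n
      using z by (simp add: norm_mult norm_power mult_left_le power_le_one less_imp_le)
    then show "\<forall>\<^sub>F (N, n) in sequentially \<times>\<^sub>F sequentially.
        norm (hyp_coeff u v W 0 N $ d * of_real (z n) ^ N) \<le> norm (hyp_coeff u v W 0 N $ d)"
      by (intro always_eventually) auto
  qed (simp_all add: hyp_coeff_summable)
  then show ?thesis
    using hypF_sums[OF nz, of u v W d] by (simp add: sums_iff hyp_value_def)
qed

text \<open>Since N z^N <= 1 + z + ... + z^(N-1), the factor (1 - z) N z^N is at most 1. The
  absolutely summable coefficients of F therefore dominate, and each single term tends to 0.\<close>

lemma hypG_tendsto_1:
  assumes z: "\<And>n. 0 \<le> z n" "\<And>n. z n < 1" "z \<longlonglongrightarrow> 1"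
  shows "(\<lambda>n. of_real (1 - z n) * (hypc u v W * hypG u v W (Li_at (of_real (z n)))) $ d) \<longlonglongrightarrow> 0"
proof -
  have nz: "norm (complex_of_real (z n)) < 1" for n using z by simp
  let ?a = "\<lambda>N n. hyp_coeff u v W 0 N $ d * of_real ((1 - z n) * real N * z n ^ N)"
  have le1: "(1 - z n) * real N * z n ^ N \<le> 1" for n N
  proof -
    have "real N * z n ^ N = (\<Sum>i<N. z n ^ N)" by simp
    also have "\<dots> \<le> (\<Sum>i<N. z n ^ i)"
      using z(1,2)[of n] by (intro sum_mono power_decreasing) auto
    finally have "(1 - z n) * (real N * z n ^ N) \<le> (1 - z n) * (\<Sum>i<N. z n ^ i)"
      using z(2)[of n] by (intro mult_left_mono) auto
    also have "\<dots> = 1 - z n ^ N" by (rule one_diff_power_eq[symmetric])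
    finally show ?thesis using z(1)[of n] by (simp add: mult.assoc) (smt (verit) zero_le_power)
  qed
  have "(\<lambda>n. \<Sum>N. ?a N n) \<longlonglongrightarrow> (\<Sum>N. (0 :: complex))"
  proof (rule conjunct2[OF conjunct2[OF tannerys_theorem]])
    fix N
    have "(\<lambda>n. ?a N n) \<longlonglongrightarrow> hyp_coeff u v W 0 N $ d * of_real ((1 - 1) * real N * 1 ^ N)"
      by (intro tendsto_intros z)
    then show "(\<lambda>n. ?a N n) \<longlonglongrightarrow> 0" by simp
  next
    have "norm (?a N n) \<le> norm (hyp_coeff u v W 0 N $ d)" for N n
    proof -
      have "0 \<le> (1 - z n) * real N * z n ^ N" using z(1,2)[of n] by simp
      then have "norm (complex_of_real ((1 - z n) * real N * z n ^ N)) \<le> 1"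
        using le1[of n N] unfolding norm_of_real by simp
      then show ?thesis unfolding norm_mult by (intro mult_left_le) auto
    qed
    then show "\<forall>\<^sub>F (N, n) in sequentially \<times>\<^sub>F sequentially. norm (?a N n) \<le> norm (hyp_coeff u v W 0 N $ d)"
      by (intro always_eventually) auto
  qed (simp_all add: hyp_coeff_summable)
  moreover have "(\<Sum>N. ?a N n) = of_real (1 - z n) * (hypc u v W * hypG u v W (Li_at (of_real (z n)))) $ d" for n
  proof -
    have "(\<lambda>N. of_real (1 - z n) * (of_nat N * hyp_coeff u v W 0 N $ d * of_real (z n) ^ N))
       sums (of_real (1 - z n) * (hypc u v W * hypG u v W (Li_at (of_real (z n)))) $ d)"
      by (intro sums_mult hypc_hypG_sums nz)
    then show ?thesis by (simp add: sums_iff mult_ac)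
  qed
  ultimately show ?thesis by simp
qed

lemma powser_tendsto_0:
  fixes c :: "nat \<Rightarrow> complex"
  assumes "summable (\<lambda>N. norm (c N) * (1/2) ^ N)" and z: "\<And>n. norm (z n) \<le> 1/2" "z \<longlonglongrightarrow> 0"
  shows "(\<lambda>n. \<Sum>N. c N * z n ^ N) \<longlonglongrightarrow> c 0"
proof -
  have "(\<lambda>n. \<Sum>N. c N * z n ^ N) \<longlonglongrightarrow> (\<Sum>N. c N * 0 ^ N)"
  proof (rule conjunct2[OF conjunct2[OF tannerys_theorem]])
    show "(\<lambda>n. c N * z n ^ N) \<longlonglongrightarrow> c N * 0 ^ N" for N by (intro tendsto_intros z)
    have "norm (c N * z n ^ N) \<le> norm (c N) * (1/2) ^ N" for N n
      unfolding norm_mult norm_power using z(1)[of n] by (intro mult_left_mono power_mono) auto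
    then show "\<forall>\<^sub>F (N, n) in sequentially \<times>\<^sub>F sequentially. norm (c N * z n ^ N) \<le> norm (c N) * (1/2) ^ N"
      by (intro always_eventually) auto
  qed (use assms(1) in simp_all)
  then show ?thesis by simp
qed

lemma powser_norm_summable_half:
  fixes c :: "nat \<Rightarrow> complex"
  assumes "\<And>z. norm z < 1 \<Longrightarrow> summable (\<lambda>N. c N * z ^ N)"
  shows "summable (\<lambda>N. norm (c N) * (1/2) ^ N)"
  using powser_insidea[of c "3/4" "1/2"] assms[of "3/4"] by (simp add: norm_mult norm_power)

lemma hypF_tendsto_0:
  assumes "\<And>n. norm (z n) \<le> 1/2" "z \<longlonglongrightarrow> 0"
  shows "(\<lambda>n. hypF u v W (Li_at (z n)) $ d) \<longlonglongrightarrow> 1 $ d"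
proof -
  have "(\<lambda>n. \<Sum>N. hyp_coeff u v W 0 N $ d * z n ^ N) \<longlonglongrightarrow> hyp_coeff u v W 0 0 $ d"
    by (intro powser_tendsto_0 powser_norm_summable_half assms sums_summable[OF hypF_sums])
  moreover have "norm (z n) < 1" for n using assms(1)[of n] by linarith
  ultimately show ?thesis using hypF_sums by (simp add: sums_iff)
qed

text \<open>G has no constant term. Only the existence of the limit matters: it is paired with a
  factor that tends to 0.\<close>

lemma hypG_tendsto_0:
  assumes "\<And>n. norm (z n) \<le> 1/2" "z \<longlonglongrightarrow> 0" "\<And>n. z n \<noteq> 0"
  obtains l where "(\<lambda>n. hypG u v W (Li_at (z n)) $ d / z n) \<longlonglongrightarrow> l"
proof -
  let ?c = "\<lambda>N. hypG u v W (cw N) $ d"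
  have c0: "?c 0 = 0" by (simp add: hypG_def FX_cw_0 FY_cw_0)
  have shift: "(\<lambda>N. ?c (Suc N) * z ^ N) sums (hypG u v W (Li_at z) $ d / z)" if "norm z < 1" "z \<noteq> 0" for z
  proof -
    have "(\<lambda>N. ?c (Suc N) * z ^ Suc N) sums (hypG u v W (Li_at z) $ d)"
      using hypG_sums[OF that(1), of u v W d] by (subst sums_Suc_iff) (simp add: c0)
    then have "(\<lambda>N. ?c (Suc N) * z ^ Suc N / z) sums (hypG u v W (Li_at z) $ d / z)"
      by (rule sums_divide)
    then show ?thesis using that by (simp add: field_simps)
  qed
  have "summable (\<lambda>N. ?c (Suc N) * z ^ N)" if "norm z < 1" for z
    using that shift by (cases "z = 0") (auto simp: sums_iff)
  then have "(\<lambda>n. \<Sum>N. ?c (Suc N) * z n ^ N) \<longlonglongrightarrow> ?c (Suc 0)"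
    by (intro powser_tendsto_0 powser_norm_summable_half assms)
  moreover have "norm (z n) < 1" for n using assms(1)[of n] by linarith
  ultimately show thesis using shift[OF _ assms(3)] that by (simp add: sums_iff)
qed

text \<open>Along a sequence tending to 1, the product F H with the companion H tends to F(1) times
  1. In c G K the factor 1 - z is moved from K to G: (1 - z) c G tends to 0 and K / (1 - z)
  converges.\<close>

theorem wronskian_value:
  assumes "w \<in> lens"
  shows "wronskian u v W (Li_at w) (Li_at (1 - w)) = hyp_value u v W 0"
proof (rule fps_ext)
  fix d
  \<comment> \<open>Starts at 1/2, so that 1 - z stays in the disc of radius 1/2 used for the limits
    at 0.\<close>
  define z where "z n = 1 - 1 / real (n + 2)" for n
  have z: "0 \<le> z n" "z n < 1" "0 < z n" for n by (simp_all add: z_def field_simps)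
  have z1: "z \<longlonglongrightarrow> 1" unfolding z_def by real_asymp
  let ?y = "\<lambda>n. complex_of_real (1 - z n)"
  have y: "norm (?y n) \<le> 1/2" "?y n \<noteq> 0" for n
    using z(2)[of n] unfolding norm_of_real of_real_eq_0_iff by (simp_all add: z_def field_simps)
  have y0: "?y \<longlonglongrightarrow> 0"
  proof -
    have "(\<lambda>n. 1 - z n) \<longlonglongrightarrow> 1 - 1" by (intro tendsto_intros z1)
    then show ?thesis using tendsto_of_real[of "\<lambda>n. 1 - z n" 0 sequentially] by simp
  qed
  have A: "(\<lambda>n. (hypF u v W (Li_at (z n)) * hypF v u W (Li_at (?y n))) $ d) \<longlonglongrightarrow> (hyp_value u v W 0 * 1) $ d"
    unfolding fps_mult_nth by (intro tendsto_intros hypF_tendsto_1 hypF_tendsto_0 z z1 y y0)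
  have B: "(\<lambda>n. ((hypc u v W * hypG u v W (Li_at (z n))) * hypG v u W (Li_at (?y n))) $ d) \<longlonglongrightarrow> 0"
  proof -
    have "(\<lambda>n. (hypc u v W * hypG u v W (Li_at (z n))) $ i * hypG v u W (Li_at (?y n)) $ (d - i)) \<longlonglongrightarrow> 0" for i
    proof -
      obtain l where l: "(\<lambda>n. hypG v u W (Li_at (?y n)) $ (d - i) / ?y n) \<longlonglongrightarrow> l"
        by (rule hypG_tendsto_0[OF y(1) y0 y(2)])
      have "(\<lambda>n. (?y n * (hypc u v W * hypG u v W (Li_at (z n))) $ i) * (hypG v u W (Li_at (?y n)) $ (d - i) / ?y n)) \<longlonglongrightarrow> 0 * l"
        by (intro tendsto_mult hypG_tendsto_1 l z z1)
      then show ?thesis using y(2) by simp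
    qed
    then have "(\<lambda>n. \<Sum>i=0..d. (hypc u v W * hypG u v W (Li_at (z n))) $ i * hypG v u W (Li_at (?y n)) $ (d - i)) \<longlonglongrightarrow> (\<Sum>i=0..d. 0)"
      by (intro tendsto_sum)
    then show ?thesis unfolding fps_mult_nth[of "hypc u v W * hypG u v W (Li_at (complex_of_real (z n)))" for n] by simp
  qed
  have "(\<lambda>n. wronskian u v W (Li_at (z n)) (Li_at (1 - z n)) $ d) \<longlonglongrightarrow> (hyp_value u v W 0 * 1) $ d + 0"
    using tendsto_add[OF A B] unfolding wronskian_def fps_add_nth mult.assoc by simp
  moreover have "wronskian u v W (Li_at (z n)) (Li_at (1 - z n)) = wronskian u v W (Li_at w) (Li_at (1 - w))" for n
    using wronskian_constant[OF of_real_in_lens[OF z(3)[of n] z(2)[of n]] assms] by simp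
  ultimately show "wronskian u v W (Li_at w) (Li_at (1 - w)) $ d = hyp_value u v W 0 $ d"
    by (simp add: LIMSEQ_const_iff)
qed

section \<open>Power sums and triple generating functions\<close>

definition pairs2 :: "nat \<Rightarrow> (nat \<times> nat) set" where
  "pairs2 n = {(i, j). i + 2 * j = n}"

lemma finite_pairs2 [simp]: "finite (pairs2 n)"
  by (rule finite_subset[of _ "{..n} \<times> {..n}"]) (auto simp: pairs2_def)

lemma sum_pairs2_Suc_fst:
  "(\<Sum>(i, j)\<in>pairs2 (Suc n). if i = 0 then 0 else f (i - 1) j) = (\<Sum>(i, j)\<in>pairs2 n. f i j)"
proof -
  have "(\<Sum>(i, j)\<in>pairs2 (Suc n). if i = 0 then 0 else f (i - 1) j)
      = (\<Sum>(i, j)\<in>{(i, j)\<in>pairs2 (Suc n). i > 0}. f (i - 1) j)"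
    by (intro sum.mono_neutral_cong_right) (auto split: if_splits)
  also have "\<dots> = (\<Sum>(i, j)\<in>pairs2 n. f i j)"
    by (rule sum.reindex_bij_witness[of _ "\<lambda>(i, j). (Suc i, j)" "\<lambda>(i, j). (i - 1, j)"])
       (auto simp: pairs2_def)
  finally show ?thesis .
qed

lemma sum_pairs2_Suc_snd:
  "(\<Sum>(i, j)\<in>pairs2 (Suc (Suc n)). if j = 0 then 0 else f i (j - 1)) = (\<Sum>(i, j)\<in>pairs2 n. f i j)"
proof -
  have "(\<Sum>(i, j)\<in>pairs2 (Suc (Suc n)). if j = 0 then 0 else f i (j - 1))
      = (\<Sum>(i, j)\<in>{(i, j)\<in>pairs2 (Suc (Suc n)). j > 0}. f i (j - 1))"
    by (intro sum.mono_neutral_cong_right) (auto split: if_splits)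
  also have "\<dots> = (\<Sum>(i, j)\<in>pairs2 n. f i j)"
    by (rule sum.reindex_bij_witness[of _ "\<lambda>(i, j). (i, Suc j)" "\<lambda>(i, j). (i, j - 1)"])
       (auto simp: pairs2_def)
  finally show ?thesis .
qed

text \<open>The recursion is that of the power sums, \<open>p n = (a + b) * p (n - 1) - a * b * p (n - 2)\<close>. It breaks at
  \<open>n = 2\<close>, where \<open>p 0 = 2\<close> but the coefficient at \<open>(0, 0)\<close> is \<open>1\<close>.\<close>

fun waring :: "nat \<Rightarrow> nat \<Rightarrow> int" where
  "waring 0 0 = 1"
| "waring (Suc i) 0 = 1"
| "waring 0 (Suc 0) = -2"
| "waring 0 (Suc (Suc j)) = - waring 0 (Suc j)"
| "waring (Suc i) (Suc j) = waring i (Suc j) - waring (Suc i) j"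

lemma waring_rec:
  "i + 2 * j \<ge> 3 \<Longrightarrow> waring i j = (if i = 0 then 0 else waring (i - 1) j) - (if j = 0 then 0 else waring i (j - 1))"
  by (cases "(i, j)" rule: waring.cases; cases i; cases "i - 1") auto

lemma pairs2_0: "pairs2 0 = {(0, 0)}"
  by (auto simp: pairs2_def)

lemma pairs2_1: "pairs2 (Suc 0) = {(1, 0)}"
  unfolding pairs2_def by (auto, presburger)

lemma pairs2_2: "pairs2 2 = {(2, 0), (0, 1)}"
  by (auto simp: pairs2_def) presburger+

text \<open>Over an arbitrary commutative ring because it serves both the indeterminates that define
  N and the complex roots a, b.\<close>

lemma waring_power_sum:
  fixes a b :: "'a :: comm_ring_1"
  assumes "n \<ge> 1"
  shows "a ^ n + b ^ n = (\<Sum>(i, j)\<in>pairs2 n. of_int (waring i j) * (a + b) ^ i * (a * b) ^ j)"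
  using assms
proof (induction n rule: less_induct)
  case (less n)
  let ?p = "\<lambda>n. \<Sum>(i, j)\<in>pairs2 n. of_int (waring i j) * (a + b) ^ i * (a * b) ^ j"
  consider "n = 1" | "n = 2" | m where "n = Suc (Suc m)" "m \<ge> 1"
    using less.prems by (cases n; cases "n - 1"; cases "n - 2") auto
  then show ?case
  proof cases
    case 1
    then show ?thesis by (simp add: pairs2_1)
  next
    case 2
    have "waring 2 0 = 1" by (simp add: numeral_2_eq_2)
    then show ?thesis unfolding 2 pairs2_2 by (simp add: algebra_simps power2_eq_square)
  next
    case (3 m)
    have "?p n = (\<Sum>(i, j)\<in>pairs2 n.
         (if i = 0 then 0 else (a + b) * (of_int (waring (i - 1) j) * (a + b) ^ (i - 1) * (a * b) ^ j))
       - (if j = 0 then 0 else (a * b) * (of_int (waring i (j - 1)) * (a + b) ^ i * (a * b) ^ (j - 1))))"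
    proof (intro sum.cong refl, clarify)
      fix i j assume "(i, j) \<in> pairs2 n"
      then have "i + 2 * j \<ge> 3" using 3 by (simp add: pairs2_def)
      from waring_rec[OF this] show "of_int (waring i j) * (a + b) ^ i * (a * b) ^ j =
         (if i = 0 then 0 else (a + b) * (of_int (waring (i - 1) j) * (a + b) ^ (i - 1) * (a * b) ^ j))
       - (if j = 0 then 0 else (a * b) * (of_int (waring i (j - 1)) * (a + b) ^ i * (a * b) ^ (j - 1)))"
        by (cases i; cases j) (simp_all add: algebra_simps)
    qed
    also have "\<dots> = (\<Sum>(i, j)\<in>pairs2 n. if i = 0 then 0 else (a + b) * (of_int (waring (i - 1) j) * (a + b) ^ (i - 1) * (a * b) ^ j))
       - (\<Sum>(i, j)\<in>pairs2 n. if j = 0 then 0 else (a * b) * (of_int (waring i (j - 1)) * (a + b) ^ i * (a * b) ^ (j - 1)))"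
      by (simp add: sum_subtractf[symmetric] case_prod_unfold)
    also have "\<dots> = (\<Sum>(i, j)\<in>pairs2 (Suc m). (a + b) * (of_int (waring i j) * (a + b) ^ i * (a * b) ^ j))
       - (\<Sum>(i, j)\<in>pairs2 m. (a * b) * (of_int (waring i j) * (a + b) ^ i * (a * b) ^ j))"
      unfolding 3(1)
        sum_pairs2_Suc_fst[where f = "\<lambda>i j. (a + b) * (of_int (waring i j) * (a + b) ^ i * (a * b) ^ j)"]
        sum_pairs2_Suc_snd[where f = "\<lambda>i j. (a * b) * (of_int (waring i j) * (a + b) ^ i * (a * b) ^ j)"] ..
    also have "\<dots> = (a + b) * ?p (Suc m) - (a * b) * ?p m"
      by (simp add: sum_distrib_left case_prod_unfold)
    also have "\<dots> = (a + b) * (a ^ Suc m + b ^ Suc m) - (a * b) * (a ^ m + b ^ m)"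
      using less.IH[of "Suc m"] less.IH[of m] 3 by simp
    also have "\<dots> = a ^ n + b ^ n" by (simp add: 3(1) algebra_simps)
    finally show ?thesis by simp
  qed
qed

text \<open>Setting b = 0 leaves only \<open>c n 0\<close> times a^n, so this coefficient vanishes.
  All remaining terms are divisible by a b, and dividing leads to the case n - 2.\<close>

lemma symmetric_monomials_independent:
  fixes c :: "nat \<Rightarrow> nat \<Rightarrow> int"
  assumes "(\<Sum>(i, j)\<in>pairs2 n. of_int (c i j) * (var_a + var_b) ^ i * (var_a * var_b) ^ j) = 0"
    and "i + 2 * j = n"
  shows "c i j = 0"
  using assms
proof (induction n arbitrary: c i j rule: less_induct)
  case (less n)
  let ?t = "\<lambda>c i j. of_int (c i j) * (var_a + var_b) ^ i * (var_a * var_b) ^ j :: int poly poly"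
  have split: "(\<Sum>(i, j)\<in>pairs2 n. ?t c i j) = ?t c n 0 + (\<Sum>(i, j)\<in>pairs2 n. if j = 0 then 0 else ?t c i j)"
  proof -
    have "(\<Sum>(i, j)\<in>pairs2 n. ?t c i j) = ?t c n 0 + (\<Sum>(i, j)\<in>pairs2 n - {(n, 0)}. ?t c i j)"
      using sum.remove[OF finite_pairs2, of "(n, 0)" n "\<lambda>(i, j). ?t c i j"] by (simp add: pairs2_def[of n])
    also have "(\<Sum>(i, j)\<in>pairs2 n - {(n, 0)}. ?t c i j) = (\<Sum>(i, j)\<in>pairs2 n. if j = 0 then 0 else ?t c i j)"
      by (intro sum.mono_neutral_cong_left finite_pairs2) (auto simp: pairs2_def split: if_splits)
    finally show ?thesis .
  qed
  \<comment> \<open>Evaluation at 0 is the substitution b = 0, the outer polynomials being those in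
    b.\<close>
  have "poly (\<Sum>(i, j)\<in>pairs2 n. if j = 0 then 0 else ?t c i j) 0 = 0"
    unfolding poly_sum by (intro sum.neutral) (auto simp: var_b_def)
  moreover have "poly (?t c n 0 + (\<Sum>(i, j)\<in>pairs2 n. if j = 0 then 0 else ?t c i j)) 0 = 0"
    using less.prems(1) unfolding split by (simp only: poly_0)
  ultimately have p0: "poly (?t c n 0) 0 = 0"
    by (simp only: poly_add add_0_right)
  have "poly (?t c n 0) 0 = of_int (c n 0) * [:0, 1:] ^ n"
    by (simp add: var_a_def var_b_def poly_power of_int_poly)
  with p0 have "of_int (c n 0) * [:0, 1 :: int:] ^ n = 0" by (simp only:)
  then have c0: "c n 0 = 0" by simp
  show ?case
  proof (cases j)
    case 0
    with c0 less.prems(2) show ?thesis by simp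
  next
    case (Suc j')
    then obtain m where m: "n = Suc (Suc m)" "i + 2 * j' = m" using less.prems(2) by auto
    have "0 = (\<Sum>(i, j)\<in>pairs2 n. if j = 0 then 0 else ?t c i j)"
      using less.prems(1) unfolding split by (simp add: c0)
    also have "\<dots> = (\<Sum>(i, j)\<in>pairs2 n. if j = 0 then 0 else ?t c i (Suc (j - 1)))"
      by (intro sum.cong) auto
    also have "\<dots> = (\<Sum>(i, j)\<in>pairs2 m. ?t c i (Suc j))"
      unfolding m(1) by (rule sum_pairs2_Suc_snd)
    also have "\<dots> = (var_a * var_b) * (\<Sum>(i, j)\<in>pairs2 m. ?t (\<lambda>i j. c i (Suc j)) i j)"
      unfolding sum_distrib_left by (intro sum.cong) (auto simp: mult_ac)
    finally have "(\<Sum>(i, j)\<in>pairs2 m. ?t (\<lambda>i j. c i (Suc j)) i j) = 0"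
      by (simp add: var_a_def var_b_def)
    from less.IH[OF _ this m(2)] m(1) show ?thesis by (simp add: Suc)
  qed
qed

text \<open>Linear independence of the monomials gives the uniqueness behind the definite
  description. The value at (0, 0) is prescribed by \<open>is_N\<close> itself, as the power sum
  identities start at n = 1.\<close>

lemma N_coeff_eq: "N_coeff (int i) (int j) = waring i j"
proof -
  define f where "f i j = (if i < 0 \<or> j < 0 then 0 else waring (nat i) (nat j))" for i j :: int
  have f: "is_N f"
    unfolding is_N_def using waring_power_sum[where a = var_a and b = var_b]
    by (auto simp: f_def pairs2_def)
  have "g = f" if g: "is_N g" for g
  proof (intro ext)
    fix i j
    show "g i j = f i j"
    proof (cases "i < 0 \<or> j < 0 \<or> i = 0 \<and> j = 0")
      case True
      with f g show ?thesis unfolding is_N_def by metis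
    next
      case False
      define p q where "p = nat i" and "q = nat j"
      have pq: "i = int p" "j = int q" "p + 2 * q \<ge> 1"
        using False by (auto simp: p_def q_def)
      have "(\<Sum>(i, j)\<in>pairs2 (p + 2 * q). of_int (g (int i) (int j) - f (int i) (int j)) * (var_a + var_b) ^ i * (var_a * var_b) ^ j) = 0"
      proof -
        have "(\<Sum>(i, j)\<in>pairs2 (p + 2 * q). of_int (g (int i) (int j)) * (var_a + var_b) ^ i * (var_a * var_b) ^ j)
           = (\<Sum>(i, j)\<in>pairs2 (p + 2 * q). of_int (f (int i) (int j)) * (var_a + var_b) ^ i * (var_a * var_b) ^ j)"
        proof -
          have "var_a ^ (p + 2 * q) + var_b ^ (p + 2 * q) =
              (\<Sum>(i, j)\<in>pairs2 (p + 2 * q). of_int (h (int i) (int j)) * (var_a + var_b) ^ i * (var_a * var_b) ^ j)"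
            if "is_N h" for h using that pq(3) unfolding is_N_def pairs2_def by blast
          from this[OF f] this[OF g] show ?thesis by simp
        qed
        then show ?thesis
          by (simp add: left_diff_distrib sum_subtractf case_prod_unfold)
      qed
      from symmetric_monomials_independent[where c = "\<lambda>i j. g (int i) (int j) - f (int i) (int j)", OF this refl]
      show ?thesis using pq by simp
    qed
  qed
  with f have "N_coeff = f" unfolding N_coeff_def by (intro the_equality)
  then have "N_coeff (int i) (int j) = f (int i) (int j)" by simp
  also have "\<dots> = waring i j" by (simp add: f_def)
  finally show ?thesis .
qed

section \<open>Generating series with three indices\<close>

lemma sum_antidiagonal: "(\<Sum>(a, b)\<in>{(a, b). a + b = n}. f a b) = (\<Sum>i\<le>n. f (n - i) i)" for n :: nat
  by (rule sum.reindex_bij_witness[of _ "\<lambda>i. (n - i, i)" "\<lambda>(a, b). b"]) auto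

definition triples :: "nat \<Rightarrow> (nat \<times> nat \<times> nat) set" where
  "triples d = {(k, l, m). k + l + 2 * m = d}"

lemma finite_triples [simp]: "finite (triples d)"
  by (rule finite_subset[of _ "{..d} \<times> {..d} \<times> {..d}"]) (auto simp: triples_def)

definition gen :: "complex \<Rightarrow> complex \<Rightarrow> complex \<Rightarrow> (nat \<Rightarrow> nat \<Rightarrow> nat \<Rightarrow> complex) \<Rightarrow> complex fps" where
  "gen u v W c = Abs_fps (\<lambda>d. \<Sum>(k, l, m)\<in>triples d. c k l m * (u ^ k * v ^ l * W ^ m))"

definition conv :: "(nat \<Rightarrow> nat \<Rightarrow> nat \<Rightarrow> complex) \<Rightarrow> (nat \<Rightarrow> nat \<Rightarrow> nat \<Rightarrow> complex) \<Rightarrow> nat \<Rightarrow> nat \<Rightarrow> nat \<Rightarrow> complex" where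
  "conv c c' k l m = (\<Sum>(k', k'')\<in>{(k', k''). k' + k'' = k}. \<Sum>(l', l'')\<in>{(l', l''). l' + l'' = l}.
     \<Sum>(m', m'')\<in>{(m', m''). m' + m'' = m}. c k' l' m' * c' k'' l'' m'')"

lemma gen_add: "gen u v W (\<lambda>k l m. c k l m + c' k l m) = gen u v W c + gen u v W c'"
  by (intro fps_ext) (simp add: gen_def case_prod_unfold distrib_right sum.distrib)

lemma gen_diff: "gen u v W (\<lambda>k l m. c k l m - c' k l m) = gen u v W c - gen u v W c'"
  by (intro fps_ext) (simp add: gen_def case_prod_unfold left_diff_distrib sum_subtractf)

lemma gen_mult: "gen u v W c * gen u v W c' = gen u v W (conv c c')"
proof (rule fps_ext)
  fix d
  let ?t = "\<lambda>c (k, l, m). c k l m * (u ^ k * v ^ l * W ^ m)"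
  let ?Q = "\<lambda>(k, l, m). {(k', k''). k' + k'' = k} \<times> {(l', l''). l' + l'' = l} \<times> {(m', m''). m' + m'' = (m::nat)}"
  have fin: "finite {(a, b). a + b = n}" for n :: nat
    by (rule finite_subset[of _ "{..n} \<times> {..n}"]) auto
  have "(gen u v W c * gen u v W c') $ d = (\<Sum>i\<le>d. \<Sum>p\<in>triples i. \<Sum>q\<in>triples (d - i). ?t c p * ?t c' q)"
    by (simp add: gen_def fps_mult_nth atLeast0AtMost sum_product)
  also have "\<dots> = (\<Sum>(i, p, q)\<in>(SIGMA i:{..d}. triples i \<times> triples (d - i)). ?t c p * ?t c' q)"
    by (simp add: sum.Sigma sum.cartesian_product)
  also have "\<dots> = (\<Sum>(p, ((k', k''), (l', l''), (m', m'')))\<in>(SIGMA p:triples d. ?Q p).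
      c k' l' m' * c' k'' l'' m'' * (case p of (k, l, m) \<Rightarrow> u ^ k * v ^ l * W ^ m))"
    by (rule sum.reindex_bij_witness[where
          i = "\<lambda>(p, ((k', k''), (l', l''), (m', m''))). (k' + l' + 2 * m', (k', l', m'), (k'', l'', m''))" and
          j = "\<lambda>(i, (k', l', m'), (k'', l'', m'')). ((k' + k'', l' + l'', m' + m''), ((k', k''), (l', l''), (m', m'')))"])
       (auto simp: triples_def power_add mult_ac)
  also have "\<dots> = (\<Sum>p\<in>triples d. \<Sum>((k', k''), (l', l''), (m', m''))\<in>?Q p.
      c k' l' m' * c' k'' l'' m'' * (case p of (k, l, m) \<Rightarrow> u ^ k * v ^ l * W ^ m))"
    by (rule sum.Sigma[symmetric]) (auto simp: fin)
  also have "\<dots> = gen u v W (conv c c') $ d"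
    unfolding gen_def fps_nth_Abs_fps
    by (intro sum.cong refl)
       (auto simp: conv_def sum_distrib_right case_prod_unfold sum.cartesian_product)
  finally show "(gen u v W c * gen u v W c') $ d = gen u v W (conv c c') $ d" .
qed

text \<open>In a fixed degree d the difference is a polynomial in u, v, W that vanishes identically;
  its coefficients are shown to be zero one variable at a time.\<close>

lemma gen_inject:
  assumes "\<And>u v W. gen u v W c = gen u v W c'"
  shows "c k l m = c' k l m"
proof -
  define d where "d = k + l + 2 * m"
  \<comment> \<open>Extended by zero from degree d to a box, so that the sum becomes an iterated
    polynomial in one variable each.\<close>
  define e where "e k l m = (if k + l + 2 * m = d then c k l m - c' k l m else 0)" for k l m
  have "(\<Sum>k\<le>d. (\<Sum>l\<le>d. (\<Sum>m\<le>d. e k l m * W ^ m) * v ^ l) * u ^ k) = 0" for u v W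
  proof -
    have "(\<Sum>k\<le>d. (\<Sum>l\<le>d. (\<Sum>m\<le>d. e k l m * W ^ m) * v ^ l) * u ^ k)
       = (\<Sum>(k, l, m)\<in>{..d} \<times> {..d} \<times> {..d}. e k l m * (u ^ k * v ^ l * W ^ m))"
      unfolding sum_distrib_right sum.cartesian_product by (intro sum.cong) (auto simp: mult_ac)
    also have "\<dots> = (\<Sum>(k, l, m)\<in>triples d. (c k l m - c' k l m) * (u ^ k * v ^ l * W ^ m))"
      by (intro sum.mono_neutral_cong_right) (auto simp: triples_def e_def split: if_splits)
    also have "\<dots> = (gen u v W c - gen u v W c') $ d"
      unfolding gen_diff[symmetric] by (simp add: gen_def)
    finally show ?thesis using assms by simp
  qed
  then have 1: "\<forall>u. (\<Sum>k\<le>d. (\<Sum>l\<le>d. (\<Sum>m\<le>d. e k l m * W ^ m) * v ^ l) * u ^ k) = 0" for v W by blast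
  have 2: "\<forall>v. (\<Sum>l\<le>d. (\<Sum>m\<le>d. e k l m * W ^ m) * v ^ l) = 0" if "k \<le> d" for k W
    using 1[unfolded polyfun_eq_0] that by blast
  have 3: "\<forall>W. (\<Sum>m\<le>d. e k l m * W ^ m) = 0" if "k \<le> d" "l \<le> d" for k l
    using 2[OF that(1), unfolded polyfun_eq_0] that(2) by blast
  have "e k l m = 0" if "k \<le> d" "l \<le> d" "m \<le> d" for k l m
    using 3[OF that(1,2), unfolded polyfun_eq_0] that(3) by blast
  then have "e k l m = 0" by (simp add: d_def)
  then show ?thesis by (simp add: e_def d_def)
qed

section \<open>The right-hand side\<close>

text \<open>The substitution f(u T).\<close>

definition scale :: "complex \<Rightarrow> complex fps \<Rightarrow> complex fps" where
  "scale u f = Abs_fps (\<lambda>k. f $ k * u ^ k)"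

lemma scale_mult: "scale u (f * g) = scale u f * scale u g"
proof (rule fps_ext)
  fix d
  show "scale u (f * g) $ d = (scale u f * scale u g) $ d"
    unfolding scale_def fps_nth_Abs_fps fps_mult_nth sum_distrib_right
    by (intro sum.cong) (auto simp: mult_ac simp flip: power_add)
qed

definition P_series :: "(nat \<Rightarrow> complex) \<Rightarrow> complex fps" where
  "P_series a = Abs_fps (\<lambda>n. P_exp n a)"

lemma P_series_nth: "fps_nth (P_series a) = (\<lambda>n. P_exp n a)"
  by (simp add: P_series_def fun_eq_iff)

lemma P_series_0: "P_series a $ 0 = 1"
  by (simp add: P_series_def P_exp_def)

lemma fps_theta_P_series:
  "fps_theta (P_series a) = Abs_fps (\<lambda>k. of_nat k * a k) * P_series a"
proof -
  let ?A = "Abs_fps (\<lambda>i. if i = 0 then 0 else a i)"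
  have P: "P_series a = fps_exp 1 oo ?A" by (intro fps_ext) (simp add: P_series_def P_exp_def)
  have "fps_deriv (P_series a) = P_series a * fps_deriv ?A"
    unfolding P by (subst fps_compose_deriv) simp_all
  moreover have "fps_theta ?A = Abs_fps (\<lambda>k. of_nat k * a k)"
    by (intro fps_ext) (simp add: fps_theta_nth)
  ultimately show ?thesis by (simp add: fps_theta_def mult_ac)
qed

lemma fps_theta_scale_P_series:
  "fps_theta (scale u (P_series a)) = Abs_fps (\<lambda>k. of_nat k * a k * u ^ k) * scale u (P_series a)"
proof -
  have "fps_theta (scale u (P_series a)) = scale u (fps_theta (P_series a))"
    by (intro fps_ext) (simp add: fps_theta_nth scale_def)
  also have "\<dots> = scale u (Abs_fps (\<lambda>k. of_nat k * a k)) * scale u (P_series a)"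
    unfolding fps_theta_P_series scale_mult ..
  finally show ?thesis by (simp add: scale_def)
qed

text \<open>The exponential of the sum over n >= 2 of zeta(n) (u^n + v^n - a^n - b^n) T^n / n. For a
  + b = u + v this is the expansion of the quotient of Gamma values.\<close>

definition E_series :: "complex \<Rightarrow> complex \<Rightarrow> complex \<Rightarrow> complex \<Rightarrow> complex fps" where
  "E_series u v a b = (scale u (P_series zeta_seq) * scale v (P_series zeta_seq))
     * (scale a (P_series (\<lambda>n. - zeta_seq n)) * scale b (P_series (\<lambda>n. - zeta_seq n)))"

lemma E_series_0: "E_series u v a b $ 0 = 1"
  by (simp add: E_series_def scale_def P_series_0)

lemma fps_theta_E_series:
  "fps_theta (E_series u v a b) = power_sums u v a b (\<lambda>k. if k \<le> 1 then 0 else zeta k) * E_series u v a b"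
proof -
  let ?S = "\<lambda>c u. Abs_fps (\<lambda>k. of_nat k * (c * zeta_seq k) * u ^ k)"
  have pos: "fps_theta (scale u (P_series zeta_seq)) = ?S 1 u * scale u (P_series zeta_seq)" for u
    using fps_theta_scale_P_series[of u zeta_seq] by simp
  have neg: "fps_theta (scale u (P_series (\<lambda>n. - zeta_seq n))) = ?S (-1) u * scale u (P_series (\<lambda>n. - zeta_seq n))" for u
    using fps_theta_scale_P_series[of u "\<lambda>n. - zeta_seq n"] by simp
  have "fps_theta (E_series u v a b) = ((?S 1 u + ?S 1 v) + (?S (-1) a + ?S (-1) b)) * E_series u v a b"
    unfolding E_series_def by (intro fps_theta_factor pos neg)
  also have "(?S 1 u + ?S 1 v) + (?S (-1) a + ?S (-1) b) = power_sums u v a b (\<lambda>k. if k \<le> 1 then 0 else zeta k)"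
    by (intro fps_ext) (auto simp: power_sums_def zeta_seq_def algebra_simps)
  finally show ?thesis .
qed

text \<open>Pairs i with d - i; a middle index is its own partner and is counted once.\<close>

lemma sum_halves:
  fixes F :: "nat \<Rightarrow> nat \<Rightarrow> 'a :: comm_monoid_add"
  shows "(\<Sum>i\<le>d. F i (d - i)) = (\<Sum>i | 2 * i \<le> d. if 2 * i = d then F i i else F i (d - i) + F (d - i) i)"
proof -
  have fin: "finite {i. 2 * i \<le> d}" "finite {i. 2 * i < d}" "finite {i. 2 * i = d}"
    by (rule finite_subset[of _ "{..d}"]; force)+
  have un: "{i. 2 * i \<le> d} = {i. 2 * i < d} \<union> {i. 2 * i = d}" by auto
  have "(\<Sum>i\<le>d. F i (d - i)) = (\<Sum>i\<in>{i. 2 * i < d} \<union> {i. 2 * i = d} \<union> {i. 2 * i > d \<and> i \<le> d}. F i (d - i))"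
    by (intro sum.cong) auto
  also have "\<dots> = (\<Sum>i | 2 * i < d. F i (d - i)) + (\<Sum>i | 2 * i = d. F i (d - i)) + (\<Sum>i | 2 * i > d \<and> i \<le> d. F i (d - i))"
    by (subst sum.union_disjoint; (subst sum.union_disjoint)?) (auto simp: fin)
  also have "(\<Sum>i | 2 * i > d \<and> i \<le> d. F i (d - i)) = (\<Sum>i | 2 * i < d. F (d - i) i)"
    by (rule sum.reindex_bij_witness[of _ "\<lambda>i. d - i" "\<lambda>i. d - i"]) auto
  also have "(\<Sum>i | 2 * i < d. F i (d - i)) + (\<Sum>i | 2 * i = d. F i (d - i)) + (\<Sum>i | 2 * i < d. F (d - i) i)
     = (\<Sum>i | 2 * i < d. F i (d - i) + F (d - i) i) + (\<Sum>i | 2 * i = d. F i (d - i))"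
    by (simp add: sum.distrib add_ac)
  also have "\<dots> = (\<Sum>i | 2 * i \<le> d. if 2 * i = d then F i i else F i (d - i) + F (d - i) i)"
    unfolding un by (subst sum.union_disjoint) (auto simp: fin intro!: arg_cong2[where f = plus] sum.cong)
  finally show ?thesis .
qed

text \<open>The coefficient of \<open>(a + b) ^ h * (a * b) ^ m\<close> in the product of the two series
  with coefficients \<open>y i * a ^ i\<close> and \<open>y i * b ^ i\<close>.\<close>

definition sym_coeff :: "(nat \<Rightarrow> complex) \<Rightarrow> nat \<Rightarrow> nat \<Rightarrow> complex" where
  "sym_coeff y h m = (\<Sum>\<mu>\<le>m. y \<mu> * y (h + 2 * m - \<mu>) * of_int (waring h (m - \<mu>)))"

text \<open>Pairing i with d - i gives y_i y_(d-i) (a b)^i (a^n + b^n) with n = d - 2 i, to which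
  the expansion of power sums applies. For n = 0 the single middle term matches the value 1 of
  \<open>waring\<close> at (0, 0), not the power sum 2. Then collect by m = i + j.\<close>

lemma sym_coeff_sum:
  "(\<Sum>i\<le>d. (y i * a ^ i) * (y (d - i) * b ^ (d - i))) = (\<Sum>(h, m)\<in>pairs2 d. sym_coeff y h m * (a + b) ^ h * (a * b) ^ m)"
proof -
  let ?w = "\<lambda>h j. of_int (waring h j) * (a + b) ^ h * (a * b) ^ j"
  have fin: "finite {i. 2 * i \<le> d}" by (rule finite_subset[of _ "{..d}"]; force)
  have "(\<Sum>i\<le>d. (y i * a ^ i) * (y (d - i) * b ^ (d - i)))
     = (\<Sum>i | 2 * i \<le> d. if 2 * i = d then (y i * a ^ i) * (y i * b ^ i)
          else (y i * a ^ i) * (y (d - i) * b ^ (d - i)) + (y (d - i) * a ^ (d - i)) * (y i * b ^ i))"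
    by (rule sum_halves[where F = "\<lambda>i j. (y i * a ^ i) * (y j * b ^ j)"])
  also have "\<dots> = (\<Sum>i | 2 * i \<le> d. \<Sum>(h, j)\<in>pairs2 (d - 2 * i). y i * y (d - i) * (a * b) ^ i * ?w h j)"
  proof (intro sum.cong refl)
    fix i assume "i \<in> {i. 2 * i \<le> d}"
    then have i: "2 * i \<le> d" by simp
    have "(\<Sum>(h, j)\<in>pairs2 (d - 2 * i). y i * y (d - i) * (a * b) ^ i * ?w h j)
        = y i * y (d - i) * (a * b) ^ i * (\<Sum>(h, j)\<in>pairs2 (d - 2 * i). ?w h j)"
      by (simp add: sum_distrib_left case_prod_unfold)
    also have "\<dots> = (if 2 * i = d then (y i * a ^ i) * (y i * b ^ i)
          else (y i * a ^ i) * (y (d - i) * b ^ (d - i)) + (y (d - i) * a ^ (d - i)) * (y i * b ^ i))"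
    proof (cases "2 * i = d")
      case True
      then have "d - 2 * i = 0" "d - i = i" by auto
      then show ?thesis using True by (simp add: pairs2_0 power_mult_distrib mult_ac)
    next
      case False
      have di: "d - i = i + (d - 2 * i)" using i by simp
      have "(\<Sum>(h, j)\<in>pairs2 (d - 2 * i). ?w h j) = a ^ (d - 2 * i) + b ^ (d - 2 * i)"
        by (rule waring_power_sum[symmetric]) (use i False in simp)
      then show ?thesis using False unfolding di power_add by (simp add: power_mult_distrib algebra_simps)
    qed
    finally show "(if 2 * i = d then (y i * a ^ i) * (y i * b ^ i)
          else (y i * a ^ i) * (y (d - i) * b ^ (d - i)) + (y (d - i) * a ^ (d - i)) * (y i * b ^ i))
       = (\<Sum>(h, j)\<in>pairs2 (d - 2 * i). y i * y (d - i) * (a * b) ^ i * ?w h j)" by simp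
  qed
  also have "\<dots> = (\<Sum>(i, (h, j))\<in>(SIGMA i:{i. 2 * i \<le> d}. pairs2 (d - 2 * i)). y i * y (d - i) * (a * b) ^ i * ?w h j)"
    using fin by (simp add: sum.Sigma case_prod_unfold)
  also have "\<dots> = (\<Sum>((h, m), \<mu>)\<in>(SIGMA p:pairs2 d. {..snd p}). (y \<mu> * y (h + 2 * m - \<mu>) * of_int (waring h (m - \<mu>))) * (a + b) ^ h * (a * b) ^ m)"
  proof (rule sum.reindex_bij_witness[where
        i = "\<lambda>((h, m), \<mu>). (\<mu>, (h, m - \<mu>))" and j = "\<lambda>(i, (h, j)). ((h, i + j), i)"], goal_cases)
    case (5 x)
    then obtain i h j where x: "x = (i, (h, j))" "h + 2 * j = d - 2 * i" "2 * i \<le> d"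
      by (auto simp: pairs2_def)
    then have "h + 2 * (i + j) - i = d - i" by simp
    then show ?case by (simp add: x(1) power_add mult_ac)
  qed (auto simp: pairs2_def)
  also have "\<dots> = (\<Sum>p\<in>pairs2 d. \<Sum>\<mu>\<le>snd p. (y \<mu> * y (fst p + 2 * snd p - \<mu>) * of_int (waring (fst p) (snd p - \<mu>))) * (a + b) ^ fst p * (a * b) ^ snd p)"
    by (simp add: sum.Sigma case_prod_unfold)
  also have "\<dots> = (\<Sum>(h, m)\<in>pairs2 d. sym_coeff y h m * (a + b) ^ h * (a * b) ^ m)"
    by (intro sum.cong) (auto simp: sym_coeff_def sum_distrib_right)
  finally show ?thesis .
qed

text \<open>Replacing a + b by u + v and expanding its powers produces the binomial coefficients of
  the right-hand side.\<close>

lemma scale_product_gen: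
  assumes "a + b = u + v" "a * b = W"
  shows "scale a f * scale b f = gen u v W (\<lambda>k l m. of_nat ((k + l) choose k) * sym_coeff (fps_nth f) (k + l) m)"
proof (rule fps_ext)
  fix d
  let ?s = "sym_coeff (fps_nth f)"
  have "(scale a f * scale b f) $ d = (\<Sum>(h, m)\<in>pairs2 d. ?s h m * (u + v) ^ h * W ^ m)"
    using sym_coeff_sum[of "fps_nth f" a d b] by (simp add: scale_def fps_mult_nth atLeast0AtMost assms)
  also have "\<dots> = (\<Sum>p\<in>pairs2 d. \<Sum>k\<le>fst p. of_nat (fst p choose k) * ?s (fst p) (snd p) * (u ^ k * v ^ (fst p - k) * W ^ snd p))"
    unfolding binomial_ring case_prod_unfold sum_distrib_left sum_distrib_right
    by (intro sum.cong) (auto simp: mult_ac)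
  also have "\<dots> = (\<Sum>((h, m), k)\<in>(SIGMA p:pairs2 d. {..fst p}). of_nat (h choose k) * ?s h m * (u ^ k * v ^ (h - k) * W ^ m))"
    by (simp add: sum.Sigma case_prod_unfold)
  also have "\<dots> = (\<Sum>(k, l, m)\<in>triples d. of_nat ((k + l) choose k) * ?s (k + l) m * (u ^ k * v ^ l * W ^ m))"
    by (rule sum.reindex_bij_witness[where
        i = "\<lambda>(k, l, m). ((k + l, m), k)" and j = "\<lambda>((h, m), k). (k, h - k, m)"])
       (auto simp: pairs2_def triples_def)
  finally show "(scale a f * scale b f) $ d = gen u v W (\<lambda>k l m. of_nat ((k + l) choose k) * ?s (k + l) m) $ d"
    by (simp add: gen_def)
qed

lemma scale_gen_fst: "scale u f = gen u v W (\<lambda>k l m. if l = 0 \<and> m = 0 then f $ k else 0)"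
proof (rule fps_ext)
  fix d
  have "(\<Sum>(k, l, m)\<in>triples d. (if l = 0 \<and> m = 0 then f $ k else 0) * (u ^ k * v ^ l * W ^ m))
     = (\<Sum>(k, l, m)\<in>{(d, 0::nat, 0::nat)}. f $ k * u ^ k)"
    by (intro sum.mono_neutral_cong_right finite_triples) (auto simp: triples_def split: if_splits)
  then show "scale u f $ d = gen u v W (\<lambda>k l m. if l = 0 \<and> m = 0 then f $ k else 0) $ d"
    by (simp add: scale_def gen_def)
qed

lemma scale_gen_snd: "scale v f = gen u v W (\<lambda>k l m. if k = 0 \<and> m = 0 then f $ l else 0)"
proof (rule fps_ext)
  fix d
  have "(\<Sum>(k, l, m)\<in>triples d. (if k = 0 \<and> m = 0 then f $ l else 0) * (u ^ k * v ^ l * W ^ m))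
     = (\<Sum>(k, l, m)\<in>{(0::nat, d, 0::nat)}. f $ l * v ^ l)"
    by (intro sum.mono_neutral_cong_right finite_triples) (auto simp: triples_def split: if_splits)
  then show "scale v f $ d = gen u v W (\<lambda>k l m. if k = 0 \<and> m = 0 then f $ l else 0) $ d"
    by (simp add: scale_def gen_def)
qed

lemma sum_antidiagonal_delta:
  "(\<Sum>(a, b)\<in>{(a, b). a + b = n}. if a = 0 then f b else 0) = f n" for n :: nat
proof -
  have fin: "finite {(a, b). a + b = n}" by (rule finite_subset[of _ "{..n} \<times> {..n}"]) auto
  have "(\<Sum>(a, b)\<in>{(a, b). a + b = n}. if a = 0 then f b else 0) = (\<Sum>(a, b)\<in>{(0::nat, n)}. f b)"
    by (intro sum.mono_neutral_cong_right fin) (auto split: if_splits)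
  then show ?thesis by simp
qed

lemma conv_delta_fst:
  "conv (\<lambda>k l m. if l = 0 \<and> m = 0 then f k else 0) c k l m = (\<Sum>i\<le>k. f (k - i) * c i l m)"
proof -
  have "conv (\<lambda>k l m. if l = 0 \<and> m = 0 then f k else 0) c k l m
     = (\<Sum>(k', k'')\<in>{(k', k''). k' + k'' = k}. \<Sum>(l', l'')\<in>{(l', l''). l' + l'' = l}.
         if l' = 0 then (\<Sum>(m', m'')\<in>{(m', m''). m' + m'' = m}. if m' = 0 then f k' * c k'' l'' m'' else 0) else 0)"
    unfolding conv_def by (intro sum.cong refl; clarsimp; intro sum.cong refl; clarsimp)
      (auto intro!: sum.cong)
  then show ?thesis unfolding sum_antidiagonal_delta sum_antidiagonal .
qed

lemma conv_delta_snd: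
  "conv (\<lambda>k l m. if k = 0 \<and> m = 0 then f l else 0) c k l m = (\<Sum>j\<le>l. f (l - j) * c k j m)"
proof -
  have "conv (\<lambda>k l m. if k = 0 \<and> m = 0 then f l else 0) c k l m
     = (\<Sum>(k', k'')\<in>{(k', k''). k' + k'' = k}. if k' = 0 then (\<Sum>(l', l'')\<in>{(l', l''). l' + l'' = l}.
         (\<Sum>(m', m'')\<in>{(m', m''). m' + m'' = m}. if m' = 0 then f l' * c k'' l'' m'' else 0)) else 0)"
    unfolding conv_def by (intro sum.cong refl; clarsimp)
      (auto intro!: sum.cong sum.neutral)
  then show ?thesis unfolding sum_antidiagonal_delta sum_antidiagonal .
qed

definition rhs_coeff :: "nat \<Rightarrow> nat \<Rightarrow> nat \<Rightarrow> complex" where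
  "rhs_coeff k l m = (\<Sum>i\<le>k. \<Sum>j\<le>l. \<Sum>\<mu>\<le>m.
       of_nat ((i + j) choose i)
       * P_exp (k - i) zeta_seq * P_exp (l - j) zeta_seq
       * P_exp \<mu> (\<lambda>n. - zeta_seq n) * P_exp (i + j + 2 * m - \<mu>) (\<lambda>n. - zeta_seq n)
       * of_int (N_coeff (int (i + j)) (int m - int \<mu>)))"

text \<open>The factors in u and in v are supported on the axes of k and of l, so convolution with
  them produces just the sums over i and j.\<close>

lemma E_series_gen:
  assumes "a + b = u + v" "a * b = W"
  shows "E_series u v a b = gen u v W rhs_coeff"
proof -
  let ?Z = "\<lambda>k. P_exp k zeta_seq" and ?y = "\<lambda>k. P_exp k (\<lambda>n. - zeta_seq n)"
  let ?Y = "\<lambda>k l m. of_nat ((k + l) choose k) * sym_coeff ?y (k + l) m"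
  have "E_series u v a b = scale u (P_series zeta_seq) * (scale v (P_series zeta_seq) *
     (scale a (P_series (\<lambda>n. - zeta_seq n)) * scale b (P_series (\<lambda>n. - zeta_seq n))))"
    unfolding E_series_def by (simp only: mult.assoc)
  also have "\<dots> = gen u v W (conv (\<lambda>k l m. if l = 0 \<and> m = 0 then ?Z k else 0)
      (conv (\<lambda>k l m. if k = 0 \<and> m = 0 then ?Z l else 0) ?Y))"
    unfolding scale_product_gen[OF assms] scale_gen_fst[of u _ v W] scale_gen_snd[of v _ u W] gen_mult P_series_nth ..
  also have "conv (\<lambda>k l m. if l = 0 \<and> m = 0 then ?Z k else 0)
      (conv (\<lambda>k l m. if k = 0 \<and> m = 0 then ?Z l else 0) ?Y) = rhs_coeff"
  proof (intro ext)
    fix k l m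
    have N: "N_coeff (int (i + j)) (int m - int \<mu>) = waring (i + j) (m - \<mu>)" if "\<mu> \<le> m" for i j \<mu>
      using N_coeff_eq[of "i + j" "m - \<mu>"] that by (simp add: of_nat_diff)
    show "conv (\<lambda>k l m. if l = 0 \<and> m = 0 then ?Z k else 0)
      (conv (\<lambda>k l m. if k = 0 \<and> m = 0 then ?Z l else 0) ?Y) k l m = rhs_coeff k l m"
      unfolding conv_delta_fst conv_delta_snd rhs_coeff_def sym_coeff_def sum_distrib_left
      by (intro sum.cong refl) (simp add: N mult_ac del: of_nat_add)
  qed
  finally show ?thesis .
qed

lemma complex_roots_exist:
  fixes s p :: complex
  obtains a b where "a + b = s" "a * b = p"
proof
  let ?d = "csqrt (s ^ 2 - 4 * p)"
  show "(s + ?d) / 2 + (s - ?d) / 2 = s" by (simp add: field_simps)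
  have "(s + ?d) / 2 * ((s - ?d) / 2) = (s ^ 2 - ?d ^ 2) / 4"
    by (simp add: power2_eq_square algebra_simps)
  then show "(s + ?d) / 2 * ((s - ?d) / 2) = p" by simp
qed

lemma hyp_value_gen: "hyp_value u v W 0 = gen u v W rhs_coeff"
proof -
  obtain a b where ab: "a + b = u + v" "a * b = W" by (rule complex_roots_exist)
  show ?thesis
    using gauss_summation[OF ab E_series_0 fps_theta_E_series] E_series_gen[OF ab] by simp
qed

section \<open>The connection formula on the unit interval\<close>

text \<open>By the bounds on the height, no word has the parameters for which the definition
  prescribes 0, so the convention agrees with the empty sum.\<close>

lemma G0_eq_sum:
  "G0 L (int K) (int n) (int s) z = (\<Sum>w | w \<in> words_from Lx K \<and> depth w = n \<and> height w = s. L w z)"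
proof (cases "K < n + s \<or> n < s \<or> K = 0 \<or> n = 0 \<or> s = 0")
  case True
  have "\<not> (depth w = n \<and> height w = s)" if "w \<in> words_from Lx K" for w
    using that True height_bounds[of w] height_ge_1[of w] length_eq_count[of w]
    by (auto simp: words_from_def)
  then have empty: "{w. w \<in> words_from Lx K \<and> depth w = n \<and> height w = s} = {}" by blast
  have "G0 L (int K) (int n) (int s) z = 0" using True by (auto simp: G0_def)
  then show ?thesis unfolding empty by simp
next
  case False
  have "{w \<in> h0_words. int (length w) = int K \<and> int (depth w) = int n \<and> int (height w) = int s}
      = {w. w \<in> words_from Lx K \<and> depth w = n \<and> height w = s}"
    using False by (auto simp: words_from_def h0_words_iff)
  with False show ?thesis by (simp add: G0_def)
qed

definition words_all :: "nat \<Rightarrow> word set" where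
  "words_all n = words_from Lx n \<union> words_from Ly n"

lemma words_all_iff: "w \<in> words_all n \<longleftrightarrow> w \<in> h1_words \<and> length w = n \<and> w \<noteq> []"
  by (cases "hd w") (auto simp: words_all_def words_from_def)

lemma G1_eq_sum:
  "G1 L (int K) (int n) (int s) z = (\<Sum>w | w \<in> words_all K \<and> depth w = n \<and> height w = s. L w z)"
proof (cases "K + 1 < n + s \<or> n < s \<or> K = 0 \<or> n = 0 \<or> s = 0")
  case True
  have "\<not> (depth w = n \<and> height w = s)" if "w \<in> words_all K" for w
    using that True height_bounds[of w] height_ge_1[of w] length_eq_count[of w]
    by (auto simp: words_all_iff)
  then have empty: "{w. w \<in> words_all K \<and> depth w = n \<and> height w = s} = {}" by blast
  have "G1 L (int K) (int n) (int s) z = 0" using True by (auto simp: G1_def)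
  then show ?thesis unfolding empty by simp
next
  case False
  have "{w \<in> h1_words. int (length w) = int K \<and> int (depth w) = int n \<and> int (height w) = int s}
      = {w. w \<in> words_all K \<and> depth w = n \<and> height w = s}"
    using False by (auto simp: words_all_iff)
  with False show ?thesis by (simp add: G1_def)
qed

lemma words_from_Lx_stats:
  assumes "w \<in> words_from Lx d"
  shows "height w \<le> depth w \<and> height w \<le> count_list w Lx \<and> d = count_list w Lx + depth w \<and> 1 \<le> height w"
  using assms height_bounds[of w] length_eq_count[of w] height_ge_1[of w] by (simp add: words_from_def)

lemma words_all_stats:
  assumes "w \<in> words_all d"
  shows "height w \<le> depth w \<and> height w \<le> Suc (count_list w Lx) \<and> d = count_list w Lx + depth w \<and> 1 \<le> height w"
  using assms height_bounds[of w] length_eq_count[of w] height_ge_1[of w] by (simp add: words_all_iff)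

text \<open>Sorts the words by the exponents they contribute; \<open>iff\<close> says that depth and
  height determine this triple within a given degree. The variants of \<open>G0\<close> and
  \<open>G1\<close> below differ only in shifts of weight, depth and height, so one lemma serves all
  of them.\<close>

lemma gen_word_sum:
  fixes f :: "word \<Rightarrow> complex"
  assumes fin: "\<And>d. finite (A d)"
    and tri: "\<And>w d. w \<in> A d \<Longrightarrow> (\<kappa> w, \<nu> w, \<mu> w) \<in> triples d"
    and iff: "\<And>w d k l m. w \<in> A d \<Longrightarrow> (k, l, m) \<in> triples d \<Longrightarrow>
      depth w = n k l m \<and> height w = s k l m \<longleftrightarrow> (\<kappa> w, \<nu> w, \<mu> w) = (k, l, m)"
  shows "gen u v W (\<lambda>k l m. \<Sum>w | w \<in> A (k + l + 2 * m) \<and> depth w = n k l m \<and> height w = s k l m. f w) $ d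
    = (\<Sum>w\<in>A d. u ^ \<kappa> w * v ^ \<nu> w * W ^ \<mu> w * f w)"
proof -
  let ?g = "\<lambda>(k, l, m). u ^ k * v ^ l * W ^ m" and ?p = "\<lambda>w. (\<kappa> w, \<nu> w, \<mu> w)"
  have "gen u v W (\<lambda>k l m. \<Sum>w | w \<in> A (k + l + 2 * m) \<and> depth w = n k l m \<and> height w = s k l m. f w) $ d
    = (\<Sum>p\<in>triples d. \<Sum>w\<in>{w \<in> A d. ?p w = p}. ?g (?p w) * f w)"
    unfolding gen_def fps_nth_Abs_fps
  proof (intro sum.cong refl)
    fix p assume p: "p \<in> triples d"
    obtain k l m where klm: "p = (k, l, m)" by (cases p)
    have eq: "{w. w \<in> A (k + l + 2 * m) \<and> depth w = n k l m \<and> height w = s k l m} = {w \<in> A d. ?p w = (k, l, m)}"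
      using iff[OF _ p[unfolded klm]] p by (auto simp: klm triples_def)
    show "(case p of (k, l, m) \<Rightarrow> (\<Sum>w | w \<in> A (k + l + 2 * m) \<and> depth w = n k l m \<and> height w = s k l m. f w)
          * (u ^ k * v ^ l * W ^ m)) = (\<Sum>w\<in>{w \<in> A d. ?p w = p}. ?g (?p w) * f w)"
      unfolding klm prod.case eq sum_distrib_right by (intro sum.cong) (auto simp: mult.commute)
  qed
  also have "\<dots> = (\<Sum>w\<in>A d. ?g (?p w) * f w)"
    by (rule sum.group) (use fin tri in auto)
  finally show ?thesis by simp
qed

lemma gen_G0:
  "gen u v W (\<lambda>k l m. G0 L (int (k + l + 2 * m)) (int (l + m)) (int m) z) = quad W * FX u v W (\<lambda>w. L w z)" (is "?l = ?r")
proof (rule fps_ext)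
  fix d
  have W: "W ^ height w = W * W ^ (height w - 1)" for w
    using height_ge_1[of w] by (simp flip: power_Suc)
  have "?l $ d
     = (\<Sum>w\<in>words_from Lx d. u ^ (count_list w Lx - height w) * v ^ (depth w - height w) * W ^ height w * L w z)"
    unfolding G0_eq_sum
    by (rule gen_word_sum; (drule words_from_Lx_stats)?; (simp add: triples_def)?; arith?)
  also have "\<dots> = (\<Sum>w\<in>words_from Lx d. W * (wtx u v W w * L w z))"
    by (simp add: wtx_def W mult_ac)
  also have "\<dots> = (quad W * FX u v W (\<lambda>w. L w z)) $ d"
    unfolding quad_mult_nth by (cases d; cases "d - 1") (auto simp: FX_def sum_distrib_left)
  finally show "?l $ d = ?r $ d" .
qed

lemma gen_G0_Suc:
  "gen u v W (\<lambda>k l m. G0 L (int (k + l + 2 * m)) (int (l + m)) (int m + 1) z)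
   = lin u * lin v * FX u v W (\<lambda>w. L w z)" (is "?l = ?r")
proof (rule fps_ext)
  fix d
  have Suc: "int m + 1 = int (Suc m)" for m by simp
  have "?l $ d
     = (\<Sum>w\<in>words_from Lx d. u ^ Suc (count_list w Lx - height w) * v ^ Suc (depth w - height w) * W ^ (height w - 1) * L w z)"
    unfolding Suc G0_eq_sum
    by (rule gen_word_sum; (drule words_from_Lx_stats)?; (simp add: triples_def)?; arith?)
  also have "\<dots> = (\<Sum>w\<in>words_from Lx d. u * v * (wtx u v W w * L w z))"
    by (simp add: wtx_def mult_ac)
  also have "\<dots> = (lin u * lin v * FX u v W (\<lambda>w. L w z)) $ d"
    unfolding mult.assoc lin_mult_nth by (cases d; cases "d - 1") (auto simp: FX_def sum_distrib_left mult_ac)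
  finally show "?l $ d = ?r $ d" .
qed

text \<open>The same words enter with the factor W T^2 at height m and u v T^2 at height m + 1. The
  difference is c, which explains the passage from \<open>G0\<close> to
  \<open>Gbar0\<close>.\<close>

lemma gen_Gbar0:
  "gen u v W (\<lambda>k l m. Gbar0 L (int (k + l + 2 * m)) (int (l + m)) (int m) z)
   = hypc u v W * FX u v W (\<lambda>w. L w z)"
  unfolding Gbar0_def gen_diff gen_G0 gen_G0_Suc hypc_def left_diff_distrib ..

text \<open>For a word starting with x, \<open>wty\<close> is u times \<open>wtx\<close>, so the two
  parts of \<open>hypG\<close> merge into one sum.\<close>

lemma hypG_nth: "hypG u v W L $ d = (\<Sum>w\<in>words_all (Suc d). wty u v W w * L w)"
proof -
  have "(\<Sum>w\<in>words_all (Suc d). wty u v W w * L w)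
     = (\<Sum>w\<in>words_from Lx (Suc d). wty u v W w * L w) + (\<Sum>w\<in>words_from Ly (Suc d). wty u v W w * L w)"
    unfolding words_all_def by (rule sum.union_disjoint) (use words_from_disjoint in auto)
  also have "(\<Sum>w\<in>words_from Ly (Suc d). wty u v W w * L w) = FY u v W L $ d"
    by (simp add: FY_def wty_def)
  also have "(\<Sum>w\<in>words_from Lx (Suc d). wty u v W w * L w) = (lin u * FX u v W L) $ d"
  proof -
    have "wty u v W w = u * wtx u v W w" if "w \<in> words_from Lx n" for w n
      using that height_bounds[of w] by (auto simp: words_from_def wty_def wtx_def Suc_diff_le)
    then show ?thesis
      unfolding lin_mult_nth by (cases d) (auto simp: FX_def sum_distrib_left mult.assoc intro!: sum.cong)
  qed
  finally show ?thesis by (simp add: hypG_def)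
qed

lemma words_all_0: "words_all 0 = {}"
  by (simp add: words_all_def)

lemma G1_neg: "k \<le> 0 \<Longrightarrow> G1 L k n s z = 0"
  by (simp add: G1_def)

text \<open>For \<open>K = 0\<close> the integer weight is -1 while the truncated one is 0; both
  sides are zero.\<close>

lemma G1_pred_eq_sum:
  "G1 L (int K - 1) (int n) (int s) z = (\<Sum>w | w \<in> words_all (K - 1) \<and> depth w = n \<and> height w = s. L w z)"
proof (cases K)
  case 0
  then show ?thesis by (simp add: G1_neg words_all_0)
next
  case (Suc K')
  then have "int K - 1 = int K'" by simp
  then show ?thesis using Suc by (simp only: G1_eq_sum diff_Suc_1)
qed

lemma finite_words_all [simp]: "finite (words_all n)"
  by (simp add: words_all_def)

lemma gen_G1_pred:
  "gen u v W (\<lambda>k l m. G1 L (int (k + l + 2 * m) - 1) (int (l + m)) (int m) z) = quad W * hypG u v W (\<lambda>w. L w z)" (is "?l = ?r")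
proof (rule fps_ext)
  fix d
  have W: "W ^ height w = W * W ^ (height w - 1)" for w
    using height_ge_1[of w] by (simp flip: power_Suc)
  have "?l $ d
     = (\<Sum>w\<in>words_all (d - 1). u ^ (Suc (count_list w Lx) - height w) * v ^ (depth w - height w) * W ^ height w * L w z)"
    unfolding G1_pred_eq_sum
    by (rule gen_word_sum[where A = "\<lambda>d. words_all (d - 1)"]; (drule words_all_stats)?; (simp add: triples_def)?; arith?)
  also have "\<dots> = (\<Sum>w\<in>words_all (d - 1). W * (wty u v W w * L w z))"
    by (simp add: wty_def W mult_ac)
  also have "\<dots> = (quad W * hypG u v W (\<lambda>w. L w z)) $ d"
    unfolding quad_mult_nth hypG_nth
    by (cases d; cases "d - 1") (auto simp: words_all_0 sum_distrib_left)
  finally show "?l $ d = ?r $ d" .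
qed

lemma gen_G1_pred_Suc:
  "gen u v W (\<lambda>k l m. G1 L (int (k + l + 2 * m) - 1) (int (l + m)) (int m + 1) z)
   = lin u * lin v * hypG u v W (\<lambda>w. L w z)" (is "?l = ?r")
proof (rule fps_ext)
  fix d
  have Suc: "int m + 1 = int (Suc m)" for m by simp
  have "?l $ d
     = (\<Sum>w\<in>words_all (d - 1). u ^ Suc (Suc (count_list w Lx) - height w) * v ^ Suc (depth w - height w) * W ^ (height w - 1) * L w z)"
    unfolding Suc G1_pred_eq_sum
    by (rule gen_word_sum[where A = "\<lambda>d. words_all (d - 1)"]; (drule words_all_stats)?; (simp add: triples_def)?; arith?)
  also have "\<dots> = (\<Sum>w\<in>words_all (d - 1). u * v * (wty u v W w * L w z))"
    by (simp add: wty_def mult_ac)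
  also have "\<dots> = (lin u * lin v * hypG u v W (\<lambda>w. L w z)) $ d"
    unfolding mult.assoc
    by (cases d; cases "d - 1") (auto simp: hypG_nth words_all_0 sum_distrib_left mult_ac)
  finally show "?l $ d = ?r $ d" .
qed

lemma gen_Gbar1:
  "gen u v W (\<lambda>k l m. Gbar1 L (int (k + l + 2 * m) - 1) (int (l + m)) (int m) z)
   = hypc u v W * hypG u v W (\<lambda>w. L w z)"
  unfolding Gbar1_def gen_diff gen_G1_pred gen_G1_pred_Suc hypc_def left_diff_distrib ..

lemma gen_swap: "gen u v W (\<lambda>k l m. c l k m) = gen v u W c"
proof (rule fps_ext)
  fix d
  show "gen u v W (\<lambda>k l m. c l k m) $ d = gen v u W c $ d"
    unfolding gen_def fps_nth_Abs_fps
    by (rule sum.reindex_bij_witness[of _ "\<lambda>(k, l, m). (l, k, m)" "\<lambda>(k, l, m). (l, k, m)"])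
       (auto simp: triples_def)
qed

text \<open>The shifts by one match the normalisation of \<open>wty\<close> exactly, so no prefactor
  appears, in contrast to \<open>Gbar1\<close>. The depth now goes with k, whence u and v change
  places.\<close>

lemma gen_G1:
  "gen u v W (\<lambda>k l m. G1 L (int (k + l + 2 * m + 1)) (int (k + m + 1)) (int (m + 1)) z) = hypG v u W (\<lambda>w. L w z)" (is "?l = ?r")
proof (rule fps_ext)
  fix d
  have "?l $ d
     = (\<Sum>w\<in>words_all (d + 1). u ^ (depth w - height w) * v ^ (Suc (count_list w Lx) - height w) * W ^ (height w - 1) * L w z)"
    unfolding G1_eq_sum
    by (rule gen_word_sum[where A = "\<lambda>d. words_all (d + 1)"]; (drule words_all_stats)?; (simp add: triples_def)?; arith?)
  also have "\<dots> = hypG v u W (\<lambda>w. L w z) $ d"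
    unfolding hypG_nth by (simp add: wty_def mult_ac)
  finally show "?l $ d = ?r $ d" .
qed

text \<open>Families and points are parameters, so that the same expression is formed from
  \<open>Li\<close> at t and 1 - t and from the continuations at one point of the cover.\<close>

definition lhs_coeff :: "(word \<Rightarrow> 'p \<Rightarrow> complex) \<Rightarrow> 'p \<Rightarrow> (word \<Rightarrow> 'p \<Rightarrow> complex) \<Rightarrow> 'p \<Rightarrow> nat \<Rightarrow> nat \<Rightarrow> nat \<Rightarrow> complex" where
  "lhs_coeff L z L' z' k l m =
     Gbar0 L (int (k + l + 2 * m)) (int (l + m)) (int m) z
       + Gbar0 L' (int (k + l + 2 * m)) (int (k + m)) (int m) z'
       + (\<Sum>(k', k'')\<in>{(k', k''). k' + k'' = k}.
          \<Sum>(l', l'')\<in>{(l', l''). l' + l'' = l}.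
          \<Sum>(m', m'')\<in>{(m', m''). m' + m'' = m}.
            Gbar0 L (int (k' + l' + 2 * m')) (int (l' + m')) (int m') z
            * Gbar0 L' (int (k'' + l'' + 2 * m'')) (int (k'' + m'')) (int m'') z'
            + Gbar1 L (int (k' + l' + 2 * m') - 1) (int (l' + m')) (int m') z
            * G1 L' (int (k'' + l'' + 2 * m'' + 1)) (int (k'' + m'' + 1)) (int (m'' + 1)) z')"

text \<open>With A, B, C, H the series of the four families: 1 + A + B + A B + C H = (1 + A)(1 + B)
  + C H.\<close>

lemma gen_lhs_coeff:
  "1 + gen u v W (lhs_coeff L z L' z') = wronskian u v W (\<lambda>w. L w z) (\<lambda>w. L' w z')"
proof -
  let ?A = "\<lambda>k l m. Gbar0 L (int (k + l + 2 * m)) (int (l + m)) (int m) z"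
  let ?B = "\<lambda>k l m. Gbar0 L' (int (k + l + 2 * m)) (int (k + m)) (int m) z'"
  let ?C = "\<lambda>k l m. Gbar1 L (int (k + l + 2 * m) - 1) (int (l + m)) (int m) z"
  let ?H = "\<lambda>k l m. G1 L' (int (k + l + 2 * m + 1)) (int (k + m + 1)) (int (m + 1)) z'"
  have lhs: "lhs_coeff L z L' z' = (\<lambda>k l m. (?A k l m + ?B k l m) + (conv ?A ?B k l m + conv ?C ?H k l m))"
    by (intro ext) (simp add: lhs_coeff_def conv_def case_prod_unfold sum.distrib)
  have B: "gen u v W ?B = hypc u v W * FX v u W (\<lambda>w. L' w z')"
    using gen_swap[of u v W "\<lambda>k l m. Gbar0 L' (int (k + l + 2 * m)) (int (l + m)) (int m) z'"]
    unfolding gen_Gbar0 by (simp add: add.commute hypc_commute[of u])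
  show ?thesis
    unfolding lhs gen_add gen_mult[symmetric] gen_Gbar0 B gen_Gbar1 gen_G1 wronskian_def hypF_def hypc_commute[of v]
    by (simp add: algebra_simps)
qed

text \<open>The summand 1 added to the left-hand side sits at (0, 0, 0), which is why this index is
  excluded.\<close>

lemma lhs_coeff_eq:
  assumes "\<And>u v W. wronskian u v W (\<lambda>w. L w z) (\<lambda>w. L' w z') = gen u v W rhs_coeff"
    and "(k, l, m) \<noteq> (0, 0, 0)"
  shows "lhs_coeff L z L' z' k l m = rhs_coeff k l m"
proof -
  let ?D = "\<lambda>k l m. if k = 0 \<and> l = 0 \<and> m = 0 then 1 else (0 :: complex)"
  have one: "gen u v W ?D = 1" for u v W
  proof (rule fps_ext)
    fix d
    have "(\<Sum>(k, l, m)\<in>triples d. ?D k l m * (u ^ k * v ^ l * W ^ m))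
       = (\<Sum>p\<in>triples d. if p = (0, 0, 0) then 1 else 0)"
      by (intro sum.cong) (auto split: if_splits)
    also have "\<dots> = 1 $ d"
    proof -
      have "(0, 0, 0) \<in> triples d \<longleftrightarrow> d = 0" by (auto simp: triples_def)
      then show ?thesis by simp
    qed
    finally show "gen u v W ?D $ d = 1 $ d" by (simp add: gen_def)
  qed
  have "gen u v W (\<lambda>k l m. ?D k l m + lhs_coeff L z L' z' k l m) = gen u v W rhs_coeff" for u v W
    unfolding gen_add one gen_lhs_coeff assms(1) ..
  from gen_inject[OF this] have "?D k l m + lhs_coeff L z L' z' k l m = rhs_coeff k l m" .
  with assms(2) show ?thesis by auto
qed

theorem lhs_coeff_Li:
  assumes "0 < t" "t < 1" "(k, l, m) \<noteq> (0, 0, 0)"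
  shows "lhs_coeff Li (of_real t) Li (1 - of_real t) k l m = rhs_coeff k l m"
proof (rule lhs_coeff_eq[OF _ assms(3)])
  fix u v W
  show "wronskian u v W (\<lambda>w. Li w (of_real t)) (\<lambda>w. Li w (1 - of_real t)) = gen u v W rhs_coeff"
    using wronskian_value[OF of_real_in_lens[OF assms(1,2)], of u v W]
    by (simp add: Li_at_def[abs_def] hyp_value_gen)
qed

section \<open>The universal covering space\<close>

text \<open>The radius of the largest disc around p that avoids both punctures.\<close>

definition rad :: "complex \<Rightarrow> real" where
  "rad p = min (norm p) (norm (p - 1))"

abbreviation disc :: "ucover \<Rightarrow> complex set" where
  "disc u \<equiv> ball (proj u) (rad (proj u))"

lemma ball_rad: "ball p (rad p) \<subseteq> punctured"
  by (auto simp: rad_def punctured_def dist_norm)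

lemma rad_pos: "p \<in> punctured \<Longrightarrow> 0 < rad p"
  by (auto simp: rad_def punctured_def)

lemma le_rad:
  assumes "ball p r \<subseteq> punctured"
  shows "r \<le> rad p"
proof -
  have "0 \<notin> ball p r" "1 \<notin> ball p r" using assms unfolding punctured_def by blast+
  then show ?thesis by (simp add: rad_def dist_norm)
qed

lemma rad_half: "rad (1 / 2) = 1 / 2"
  by (simp add: rad_def)

lemma in_ball_rad: "p \<in> punctured \<Longrightarrow> p \<in> ball p (rad p)"
  using rad_pos by simp

lemma segment_in_ball_rad:
  assumes "x \<in> ball p (rad p)" "y \<in> ball p (rad p)"
  shows "closed_segment x y \<subseteq> ball p (rad p)" "closed_segment x y \<subseteq> punctured"
proof -
  show 1: "closed_segment x y \<subseteq> ball p (rad p)"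
    using assms by (intro closed_segment_subset convex_ball)
  then show "closed_segment x y \<subseteq> punctured" using ball_rad by blast
qed

section \<open>Paths from the base point and their classes\<close>

definition upath :: "(real \<Rightarrow> complex) \<Rightarrow> bool" where
  "upath \<gamma> \<longleftrightarrow> path \<gamma> \<and> path_image \<gamma> \<subseteq> punctured \<and> pathstart \<gamma> = 1 / 2"

lemma upath_iff: "upath \<gamma> \<longleftrightarrow> pathstart \<gamma> = 1 / 2 \<and> homotopic_paths punctured \<gamma> \<gamma>"
  by (auto simp: upath_def)

lemma upath_homotopic:
  assumes "upath \<gamma>" "homotopic_paths punctured \<gamma> \<delta>"
  shows "upath \<delta>"
  using assms homotopic_paths_imp_path homotopic_paths_imp_subset homotopic_paths_imp_pathstart
  unfolding upath_def by metis

lemma abs_ucover_eq: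
  assumes "upath \<gamma>" "homotopic_paths punctured \<gamma> \<delta>"
  shows "abs_ucover \<gamma> = abs_ucover \<delta>"
  by (rule Quotient3_rel_abs[OF Quotient3_ucover]) (use assms in \<open>simp add: upath_def\<close>)

lemma upath_rep: "upath (rep_ucover u)"
  using Quotient3_rep_reflp[OF Quotient3_ucover, of u] by (simp add: upath_iff)

lemma abs_rep_ucover: "abs_ucover (rep_ucover u) = u"
  by (rule Quotient3_abs_rep[OF Quotient3_ucover])

lemma rep_abs_ucover: "upath \<gamma> \<Longrightarrow> homotopic_paths punctured (rep_ucover (abs_ucover \<gamma>)) \<gamma>"
  using Quotient3_rep_abs[OF Quotient3_ucover, of \<gamma>] by (simp add: upath_iff)

lemma proj_rep: "proj u = pathfinish (rep_ucover u)"
  by (simp add: proj_def)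

lemma proj_abs: "upath \<gamma> \<Longrightarrow> proj (abs_ucover \<gamma>) = pathfinish \<gamma>"
  unfolding proj_rep by (rule homotopic_paths_imp_pathfinish[OF rep_abs_ucover])

lemma proj_punctured: "proj u \<in> punctured"
  using upath_rep[of u] pathfinish_in_path_image[of "rep_ucover u"] unfolding proj_rep upath_def by blast

lemma rad_proj_pos: "0 < rad (proj u)"
  by (rule rad_pos[OF proj_punctured])

lemma upath_join_linepath:
  assumes "upath \<gamma>" "closed_segment (pathfinish \<gamma>) z \<subseteq> punctured"
  shows "upath (\<gamma> +++ linepath (pathfinish \<gamma>) z)"
  using assms by (auto simp: upath_def path_image_join)

text \<open>Makes \<open>shift\<close> independent of the representative that
  \<open>rep_ucover\<close> selects.\<close>

lemma shift_abs:
  assumes "upath \<gamma>" "closed_segment (pathfinish \<gamma>) z \<subseteq> punctured"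
  shows "shift (abs_ucover \<gamma>) z = abs_ucover (\<gamma> +++ linepath (pathfinish \<gamma>) z)"
proof -
  let ?\<rho> = "rep_ucover (abs_ucover \<gamma>)"
  have f: "pathfinish ?\<rho> = pathfinish \<gamma>"
    by (rule homotopic_paths_imp_pathfinish[OF rep_abs_ucover[OF assms(1)]])
  have "homotopic_paths punctured (?\<rho> +++ linepath (pathfinish \<gamma>) z) (\<gamma> +++ linepath (pathfinish \<gamma>) z)"
    by (intro homotopic_paths_join rep_abs_ucover) (use assms f in auto)
  then show ?thesis
    unfolding shift_def proj_abs[OF assms(1)] using upath_join_linepath[OF upath_rep, of "abs_ucover \<gamma>" z] assms f
    by (intro abs_ucover_eq) simp_all
qed

lemma convex_homotopic_paths:
  fixes S :: "'a :: real_normed_vector set"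
  assumes "convex S" "path p" "path_image p \<subseteq> S" "path q" "path_image q \<subseteq> S"
    "pathstart q = pathstart p" "pathfinish q = pathfinish p"
  shows "homotopic_paths S p q"
  using convex_imp_simply_connected[OF assms(1)] assms unfolding simply_connected_eq_homotopic_paths by blast

lemma ball_rad_homotopic_paths:
  assumes "path p" "path_image p \<subseteq> ball c (rad c)" "path q" "path_image q \<subseteq> ball c (rad c)"
    "pathstart q = pathstart p" "pathfinish q = pathfinish p"
  shows "homotopic_paths punctured p q"
  using homotopic_paths_subset[OF convex_homotopic_paths[OF convex_ball assms] ball_rad] .

text \<open>The two legs and the direct segment lie in the convex disc around \<open>proj u\<close>,
  where they are homotopic. This is the compatibility of sheets over overlapping discs.\<close>

lemma shift_shift:
  assumes z: "z \<in> disc u" and z': "z' \<in> disc u"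
  shows "shift (shift u z) z' = shift u z'"
proof -
  let ?g = "rep_ucover u" and ?p = "proj u"
  have p: "?p \<in> ball ?p (rad ?p)" by (rule in_ball_rad[OF proj_punctured])
  note s1 = segment_in_ball_rad[OF p z] and s2 = segment_in_ball_rad[OF z z'] and s3 = segment_in_ball_rad[OF p z']
  have g: "path ?g" "path_image ?g \<subseteq> punctured" "pathstart ?g = 1 / 2" "pathfinish ?g = ?p"
    using upath_rep[of u] by (simp_all add: upath_def proj_rep)
  have u1: "upath (?g +++ linepath ?p z)"
    using upath_join_linepath[OF upath_rep, of u z] s1 g by simp
  have u2: "upath ((?g +++ linepath ?p z) +++ linepath z z')"
    using upath_join_linepath[OF u1, of z'] s2 by simp
  have assoc: "homotopic_paths punctured ((?g +++ linepath ?p z) +++ linepath z z') (?g +++ (linepath ?p z +++ linepath z z'))"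
    using g s1 s2 by (intro homotopic_paths_sym[OF homotopic_paths_assoc]) auto
  have "shift (shift u z) z' = abs_ucover ((?g +++ linepath ?p z) +++ linepath z z')"
    using shift_abs[OF u1, of z'] s2 by (simp add: shift_def)
  also have "\<dots> = abs_ucover (?g +++ (linepath ?p z +++ linepath z z'))"
    by (rule abs_ucover_eq[OF u2 assoc])
  also have "\<dots> = abs_ucover (?g +++ linepath ?p z')"
  proof (rule abs_ucover_eq[OF upath_homotopic[OF u2 assoc]], rule homotopic_paths_join)
    show "homotopic_paths punctured (linepath ?p z +++ linepath z z') (linepath ?p z')"
      using s1 s2 s3 by (intro ball_rad_homotopic_paths[where c = ?p]) (auto simp: path_image_join)
  qed (use g in auto)
  finally show ?thesis by (simp add: shift_def)
qed

lemma proj_shift_ball: "z \<in> disc u \<Longrightarrow> proj (shift u z) = z"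
  using segment_in_ball_rad[OF in_ball_rad[OF proj_punctured]] by (intro proj_shift) auto

lemma shift_self: "shift u (proj u) = u"
proof -
  have "abs_ucover (rep_ucover u +++ linepath (proj u) (proj u)) = abs_ucover (rep_ucover u)"
    using upath_rep[of u] unfolding upath_def proj_rep
    by (intro abs_ucover_eq[symmetric] homotopic_paths_sym[OF homotopic_paths_rid]) (auto simp: upath_def)
  then show ?thesis by (simp add: shift_def abs_rep_ucover)
qed

lemma holomorphic_cover_iff:
  "holomorphic_cover F \<longleftrightarrow> (\<forall>u. (\<lambda>z. F (shift u z)) holomorphic_on disc u)"
proof
  assume "holomorphic_cover F"
  then show "\<forall>u. (\<lambda>z. F (shift u z)) holomorphic_on disc u"
    using rad_proj_pos ball_rad unfolding holomorphic_cover_def by blast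
next
  assume *: "\<forall>u. (\<lambda>z. F (shift u z)) holomorphic_on disc u"
  show "holomorphic_cover F" unfolding holomorphic_cover_def
  proof (intro allI impI)
    fix u r assume "0 < r" "ball (proj u) r \<subseteq> punctured"
    then have "ball (proj u) r \<subseteq> disc u" using le_rad by (intro subset_ball)
    then show "(\<lambda>z. F (shift u z)) holomorphic_on ball (proj u) r"
      using * holomorphic_on_subset by blast
  qed
qed

text \<open>The lift to the covering space of a map on a star-shaped set.\<close>

definition lift_map :: "('a :: real_normed_vector \<Rightarrow> complex) \<Rightarrow> 'a \<Rightarrow> 'a \<Rightarrow> ucover" where
  "lift_map h x0 x = abs_ucover (h \<circ> linepath x0 x)"

lemma upath_compose_linepath:
  assumes "convex K" "x0 \<in> K" "x \<in> K" "continuous_on K h" "h ` K \<subseteq> punctured" "h x0 = 1 / 2"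
  shows "upath (h \<circ> linepath x0 x)"
proof -
  have s: "closed_segment x0 x \<subseteq> K" using assms by (intro closed_segment_subset) auto
  show ?thesis unfolding upath_def
    using assms s continuous_on_subset[OF assms(4) s]
    by (auto simp: path_image_compose pathstart_compose intro!: path_continuous_image)
qed

lemma proj_lift_map:
  assumes "convex K" "x0 \<in> K" "x \<in> K" "continuous_on K h" "h ` K \<subseteq> punctured" "h x0 = 1 / 2"
  shows "proj (lift_map h x0 x) = h x"
  unfolding lift_map_def proj_abs[OF upath_compose_linepath[OF assms]] by (simp add: pathfinish_compose)

text \<open>Contract the triangle x0, x, y inside K and apply h. Since h maps the side from x to y
  into one disc, that side may be replaced by the straight segment that \<open>shift\<close>
  appends.\<close>

lemma lift_map_step:
  fixes h :: "'a :: real_normed_vector \<Rightarrow> complex"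
  assumes K: "convex K" "x0 \<in> K" "x \<in> K" "y \<in> K" and h: "continuous_on K h" "h ` K \<subseteq> punctured" "h x0 = 1 / 2"
    and near: "h ` closed_segment x y \<subseteq> ball (h x) (rad (h x))"
  shows "lift_map h x0 y = shift (lift_map h x0 x) (h y)"
proof -
  have ux: "upath (h \<circ> linepath x0 x)" and uy: "upath (h \<circ> linepath x0 y)"
    by (rule upath_compose_linepath[OF K(1,2) _ h]; fact)+
  have seg: "closed_segment x0 x \<subseteq> K" "closed_segment x y \<subseteq> K" "closed_segment x0 y \<subseteq> K"
    using K by (simp_all add: closed_segment_subset)
  have hx: "h x \<in> ball (h x) (rad (h x))" "h y \<in> ball (h x) (rad (h x))"
    using near by auto
  have pxy: "path (h \<circ> linepath x y)" "path_image (h \<circ> linepath x y) = h ` closed_segment x y"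
    using continuous_on_subset[OF h(1) seg(2)] by (auto simp: path_image_compose intro!: path_continuous_image)
  have "shift (lift_map h x0 x) (h y) = abs_ucover ((h \<circ> linepath x0 x) +++ linepath (h x) (h y))"
    unfolding lift_map_def using shift_abs[OF ux, of "h y"] segment_in_ball_rad[OF hx]
    by (simp add: pathfinish_compose)
  also have "\<dots> = abs_ucover ((h \<circ> linepath x0 x) +++ (h \<circ> linepath x y))"
  proof (rule abs_ucover_eq)
    show "upath ((h \<circ> linepath x0 x) +++ linepath (h x) (h y))"
      using upath_join_linepath[OF ux, of "h y"] segment_in_ball_rad[OF hx] by (simp add: pathfinish_compose)
    show "homotopic_paths punctured ((h \<circ> linepath x0 x) +++ linepath (h x) (h y)) ((h \<circ> linepath x0 x) +++ (h \<circ> linepath x y))"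
    proof (rule homotopic_paths_join)
      show "homotopic_paths punctured (linepath (h x) (h y)) (h \<circ> linepath x y)"
        using near segment_in_ball_rad[OF hx] pxy
        by (intro ball_rad_homotopic_paths[where c = "h x"]) (auto simp: pathstart_compose pathfinish_compose)
    qed (use ux in \<open>auto simp: upath_iff pathfinish_compose\<close>)
  qed
  also have "\<dots> = abs_ucover (h \<circ> (linepath x0 x +++ linepath x y))"
    by (simp add: path_compose_join)
  also have "\<dots> = abs_ucover (h \<circ> linepath x0 y)"
  proof (rule abs_ucover_eq[symmetric, OF uy])
    have "homotopic_paths K (linepath x0 y) (linepath x0 x +++ linepath x y)"
      using K seg by (intro convex_homotopic_paths) (auto simp: path_image_join)
    then show "homotopic_paths punctured (h \<circ> linepath x0 y) (h \<circ> (linepath x0 x +++ linepath x y))"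
      by (rule homotopic_paths_continuous_image) (use h in auto)
  qed
  finally show ?thesis by (simp add: lift_map_def)
qed

text \<open>On a compact set the distance of h from the punctures has a positive minimum, and
  uniform continuity keeps short steps within it.\<close>

lemma uniform_step:
  fixes h :: "'a :: real_normed_vector \<Rightarrow> complex"
  assumes "compact K" "convex K" "continuous_on K h" "h ` K \<subseteq> punctured"
  obtains e where "e > 0" "\<And>x y. x \<in> K \<Longrightarrow> y \<in> K \<Longrightarrow> dist x y < e \<Longrightarrow> h ` closed_segment x y \<subseteq> ball (h x) (rad (h x))"
proof (cases "K = {}")
  case True
  show ?thesis by (rule that[of 1]) (use True in auto)
next
  case False
  have "continuous_on K (\<lambda>x. rad (h x))"
    unfolding rad_def by (intro continuous_intros assms)
  then obtain x where x: "x \<in> K" "\<And>y. y \<in> K \<Longrightarrow> rad (h x) \<le> rad (h y)"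
    using continuous_attains_inf[OF assms(1) False] by blast
  have r: "rad (h x) > 0" using x assms(4) by (intro rad_pos) auto
  have "uniformly_continuous_on K h" using assms by (intro compact_uniformly_continuous)
  then obtain e where e: "e > 0" "\<And>x' y. x' \<in> K \<Longrightarrow> y \<in> K \<Longrightarrow> dist y x' < e \<Longrightarrow> dist (h y) (h x') < rad (h x)"
    unfolding uniformly_continuous_on_def using r by metis
  show ?thesis
  proof (rule that[OF e(1)])
    fix a b assume ab: "a \<in> K" "b \<in> K" "dist a b < e"
    show "h ` closed_segment a b \<subseteq> ball (h a) (rad (h a))"
    proof (rule image_subsetI)
      fix c assume c: "c \<in> closed_segment a b"
      then have "c \<in> K" using ab assms(2) closed_segment_subset by blast
      moreover have "dist c a < e"
      proof -
        obtain t where t: "0 \<le> t" "t \<le> 1" "c = (1 - t) *\<^sub>R a + t *\<^sub>R b"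
          using c by (auto simp: closed_segment_def)
        then have "c - a = t *\<^sub>R (b - a)" by (simp add: algebra_simps)
        then have "dist c a = t * dist a b" using t by (simp add: dist_norm norm_minus_commute)
        also have "\<dots> \<le> 1 * dist a b" using t by (intro mult_right_mono) auto
        finally show ?thesis using ab(3) by simp
      qed
      ultimately have "dist (h c) (h a) < rad (h x)" using e(2) ab by blast
      then show "h c \<in> ball (h a) (rad (h a))" using x(2)[OF ab(1)] by (simp add: dist_commute)
    qed
  qed
qed

text \<open>Such a function has derivative zero everywhere on K. This is the device that carries
  local information along a path.\<close>

lemma locally_constant_on_convex:
  fixes f :: "'a :: real_normed_vector \<Rightarrow> complex"
  assumes "convex K" "e > 0" "\<And>x y. x \<in> K \<Longrightarrow> y \<in> K \<Longrightarrow> dist x y < e \<Longrightarrow> f x = f y"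
    and "x \<in> K" "y \<in> K"
  shows "f x = f y"
proof -
  have "\<exists>c. \<forall>x\<in>K. f x = c"
  proof (rule has_derivative_zero_constant[OF assms(1)])
    fix x assume x: "x \<in> K"
    have "f x = f x'" if "x' \<in> K" "dist x' x < e" for x'
      by (rule assms(3)[OF x that(1)]) (use that(2) in \<open>simp add: dist_commute\<close>)
    then show "(f has_derivative (\<lambda>h. 0)) (at x within K)"
      by (rule has_derivative_transform_within[OF has_derivative_const[of "f x"] assms(2) x])
  qed
  then obtain c where "\<forall>x\<in>K. f x = c" ..
  then show ?thesis using assms(4,5) by simp
qed

text \<open>Sum the cocycle along a subdivision of the segment from \<open>x0\<close>.\<close>

lemma cocycle_trivial:
  fixes K :: "'a :: real_normed_vector set" and c :: "'a \<Rightarrow> 'a \<Rightarrow> complex"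
  assumes K: "convex K" "bounded K" "x0 \<in> K" and e: "e > 0"
    and c: "\<And>x y z. x \<in> K \<Longrightarrow> y \<in> K \<Longrightarrow> z \<in> K \<Longrightarrow> dist x y < e \<Longrightarrow> dist y z < e \<Longrightarrow> dist x z < e \<Longrightarrow> c x z = c x y + c y z"
  obtains g where "g x0 = 0" "\<And>x y. x \<in> K \<Longrightarrow> y \<in> K \<Longrightarrow> dist x y < e / 3 \<Longrightarrow> g y - g x = c x y"
proof -
  obtain B where B: "B > 0" "\<And>x. x \<in> K \<Longrightarrow> norm (x - x0) \<le> B"
  proof -
    obtain B where "\<And>x. x \<in> K \<Longrightarrow> dist x0 x \<le> B"
      using bounded_any_center[of K x0] K(2) by blast
    then have "norm (x - x0) \<le> max B 1" if "x \<in> K" for x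
      using that by (force simp: dist_norm norm_minus_commute)
    then show thesis by (intro that[of "max B 1"]) auto
  qed
  \<comment> \<open>Subdivision into n parts has mesh below e / 3 for all x in K at once.\<close>
  obtain n where n: "real n > 3 * B / e" using reals_Archimedean2 by blast
  have n0: "real n > 0" using n B e by (smt (verit) divide_pos_pos)
  have step: "B / real n < e / 3" using n n0 e by (simp add: field_simps)
  define p where "p i x = x0 + (real i / real n) *\<^sub>R (x - x0)" for i x
  have pK: "p i x \<in> K" if "x \<in> K" "i \<le> n" for i x
  proof -
    have "p i x = (1 - real i / real n) *\<^sub>R x0 + (real i / real n) *\<^sub>R x"
      by (simp add: p_def algebra_simps)
    then show ?thesis using that K n0 by (auto intro!: convexD)
  qed
  have d1: "dist (p i x) (p (Suc i) x) < e / 3" if "x \<in> K" for i x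
  proof -
    have "dist (p i x) (p (Suc i) x) = norm ((real i / real n - real (Suc i) / real n) *\<^sub>R (x - x0))"
      by (simp add: p_def dist_norm scaleR_diff_left)
    also have "real i / real n - real (Suc i) / real n = - 1 / real n"
      by (simp add: diff_divide_distrib[symmetric])
    also have "norm ((- 1 / real n) *\<^sub>R (x - x0)) = norm (x - x0) / real n" by simp
    also have "\<dots> \<le> B / real n" using B(2)[OF that] n0 by (intro divide_right_mono) auto
    finally show ?thesis using step by linarith
  qed
  have d2: "dist (p i x) (p i y) \<le> dist x y" if "i \<le> n" for i x y
  proof -
    have "dist (p i x) (p i y) = norm ((real i / real n) *\<^sub>R (x - y))"
      by (simp add: p_def dist_norm scaleR_diff_right[symmetric])
    also have "\<dots> \<le> 1 * norm (x - y)"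
      unfolding norm_scaleR using that n0 by (intro mult_right_mono) auto
    finally show ?thesis by (simp add: dist_norm)
  qed
  have c0: "c x x = 0" if "x \<in> K" for x using c[of x x x] that e by simp
  define g where "g x = (\<Sum>i<n. c (p i x) (p (Suc i) x))" for x
  show thesis
  proof
    have "p i x0 = x0" for i by (simp add: p_def)
    then show "g x0 = 0" by (simp add: g_def c0 K)
    fix x y assume xy: "x \<in> K" "y \<in> K" "dist x y < e / 3"
    \<comment> \<open>Compares the two subdivisions rung by rung; for j = n the rung is the pair x,
      y.\<close>
    have "(\<Sum>i<j. c (p i y) (p (Suc i) y)) - (\<Sum>i<j. c (p i x) (p (Suc i) x)) = c (p j x) (p j y)" if "j \<le> n" for j
      using that
    proof (induction j)
      case 0
      have "p 0 x = x0" "p 0 y = x0" by (simp_all add: p_def)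
      then show ?case by (simp add: c0 K)
    next
      case (Suc j)
      let ?a = "p j x" and ?b = "p j y" and ?a' = "p (Suc j) x" and ?b' = "p (Suc j) y"
      have mem: "?a \<in> K" "?b \<in> K" "?a' \<in> K" "?b' \<in> K" using pK xy Suc.prems by auto
      have ab: "dist ?a ?b < e / 3" "dist ?a' ?b' < e / 3"
        using d2[of j x y] d2[of "Suc j" x y] xy(3) Suc.prems by auto
      have aa: "dist ?a ?a' < e / 3" "dist ?b ?b' < e / 3" using d1 xy by auto
      \<comment> \<open>The diagonal of the small quadrilateral is shorter than 2 e / 3, so the
        cocycle identity applies to the triangles on both sides of it.\<close>
      have ab': "dist ?a ?b' < e" using dist_triangle[of ?a ?b' ?b] ab aa e by linarith
      have "c ?a ?b' = c ?a ?b + c ?b ?b'"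
        by (rule c) (use mem ab aa ab' e in auto)
      moreover have "c ?a ?b' = c ?a ?a' + c ?a' ?b'"
        by (rule c) (use mem ab aa ab' e in auto)
      ultimately show ?case using Suc by (simp add: algebra_simps)
    qed
    from this[of n] show "g y - g x = c x y"
      using n0 by (simp add: g_def p_def)
  qed
qed

section \<open>Primitives on the covering space\<close>

lemma linepath_in_Icc: "t \<in> {0..1} \<Longrightarrow> x \<in> {0..1} \<Longrightarrow> linepath 0 t x \<in> {0..1::real}"
  by (auto simp: linepath_def mult_le_one)

lemma upath_restrict:
  assumes "upath \<gamma>" "t \<in> {0..1}"
  shows "upath (\<gamma> \<circ> linepath 0 t)"
  by (rule upath_compose_linepath[of "{0..1}"])
     (use assms in \<open>auto simp: upath_def path_def path_image_def pathstart_def\<close>)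

lemma lift_map_1: "lift_map \<gamma> 0 1 = abs_ucover \<gamma>" for \<gamma> :: "real \<Rightarrow> complex"
proof -
  have "\<gamma> \<circ> linepath 0 1 = \<gamma>" by (rule ext) (simp add: linepath_def)
  then show ?thesis by (simp add: lift_map_def)
qed

lemma lift_map_restrict: "lift_map (\<gamma> \<circ> linepath 0 t) 0 x = lift_map \<gamma> 0 (t * x)" for \<gamma> :: "real \<Rightarrow> complex"
proof -
  have "(\<gamma> \<circ> linepath 0 t) \<circ> linepath 0 x = \<gamma> \<circ> linepath 0 (t * x)"
    by (rule ext) (simp add: linepath_def mult_ac)
  then show ?thesis by (simp add: lift_map_def)
qed

lemma upath_interval:
  assumes "upath \<gamma>"
  shows "compact {0..1::real}" "convex {0..1::real}" "0 \<in> {0..1::real}"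
    "continuous_on {0..1} \<gamma>" "\<gamma> ` {0..1} \<subseteq> punctured" "\<gamma> 0 = 1 / 2"
  using assms by (auto simp: upath_def path_def path_image_def pathstart_def)

context
  fixes H :: "ucover \<Rightarrow> complex" and a :: "complex \<Rightarrow> complex"
  assumes H: "holomorphic_cover H" and a: "a holomorphic_on punctured"
begin

text \<open>Normalised to vanish at the centre, so that its value at z is the increment of a global
  primitive from u to \<open>shift u z\<close>.\<close>

definition prim :: "ucover \<Rightarrow> complex \<Rightarrow> complex" where
  "prim u = (SOME P. P (proj u) = 0 \<and> (\<forall>z\<in>disc u.
     (P has_field_derivative a z * H (shift u z)) (at z)))"

lemma prim_props:
  "prim u (proj u) = 0"
  "z \<in> disc u \<Longrightarrow> (prim u has_field_derivative a z * H (shift u z)) (at z)"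
proof -
  let ?B = "disc u"
  have "(\<lambda>z. a z * H (shift u z)) holomorphic_on ?B"
    using H a holomorphic_on_subset[OF a ball_rad] unfolding holomorphic_cover_iff
    by (intro holomorphic_intros) auto
  then obtain g where g: "\<And>z. z \<in> ?B \<Longrightarrow> (g has_field_derivative a z * H (shift u z)) (at z within ?B)"
    using holomorphic_convex_primitive'[OF convex_ball open_ball] by blast
  have "\<exists>P. P (proj u) = 0 \<and> (\<forall>z\<in>?B. (P has_field_derivative a z * H (shift u z)) (at z))"
  proof (intro exI[of _ "\<lambda>z. g z - g (proj u)"] conjI ballI)
    fix z assume z: "z \<in> ?B"
    have "(g has_field_derivative a z * H (shift u z)) (at z)"
      using g[OF z] at_within_open[OF z open_ball] by simp
    then show "((\<lambda>z. g z - g (proj u)) has_field_derivative a z * H (shift u z)) (at z)"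
      by (auto intro!: derivative_eq_intros)
  qed simp
  from someI_ex[OF this] show "prim u (proj u) = 0"
    "z \<in> ?B \<Longrightarrow> (prim u has_field_derivative a z * H (shift u z)) (at z)"
    unfolding prim_def by auto
qed

text \<open>By \<open>shift_shift\<close> both primitives have the same derivative on the convex
  overlap; their constant difference is read off at w.\<close>

lemma prim_cocycle:
  assumes w: "w \<in> disc u" and z: "z \<in> disc u" "z \<in> ball w (rad w)"
  shows "prim u z = prim u w + prim (shift u w) z"
proof -
  let ?v = "shift u w"
  let ?S = "disc u \<inter> ball w (rad w)"
  have pv: "proj ?v = w" by (rule proj_shift_ball[OF w])
  have "\<exists>c. \<forall>x\<in>?S. prim u x - prim ?v x = c"
  proof (rule has_field_derivative_zero_constant)
    show "convex ?S" by (intro convex_Int convex_ball)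
    fix x assume x: "x \<in> ?S"
    have "((\<lambda>x. prim u x - prim ?v x) has_field_derivative a x * H (shift u x) - a x * H (shift ?v x)) (at x)"
      by (intro DERIV_diff prim_props) (use x pv in auto)
    then show "((\<lambda>x. prim u x - prim ?v x) has_field_derivative 0) (at x within ?S)"
      using shift_shift[OF w, of x] x by (simp add: has_field_derivative_at_within)
  qed
  then obtain c where c: "\<And>x. x \<in> ?S \<Longrightarrow> prim u x - prim ?v x = c" by blast
  have "w \<in> ball w (rad w)" using w ball_rad[of "proj u"] by (intro in_ball_rad) blast
  then have "prim u z - prim ?v z = prim u w - prim ?v w" using c w z by (metis IntI)
  moreover have "prim ?v w = 0" using prim_props(1)[of ?v] pv by simp
  ultimately show ?thesis by (simp add: algebra_simps)
qed

text \<open>The pull-back along h of a global primitive, described by its increments over short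
  distances. K will be an interval for paths and a square for homotopies.\<close>

definition prim_along :: "('b :: real_normed_vector \<Rightarrow> complex) \<Rightarrow> 'b set \<Rightarrow> 'b \<Rightarrow> ('b \<Rightarrow> complex) \<Rightarrow> bool" where
  "prim_along h K x0 g \<longleftrightarrow> g x0 = 0 \<and> (\<exists>e>0. \<forall>x\<in>K. \<forall>y\<in>K. dist x y < e \<longrightarrow> g y - g x = prim (lift_map h x0 x) (h y))"

lemma prim_along_exists:
  fixes h :: "'b :: real_normed_vector \<Rightarrow> complex"
  assumes K: "compact K" "convex K" "x0 \<in> K" and h: "continuous_on K h" "h ` K \<subseteq> punctured" "h x0 = 1 / 2"
  obtains g where "prim_along h K x0 g"
proof -
  obtain e where e: "e > 0" "\<And>x y. x \<in> K \<Longrightarrow> y \<in> K \<Longrightarrow> dist x y < e \<Longrightarrow> h ` closed_segment x y \<subseteq> ball (h x) (rad (h x))"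
    using uniform_step[OF K(1,2) h(1,2)] by blast
  have near: "h y \<in> ball (h x) (rad (h x))" if "x \<in> K" "y \<in> K" "dist x y < e" for x y
    using e(2)[OF that] by auto
  have cocycle: "prim (lift_map h x0 x) (h z) = prim (lift_map h x0 x) (h y) + prim (lift_map h x0 y) (h z)"
    if "x \<in> K" "y \<in> K" "z \<in> K" "dist x y < e" "dist y z < e" "dist x z < e" for x y z
  proof -
    have "lift_map h x0 y = shift (lift_map h x0 x) (h y)"
      by (rule lift_map_step[OF K(2,3) _ _ h]) (use that e in auto)
    moreover have "proj (lift_map h x0 x) = h x" by (rule proj_lift_map[OF K(2,3) _ h]) fact
    ultimately show ?thesis using prim_cocycle[of "h y" "lift_map h x0 x" "h z"] near that by simp
  qed
  obtain g where g: "g x0 = 0" "\<And>x y. x \<in> K \<Longrightarrow> y \<in> K \<Longrightarrow> dist x y < e / 3 \<Longrightarrow> g y - g x = prim (lift_map h x0 x) (h y)"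
    by (rule cocycle_trivial[OF K(2) compact_imp_bounded[OF K(1)] K(3) e(1), of "\<lambda>x y. prim (lift_map h x0 x) (h y)"])
       (use cocycle in blast)+
  show thesis
    by (rule that[of g], unfold prim_along_def, intro conjI exI[of _ "e / 3"]) (use g e in auto)
qed

lemma prim_along_unique:
  assumes "convex K" "x0 \<in> K" "prim_along h K x0 g" "prim_along h K x0 g'" "x \<in> K"
  shows "g x = g' x"
proof -
  obtain e e' where e: "e > 0" "e' > 0"
      "\<forall>x\<in>K. \<forall>y\<in>K. dist x y < e \<longrightarrow> g y - g x = prim (lift_map h x0 x) (h y)"
      "\<forall>x\<in>K. \<forall>y\<in>K. dist x y < e' \<longrightarrow> g' y - g' x = prim (lift_map h x0 x) (h y)"
    using assms(3,4) unfolding prim_along_def by blast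
  have "g x - g' x = g x0 - g' x0"
  proof (rule locally_constant_on_convex[OF assms(1), of "min e e'"])
    fix x y assume "x \<in> K" "y \<in> K" "dist x y < min e e'"
    then have "g y - g x = g' y - g' x" using e by auto
    then show "g x - g' x = g y - g' y" by (simp add: algebra_simps)
  qed (use e assms in auto)
  then show ?thesis using assms(3,4) by (simp add: prim_along_def)
qed

definition path_prim :: "(real \<Rightarrow> complex) \<Rightarrow> complex" where
  "path_prim \<gamma> = (SOME g. prim_along \<gamma> {0..1} 0 g) 1"

lemma path_prim_eq:
  assumes "prim_along \<gamma> {0..1} 0 g"
  shows "path_prim \<gamma> = g 1"
  unfolding path_prim_def
  by (rule prim_along_unique[OF _ _ someI[of "prim_along \<gamma> {0..1} 0", OF assms] assms]) auto

lemma lift_map_cong: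
  fixes h :: "'b :: real_normed_vector \<Rightarrow> complex"
  assumes "upath (h \<circ> linepath x0 x)" "\<And>t. t \<in> {0..1} \<Longrightarrow> h (linepath x0 x t) = h' (linepath y0 y t)"
  shows "lift_map h x0 x = lift_map h' y0 y"
  unfolding lift_map_def
  by (rule abs_ucover_eq[OF assms(1) homotopic_paths_eq]) (use assms in \<open>auto simp: upath_def\<close>)

text \<open>Take g along the homotopy h(s, t) on the square, with t the parameter of the paths. On
  the sides t = 0 and t = 1 the map h is constant, hence so is g; the sides s = 0 and s = 1 give
  primitives along the two paths.\<close>

lemma path_prim_homotopic:
  assumes "upath \<gamma>" "homotopic_paths punctured \<gamma> \<delta>"
  shows "path_prim \<gamma> = path_prim \<delta>"
proof -
  let ?K = "{0..1::real} \<times> {0..1::real}"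
  have \<delta>: "upath \<delta>" by (rule upath_homotopic[OF assms])
  have fin: "\<delta> 1 = \<gamma> 1" using homotopic_paths_imp_pathfinish[OF assms(2)] by (simp add: pathfinish_def)
  obtain h where h: "continuous_on ?K h" "h \<in> ?K \<rightarrow> punctured"
      and h0: "\<And>x. x \<in> {0..1} \<Longrightarrow> h (0, x) = \<gamma> x" and h1: "\<And>x. x \<in> {0..1} \<Longrightarrow> h (1, x) = \<delta> x"
      and hb: "\<And>s. s \<in> {0..1} \<Longrightarrow> h (s, 0) = 1 / 2" and ht: "\<And>s. s \<in> {0..1} \<Longrightarrow> h (s, 1) = \<gamma> 1"
    using assms unfolding homotopic_paths upath_def pathstart_def pathfinish_def o_def by metis
  have K: "compact ?K" "convex ?K" "(0, 0) \<in> ?K" by (auto intro: compact_Times convex_Times)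
  have hK: "h ` ?K \<subseteq> punctured" "h (0, 0) = 1 / 2" using h(2) hb by auto
  note up = upath_compose_linepath[OF K(2,3) _ h(1) hK] and pl = proj_lift_map[OF K(2,3) _ h(1) hK]
  obtain g where g: "prim_along h ?K (0, 0) g" by (rule prim_along_exists[OF K h(1) hK])
  then obtain e where e: "e > 0" and g0: "g (0, 0) = 0"
    and ge: "\<And>x y. x \<in> ?K \<Longrightarrow> y \<in> ?K \<Longrightarrow> dist x y < e \<Longrightarrow> g y - g x = prim (lift_map h (0, 0) x) (h y)"
    unfolding prim_along_def by blast
  have edge: "g (s, t) = g (0, t)" if s: "s \<in> {0..1}" and t: "t \<in> {0..1}" and c: "\<And>s. s \<in> {0..1} \<Longrightarrow> h (s, t) = c" for s t c
  proof (rule locally_constant_on_convex[of "{0..1}" e "\<lambda>s. g (s, t)"])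
    fix x y :: real assume xy: "x \<in> {0..1}" "y \<in> {0..1}" "dist x y < e"
    have "g (y, t) - g (x, t) = prim (lift_map h (0, 0) (x, t)) (h (y, t))"
      by (rule ge) (use xy t in \<open>auto simp: dist_Pair_Pair\<close>)
    also have "h (y, t) = proj (lift_map h (0, 0) (x, t))"
      using pl[of "(x, t)"] xy t c by simp
    finally show "g (x, t) = g (y, t)" by (simp add: prim_props)
  qed (use s e in auto)
  have left: "prim_along \<gamma> {0..1} 0 (\<lambda>t. g (0, t))"
    unfolding prim_along_def
  proof (intro conjI exI[of _ e] ballI impI)
    fix x y :: real assume xy: "x \<in> {0..1}" "y \<in> {0..1}" "dist x y < e"
    have "g (0, y) - g (0, x) = prim (lift_map h (0, 0) (0, x)) (h (0, y))"
      by (rule ge) (use xy in \<open>auto simp: dist_Pair_Pair\<close>)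
    also have "lift_map h (0, 0) (0, x) = lift_map \<gamma> 0 x"
    proof (rule lift_map_cong[OF up])
      fix t :: real assume "t \<in> {0..1}"
      then show "h (linepath (0, 0) (0, x) t) = \<gamma> (linepath 0 x t)"
        using h0[OF linepath_in_Icc[OF xy(1)], of t] by (simp add: linepath_def)
    qed (use xy in auto)
    finally show "g (0, y) - g (0, x) = prim (lift_map \<gamma> 0 x) (\<gamma> y)" using h0 xy by simp
  qed (use e g0 in auto)
  have right: "prim_along \<delta> {0..1} 0 (\<lambda>t. g (1, t))"
    unfolding prim_along_def
  proof (intro conjI exI[of _ e] ballI impI)
    show "g (1, 0) = 0" using edge[of 1 0 "1 / 2", OF _ _ hb] g0 by simp
    fix x y :: real assume xy: "x \<in> {0..1}" "y \<in> {0..1}" "dist x y < e"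
    have "g (1, y) - g (1, x) = prim (lift_map h (0, 0) (1, x)) (h (1, y))"
      by (rule ge) (use xy in \<open>auto simp: dist_Pair_Pair\<close>)
    \<comment> \<open>Lifts on the square start at (0, 0), so the segment to (1, x) is rerouted
      through (1, 0); its first leg has constant image and drops out.\<close>
    also have "lift_map h (0, 0) (1, x) = abs_ucover (h \<circ> (linepath (0, 0) (1, 0) +++ linepath (1, 0) (1, x)))"
      unfolding lift_map_def
    proof (rule abs_ucover_eq[OF up])
      have "homotopic_paths ?K (linepath (0, 0) (1, x)) (linepath (0, 0) (1, 0) +++ linepath (1, 0) (1, x))"
      proof (rule convex_homotopic_paths[OF K(2)])
        have seg: "closed_segment p q \<subseteq> ?K" if "p \<in> ?K" "q \<in> ?K" for p q
          using closed_segment_subset[OF that K(2)] .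
        show "path_image (linepath (0, 0) (1, x)) \<subseteq> ?K"
          unfolding path_image_linepath by (rule seg) (use xy in auto)
        show "path_image (linepath (0, 0) (1, 0) +++ linepath (1, 0) (1, x)) \<subseteq> ?K"
          by (intro subset_path_image_join; unfold path_image_linepath; rule seg) (use xy in auto)
      qed auto
      then show "homotopic_paths punctured (h \<circ> linepath (0, 0) (1, x)) (h \<circ> (linepath (0, 0) (1, 0) +++ linepath (1, 0) (1, x)))"
        by (rule homotopic_paths_continuous_image) (use h in auto)
    qed (use xy in auto)
    also have "\<dots> = lift_map \<delta> 0 x"
      unfolding lift_map_def
    proof (rule abs_ucover_eq[OF upath_restrict[OF \<delta> xy(1)], symmetric])
      have p: "upath (\<delta> \<circ> linepath 0 x)" by (rule upath_restrict[OF \<delta> xy(1)])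
      have "homotopic_paths punctured (linepath (1 / 2) (1 / 2) +++ (\<delta> \<circ> linepath 0 x)) (\<delta> \<circ> linepath 0 x)"
        using homotopic_paths_lid[of "\<delta> \<circ> linepath 0 x" punctured] p unfolding upath_def by metis
      moreover have "homotopic_paths punctured (linepath (1 / 2) (1 / 2) +++ (\<delta> \<circ> linepath 0 x))
          (h \<circ> (linepath (0, 0) (1, 0) +++ linepath (1, 0) (1, x)))"
        unfolding path_compose_join
      proof (rule homotopic_paths_join)
        show "homotopic_paths punctured (linepath (1 / 2) (1 / 2)) (h \<circ> linepath (0, 0) (1, 0))"
        proof (rule homotopic_paths_eq)
          fix t :: real assume "t \<in> {0..1}"
          then show "linepath (1 / 2) (1 / 2) t = (h \<circ> linepath (0, 0) (1, 0)) t"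
            using hb[of t] by (simp add: linepath_def algebra_simps)
        qed (auto simp: punctured_def)
        show "homotopic_paths punctured (\<delta> \<circ> linepath 0 x) (h \<circ> linepath (1, 0) (1, x))"
        proof (rule homotopic_paths_eq)
          fix t :: real assume "t \<in> {0..1}"
          then show "(\<delta> \<circ> linepath 0 x) t = (h \<circ> linepath (1, 0) (1, x)) t"
            using h1[OF linepath_in_Icc[OF xy(1)], of t] by (simp add: linepath_def)
        qed (use p in \<open>auto simp: upath_def\<close>)
        show "pathfinish (linepath (1 / 2) (1 / 2)) = pathstart (\<delta> \<circ> linepath 0 x)"
          using p by (simp add: upath_def)
      qed
      ultimately show "homotopic_paths punctured (\<delta> \<circ> linepath 0 x)
          (h \<circ> (linepath (0, 0) (1, 0) +++ linepath (1, 0) (1, x)))"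
        using homotopic_paths_trans homotopic_paths_sym by blast
    qed
    finally show "g (1, y) - g (1, x) = prim (lift_map \<delta> 0 x) (\<delta> y)" using h1 xy by simp
  qed (use e in auto)
  have "g (1, 1) = g (0, 1)" using edge[of 1 1 "\<gamma> 1", OF _ _ ht] by simp
  then show ?thesis using path_prim_eq[OF left] path_prim_eq[OF right] by simp
qed

definition cover_prim :: "ucover \<Rightarrow> complex" where
  "cover_prim u = path_prim (rep_ucover u)"

lemma cover_prim_abs: "upath \<gamma> \<Longrightarrow> cover_prim (abs_ucover \<gamma>) = path_prim \<gamma>"
  unfolding cover_prim_def by (rule path_prim_homotopic[OF upath_rep rep_abs_ucover])

text \<open>Restricting the path to [0, t] and rescaling restricts its primitive, so one g gives the
  values at all points of the lifted path.\<close>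

lemma cover_prim_lift_map:
  assumes \<gamma>: "upath \<gamma>" and g: "prim_along \<gamma> {0..1} 0 g" and t: "t \<in> {0..1}"
  shows "cover_prim (lift_map \<gamma> 0 t) = g t"
proof -
  obtain e where e: "e > 0" "\<And>x y. x \<in> {0..1} \<Longrightarrow> y \<in> {0..1} \<Longrightarrow> dist x y < e \<Longrightarrow> g y - g x = prim (lift_map \<gamma> 0 x) (\<gamma> y)"
    using g unfolding prim_along_def by blast
  have "prim_along (\<gamma> \<circ> linepath 0 t) {0..1} 0 (\<lambda>x. g (t * x))"
    unfolding prim_along_def lift_map_restrict
  proof (intro conjI exI[of _ e] ballI impI)
    fix x y :: real assume xy: "x \<in> {0..1}" "y \<in> {0..1}" "dist x y < e"
    have "dist (t * x) (t * y) = t * dist x y"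
      using t by (simp add: dist_real_def abs_mult flip: right_diff_distrib)
    also have "\<dots> \<le> 1 * dist x y" using t by (intro mult_right_mono) auto
    finally have "dist (t * x) (t * y) < e" using xy by simp
    then show "g (t * y) - g (t * x) = prim (lift_map \<gamma> 0 (t * x)) ((\<gamma> \<circ> linepath 0 t) y)"
      using e(2)[of "t * x" "t * y"] xy t by (simp add: mult_le_one linepath_def mult.commute)
  qed (use e g in \<open>auto simp: prim_along_def\<close>)
  from path_prim_eq[OF this] show ?thesis
    unfolding lift_map_def using cover_prim_abs[OF upath_restrict[OF \<gamma> t]] by simp
qed

text \<open>Append the segment to a representative of u. Along it \<open>cover_prim\<close> and
  \<open>prim u\<close> have the same short increments by \<open>prim_cocycle\<close>, so their
  difference keeps the value it has at u.\<close>

lemma cover_prim_shift: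
  assumes z: "z \<in> disc u"
  shows "cover_prim (shift u z) = cover_prim u + prim u z"
proof -
  let ?p = "proj u" and ?g = "rep_ucover u"
  let ?\<delta> = "?g +++ linepath ?p z"
  let ?B = "ball ?p (rad ?p)"
  have g: "path ?g" "path_image ?g \<subseteq> punctured" "pathfinish ?g = ?p"
    using upath_rep[of u] by (simp_all add: upath_def proj_rep)
  have p: "?p \<in> ?B" by (rule in_ball_rad[OF proj_punctured])
  note seg = segment_in_ball_rad[OF p z]
  have \<delta>: "upath ?\<delta>" using upath_join_linepath[OF upath_rep, of u z] seg g by simp
  note I = upath_interval[OF \<delta>]
  \<comment> \<open>The concatenation reaches u at time 1/2; the parameter x of the segment
    corresponds to time (1 + x) / 2.\<close>
  have half: "lift_map ?\<delta> 0 (1/2) = u"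
  proof -
    have "lift_map ?g 0 1 = lift_map ?\<delta> 0 (1/2)"
    proof (rule lift_map_cong)
      show "upath (?g \<circ> linepath 0 1)" by (rule upath_restrict[OF upath_rep]) simp
      fix t :: real assume "t \<in> {0..1}"
      then show "?g (linepath 0 1 t) = ?\<delta> (linepath 0 (1/2) t)"
        by (simp add: linepath_def joinpaths_def)
    qed
    then show ?thesis by (simp add: lift_map_1 abs_rep_ucover)
  qed
  have second: "?\<delta> t = linepath ?p z (2 * t - 1)" if "t \<in> {1/2..1}" for t
  proof (cases "t = 1/2")
    case True
    show ?thesis unfolding True using g(3) by (simp add: joinpaths_def linepath_def pathfinish_def)
  qed (use that in \<open>simp add: joinpaths_def\<close>)
  have inB: "linepath ?p z x \<in> ?B" if "x \<in> {0..1}" for x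
    using seg(1) linepath_in_path[OF that, of ?p z] by blast
  have lift: "lift_map ?\<delta> 0 ((1 + x) / 2) = shift u (linepath ?p z x)" if x: "x \<in> {0..1}" for x
  proof -
    have "lift_map ?\<delta> 0 ((1 + x) / 2) = shift (lift_map ?\<delta> 0 (1/2)) (?\<delta> ((1 + x) / 2))"
    proof (rule lift_map_step[OF I(2,3) _ _ I(4-6)])
      show "?\<delta> ` closed_segment (1/2) ((1 + x) / 2) \<subseteq> ball (?\<delta> (1/2)) (rad (?\<delta> (1/2)))"
      proof (rule image_subsetI)
        fix t assume "t \<in> closed_segment (1/2) ((1 + x) / 2)"
        then have "t \<in> {1/2..1}" using x by (auto simp: closed_segment_eq_real_ivl split: if_splits)
        moreover have "?\<delta> (1/2) = ?p" using second[of "1/2"] by (simp add: linepath_def)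
        ultimately show "?\<delta> t \<in> ball (?\<delta> (1/2)) (rad (?\<delta> (1/2)))"
          using second[of t] inB[of "2 * t - 1"] by simp
      qed
    qed (use x in auto)
    then show ?thesis using second[of "(1 + x) / 2"] x half by (simp add: field_simps)
  qed
  obtain f where f: "prim_along ?\<delta> {0..1} 0 f" by (rule prim_along_exists[OF I])
  then obtain e where e: "e > 0" "\<And>x y. x \<in> {0..1} \<Longrightarrow> y \<in> {0..1} \<Longrightarrow> dist x y < e \<Longrightarrow> f y - f x = prim (lift_map ?\<delta> 0 x) (?\<delta> y)"
    unfolding prim_along_def by blast
  obtain e' where e': "e' > 0" "\<And>x y. x \<in> {0..1} \<Longrightarrow> y \<in> {0..1} \<Longrightarrow> dist x y < e' \<Longrightarrow>
      ?\<delta> ` closed_segment x y \<subseteq> ball (?\<delta> x) (rad (?\<delta> x))"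
    using uniform_step[OF I(1,2,4,5)] by blast
  let ?w = "linepath ?p z"
  have "cover_prim (shift u (?w 0)) - prim u (?w 0) = cover_prim (shift u (?w 1)) - prim u (?w 1)"
  proof (rule locally_constant_on_convex[of "{0..1}" "min e e'" "\<lambda>x. cover_prim (shift u (?w x)) - prim u (?w x)"])
    fix x y :: real assume xy: "x \<in> {0..1}" "y \<in> {0..1}" "dist x y < min e e'"
    let ?x = "(1 + x) / 2" and ?y = "(1 + y) / 2"
    have d: "dist ?x ?y = dist x y / 2" 
    proof -
      have eq: "?x - ?y = (x - y) / 2" by (simp add: field_simps)
      show ?thesis unfolding dist_real_def eq by simp
    qed
    have xy': "?x \<in> {0..1}" "?y \<in> {0..1}" "dist ?x ?y < e" "dist ?x ?y < e'"
      using xy zero_le_dist[of x y] unfolding d by (auto simp del: zero_le_dist)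
    have \<delta>xy: "?\<delta> ?x = ?w x" "?\<delta> ?y = ?w y"
      using second[of ?x] second[of ?y] xy by (auto simp: field_simps)
    have "?w y \<in> ball (?w x) (rad (?w x))"
      using e'(2)[OF xy'(1,2,4)] \<delta>xy by auto
    then have "prim u (?w y) = prim u (?w x) + prim (shift u (?w x)) (?w y)"
      using xy by (intro prim_cocycle inB)
    moreover have "cover_prim (shift u (?w y)) - cover_prim (shift u (?w x)) = prim (shift u (?w x)) (?w y)"
      using e(2)[OF xy'(1-3)] cover_prim_lift_map[OF \<delta> f xy'(1)] cover_prim_lift_map[OF \<delta> f xy'(2)] lift[OF xy(1)] lift[OF xy(2)] \<delta>xy
      by simp
    ultimately show "cover_prim (shift u (?w x)) - prim u (?w x) = cover_prim (shift u (?w y)) - prim u (?w y)"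
      by (simp add: algebra_simps)
  qed (use e e' in auto)
  then show ?thesis
    by (simp add: linepath_def shift_self prim_props(1) algebra_simps)
qed

lemma cover_primitive_exists:
  "\<exists>F. holomorphic_cover F \<and> F b = c \<and> (\<forall>u. \<forall>z\<in>disc u.
     ((\<lambda>z. F (shift u z)) has_field_derivative a z * H (shift u z)) (at z))"
proof -
  let ?F = "\<lambda>u. cover_prim u - cover_prim b + c"
  have der: "((\<lambda>z. ?F (shift u z)) has_field_derivative a z * H (shift u z)) (at z)"
    if z: "z \<in> disc u" for u z
  proof -
    have "((\<lambda>z. cover_prim u + prim u z - cover_prim b + c) has_field_derivative a z * H (shift u z)) (at z)"
      using prim_props(2)[OF z] by (auto intro!: derivative_eq_intros)
    moreover have "\<forall>\<^sub>F x in nhds z. cover_prim u + prim u x - cover_prim b + c = ?F (shift u x)"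
      using eventually_nhds_in_open[OF open_ball z] by eventually_elim (simp add: cover_prim_shift)
    ultimately show ?thesis by (subst (asm) DERIV_cong_ev[OF refl _ refl]) auto
  qed
  have "holomorphic_cover ?F"
    unfolding holomorphic_cover_iff holomorphic_on_open[OF open_ball] using der by blast
  with der show ?thesis by (intro exI[of _ ?F]) simp
qed

end

section \<open>Analytic continuation\<close>

definition base_pt :: ucover where
  "base_pt = abs_ucover (linepath (1 / 2) (1 / 2))"

lemma upath_base: "upath (linepath (1 / 2) (1 / 2))"
  by (simp add: upath_def punctured_def)

lemma proj_base: "proj base_pt = 1 / 2"
  unfolding base_pt_def proj_abs[OF upath_base] by simp

text \<open>This disc contains the interval between 0 and 1, so the fixed lift lies on the sheet of
  the base point.\<close>

lemma shift_base:
  assumes "z \<in> ball (1 / 2) (1 / 2)"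
  shows "shift base_pt z = abs_ucover (linepath (1 / 2) z)"
proof -
  have seg: "closed_segment (1 / 2) z \<subseteq> punctured"
    using segment_in_ball_rad[of "1 / 2" "1 / 2" z] assms by (simp add: rad_half)
  have "shift base_pt z = abs_ucover (linepath (1 / 2) (1 / 2) +++ linepath (1 / 2) z)"
    using shift_abs[OF upath_base, of z] seg unfolding base_pt_def pathfinish_linepath by blast
  also have "\<dots> = abs_ucover (linepath (1 / 2) z)"
  proof (rule abs_ucover_eq)
    show "upath (linepath (1 / 2) (1 / 2) +++ linepath (1 / 2) z)"
      using upath_join_linepath[OF upath_base, of z] seg unfolding pathfinish_linepath by blast
    show "homotopic_paths punctured (linepath (1 / 2) (1 / 2) +++ linepath (1 / 2) z) (linepath (1 / 2) z)"
      using homotopic_paths_lid[of "linepath (1 / 2) z" punctured] seg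
      unfolding pathstart_linepath path_image_linepath by blast
  qed
  finally show ?thesis .
qed

lemma of_real_in_base_ball: "0 < t \<Longrightarrow> t < 1 \<Longrightarrow> complex_of_real t \<in> ball (1 / 2) (1 / 2)"
proof -
  assume t: "0 < t" "t < 1"
  have "dist (1 / 2) (complex_of_real t) = \<bar>1 / 2 - t\<bar>"
    using norm_of_real[of "1 / 2 - t", where ?'a = complex] by (simp add: dist_norm)
  also have "\<dots> < 1 / 2" using t by linarith
  finally show ?thesis unfolding mem_ball .
qed

lemma lift01_eq_shift: "0 < t \<Longrightarrow> t < 1 \<Longrightarrow> lift01 t = shift base_pt (of_real t)"
  by (simp add: lift01_def shift_base[OF of_real_in_base_ball])

text \<open>Vanishing on a whole disc passes to neighbouring discs by the identity theorem, starting
  from the base disc, where the interval accumulates. A path to u is then covered in steps of fixed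
  length.\<close>

lemma cover_identity:
  assumes D: "holomorphic_cover D" and zero: "\<And>t. 0 < t \<Longrightarrow> t < 1 \<Longrightarrow> D (lift01 t) = 0"
  shows "D u = 0"
proof -
  let ?g = "rep_ucover u"
  note I = upath_interval[OF upath_rep[of u]]
  have hol: "(\<lambda>z. D (shift v z)) holomorphic_on disc v" for v
    using D by (simp add: holomorphic_cover_iff)
  define T where "T v \<longleftrightarrow> (\<forall>z\<in>disc v. D (shift v z) = 0)" for v
  have base: "T base_pt"
    unfolding T_def
  proof
    fix z assume z: "z \<in> disc base_pt"
    show "D (shift base_pt z) = 0"
    proof (rule analytic_continuation[OF hol open_ball connected_ball, of "complex_of_real ` {0<..<1}" base_pt "1 / 2"])
      show "complex_of_real ` {0<..<1} \<subseteq> disc base_pt"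
        unfolding proj_base rad_half using of_real_in_base_ball by auto
      show "(1 / 2 :: complex) islimpt complex_of_real ` {0<..<1}"
      proof -
        have "(1 / 2 :: real) islimpt {0<..<1}" by (simp add: islimpt_greaterThanLessThan1 interior_limit_point)
        moreover have "\<forall>\<^sub>F x in at (1 / 2). complex_of_real x \<noteq> complex_of_real (1 / 2)"
          unfolding of_real_eq_iff by (simp add: eventually_at_filter)
        ultimately have "complex_of_real (1 / 2) islimpt complex_of_real ` {0<..<1}"
          by (intro islimpt_isCont_image) auto
        then show ?thesis by simp
      qed
      show "D (shift base_pt x) = 0" if "x \<in> complex_of_real ` {0<..<1}" for x
        using that zero lift01_eq_shift by force
    qed (use z in \<open>simp_all add: proj_base rad_half\<close>)
  qed
  have step: "T (shift v w)" if v: "T v" and w: "w \<in> disc v" for v w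
    unfolding T_def proj_shift_ball[OF w]
  proof
    fix z assume z: "z \<in> ball w (rad w)"
    have hw: "(\<lambda>z. D (shift (shift v w) z)) holomorphic_on ball w (rad w)"
      using hol[of "shift v w"] unfolding proj_shift_ball[OF w] .
    have ww: "w \<in> ball w (rad w)" using w ball_rad[of "proj v"] by (intro in_ball_rad) blast
    show "D (shift (shift v w) z) = 0"
    proof (rule analytic_continuation[OF hw open_ball connected_ball, of "ball w (rad w) \<inter> disc v" w])
      show "w islimpt ball w (rad w) \<inter> disc v"
        using ww w by (intro interior_limit_point) (simp add: interior_open open_Int)
      show "D (shift (shift v w) x) = 0" if "x \<in> ball w (rad w) \<inter> disc v" for x
        using that v shift_shift[OF w, of x] by (simp add: T_def)
    qed (use ww z in auto)
  qed
  obtain e where e: "e > 0" "\<And>x y. x \<in> {0..1} \<Longrightarrow> y \<in> {0..1} \<Longrightarrow> dist x y < e \<Longrightarrow>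
      ?g ` closed_segment x y \<subseteq> ball (?g x) (rad (?g x))"
    using uniform_step[OF I(1,2,4,5)] by blast
  \<comment> \<open>The indicator of T along the path is locally constant, hence equal at both
    ends.\<close>
  let ?f = "\<lambda>x. if T (lift_map ?g 0 x) then 1 else (0 :: complex)"
  have near: "T (lift_map ?g 0 y)" if "T (lift_map ?g 0 x)" "x \<in> {0..1}" "y \<in> {0..1}" "dist x y < e" for x y
  proof -
    have p: "proj (lift_map ?g 0 x) = ?g x" by (rule proj_lift_map[OF I(2,3) that(2) I(4-6)])
    have "lift_map ?g 0 y = shift (lift_map ?g 0 x) (?g y)"
      by (rule lift_map_step[OF I(2,3) that(2,3) I(4-6) e(2)[OF that(2-4)]])
    moreover have "?g y \<in> ball (?g x) (rad (?g x))" using e(2)[OF that(2-4)] by auto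
    ultimately show ?thesis using step[OF that(1)] p by simp
  qed
  have "?f 0 = ?f 1"
  proof (rule locally_constant_on_convex[of "{0..1::real}" e])
    fix x y :: real assume "x \<in> {0..1}" "y \<in> {0..1}" "dist x y < e"
    then have "T (lift_map ?g 0 x) \<longleftrightarrow> T (lift_map ?g 0 y)"
      using near by (metis dist_commute)
    then show "?f x = ?f y" by simp
  qed (use e in auto)
  moreover have "lift_map ?g 0 0 = base_pt"
  proof -
    have "?g \<circ> linepath 0 0 = linepath (1 / 2) (1 / 2)"
      using I(6) by (auto simp: linepath_def algebra_simps)
    then show ?thesis by (simp add: lift_map_def base_pt_def)
  qed
  ultimately have "T u" using base by (simp add: lift_map_1 abs_rep_ucover split: if_splits)
  then have "D (shift u (proj u)) = 0" using in_ball_rad[OF proj_punctured] unfolding T_def by blast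
  then show ?thesis by (simp add: shift_self)
qed

section \<open>Continuation of the polylogarithms and of the identity\<close>

lemma holomorphic_cover_const: "holomorphic_cover (\<lambda>_. c)"
  by (simp add: holomorphic_cover_def)

lemma holomorphic_cover_add: "holomorphic_cover F \<Longrightarrow> holomorphic_cover G \<Longrightarrow> holomorphic_cover (\<lambda>u. F u + G u)"
  by (auto simp: holomorphic_cover_iff intro!: holomorphic_intros)

lemma holomorphic_cover_diff: "holomorphic_cover F \<Longrightarrow> holomorphic_cover G \<Longrightarrow> holomorphic_cover (\<lambda>u. F u - G u)"
  by (auto simp: holomorphic_cover_iff intro!: holomorphic_intros)

lemma holomorphic_cover_mult: "holomorphic_cover F \<Longrightarrow> holomorphic_cover G \<Longrightarrow> holomorphic_cover (\<lambda>u. F u * G u)"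
  by (auto simp: holomorphic_cover_iff intro!: holomorphic_intros)

lemma holomorphic_cover_sum:
  "(\<And>i. i \<in> I \<Longrightarrow> holomorphic_cover (F i)) \<Longrightarrow> holomorphic_cover (\<lambda>u. \<Sum>i\<in>I. F i u)"
  by (auto simp: holomorphic_cover_iff intro!: holomorphic_on_sum)

text \<open>Agreement on the whole base disc rather than on the interval, so that complex
  derivatives can be compared when passing to a primitive.\<close>

definition has_continuation :: "(complex \<Rightarrow> complex) \<Rightarrow> bool" where
  "has_continuation f \<longleftrightarrow> (\<exists>F. holomorphic_cover F \<and> (\<forall>z\<in>ball (1 / 2) (1 / 2). F (shift base_pt z) = f z))"

text \<open>A primitive on the cover, normalised at the base point, has on the base disc the
  derivative of f and the same value at 1/2.\<close>

lemma has_continuation_primitive: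
  assumes g: "has_continuation g" and a: "a holomorphic_on punctured"
    and f: "\<And>z. z \<in> ball (1 / 2) (1 / 2) \<Longrightarrow> (f has_field_derivative a z * g z) (at z)"
  shows "has_continuation f"
proof -
  let ?B = "ball (1 / 2 :: complex) (1 / 2)"
  obtain G where G: "holomorphic_cover G" "\<And>z. z \<in> ?B \<Longrightarrow> G (shift base_pt z) = g z"
    using g unfolding has_continuation_def by blast
  obtain F where F: "holomorphic_cover F" "F base_pt = f (1 / 2)"
    "\<And>u z. z \<in> disc u \<Longrightarrow> ((\<lambda>z. F (shift u z)) has_field_derivative a z * G (shift u z)) (at z)"
    using cover_primitive_exists[OF G(1) a] by blast
  have "\<exists>c. \<forall>z\<in>?B. F (shift base_pt z) - f z = c"
  proof (rule has_field_derivative_zero_constant[OF convex_ball])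
    fix z assume z: "z \<in> ?B"
    have "((\<lambda>z. F (shift base_pt z) - f z) has_field_derivative a z * G (shift base_pt z) - a z * g z) (at z)"
      using F(3)[of z base_pt] f[OF z] z unfolding proj_base rad_half by (intro DERIV_diff) auto
    then show "((\<lambda>z. F (shift base_pt z) - f z) has_field_derivative 0) (at z within ?B)"
      using G(2)[OF z] by (simp add: has_field_derivative_at_within)
  qed
  then obtain c where c: "\<And>z. z \<in> ?B \<Longrightarrow> F (shift base_pt z) - f z = c" by blast
  have "c = 0" using c[of "1 / 2"] F(2) shift_self[of base_pt] unfolding proj_base by simp
  with c F(1) show ?thesis unfolding has_continuation_def by (intro exI[of _ F]) simp
qed

lemma has_continuation_cong:
  "has_continuation f \<Longrightarrow> (\<And>z. z \<in> ball (1 / 2) (1 / 2) \<Longrightarrow> f z = g z) \<Longrightarrow> has_continuation g"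
  unfolding has_continuation_def by (metis (no_types, lifting))

lemma has_continuation_const: "has_continuation (\<lambda>_. c)"
  unfolding has_continuation_def by (intro exI[of _ "\<lambda>_. c"]) (simp add: holomorphic_cover_const)

lemma base_ball_in_lens:
  fixes z :: complex
  assumes "z \<in> ball (1 / 2) (1 / 2)"
  shows "norm z < 1" "norm (1 - z) < 1" "z \<noteq> 0" "1 - z \<noteq> 0"
proof -
  have h: "norm (1 / 2 - z) < 1 / 2" using assms by (simp add: dist_norm)
  have n: "norm (1 / 2 :: complex) = 1 / 2" by simp
  show "norm z < 1" using norm_triangle_ineq4[of "1 / 2" "1 / 2 - z"] h n by simp
  have eq: "1 - z = 1 / 2 + (1 / 2 - z)" by simp
  show "norm (1 - z) < 1"
    by (subst eq) (use norm_triangle_ineq[of "1 / 2" "1 / 2 - z"] h n in linarith)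
  show "z \<noteq> 0" using h n by auto
  show "1 - z \<noteq> 0"
  proof
    assume "1 - z = 0"
    then have "1 / 2 - z = - (1 / 2)" by (simp add: field_simps)
    then show False using h n by (simp only: norm_minus_cancel)
  qed
qed

text \<open>Covers both families of iterated primitives: the forms dz / z and dz / (1 - z) for Li(w;
  z), and - dz / (1 - z) and - dz / z for Li(w; 1 - z).\<close>

lemma word_family_has_continuation:
  fixes f :: "word \<Rightarrow> complex \<Rightarrow> complex"
  assumes a: "a holomorphic_on punctured" and b: "b holomorphic_on punctured"
    and Nil: "\<And>z. z \<in> ball (1 / 2) (1 / 2) \<Longrightarrow> f [] z = 1"
    and Lx: "\<And>w z. w \<in> h1_words \<Longrightarrow> w \<noteq> [] \<Longrightarrow> z \<in> ball (1 / 2) (1 / 2) \<Longrightarrow>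
      (f (Lx # w) has_field_derivative a z * f w z) (at z)"
    and Ly: "\<And>w z. w \<in> h1_words \<Longrightarrow> z \<in> ball (1 / 2) (1 / 2) \<Longrightarrow>
      (f (Ly # w) has_field_derivative b z * f w z) (at z)"
  shows "w \<in> h1_words \<Longrightarrow> has_continuation (f w)"
proof (induction w)
  case Nil
  show ?case by (rule has_continuation_cong[OF has_continuation_const[of 1]]) (simp add: assms(3))
next
  case (Cons c w)
  then have w: "w \<in> h1_words" "w = [] \<longrightarrow> c = Ly" by (simp_all add: h1_words_Cons)
  show ?case
  proof (cases c)
    case c: Lx
    show ?thesis
      by (rule has_continuation_primitive[OF Cons.IH[OF w(1)] a]) (use Lx w c in auto)
  next
    case c: Ly
    show ?thesis
      by (rule has_continuation_primitive[OF Cons.IH[OF w(1)] b]) (use Ly w c in auto)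
  qed
qed

lemma Li_has_continuation:
  assumes "w \<in> h1_words"
  shows "has_continuation (Li w)"
proof (rule word_family_has_continuation[OF _ _ _ _ _ assms, of "\<lambda>z. 1 / z" "\<lambda>z. 1 / (1 - z)"])
  fix w and z :: complex assume w: "w \<in> h1_words" and z: "z \<in> ball (1 / 2) (1 / 2)"
  show "(Li (Lx # w) has_field_derivative 1 / z * Li w z) (at z)" if "w \<noteq> []"
    using Li_Lx_deriv[of z w] base_ball_in_lens[OF z] w that by simp
  show "(Li (Ly # w) has_field_derivative 1 / (1 - z) * Li w z) (at z)"
    using Li_Ly_deriv[of z w] base_ball_in_lens[OF z] w by simp
qed (auto simp: punctured_def base_ball_in_lens intro!: holomorphic_intros)

lemma Li_refl_has_continuation:
  assumes "w \<in> h1_words"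
  shows "has_continuation (\<lambda>z. Li w (1 - z))"
proof (rule word_family_has_continuation[OF _ _ _ _ _ assms, of "\<lambda>z. - 1 / (1 - z)" "\<lambda>z. - 1 / z"])
  fix w and z :: complex assume w: "w \<in> h1_words" and z: "z \<in> ball (1 / 2) (1 / 2)"
  have refl: "((\<lambda>z. Li w (1 - z)) has_field_derivative - d) (at z)"
    if "(Li w has_field_derivative d) (at (1 - z))" for d w
  proof -
    have "((\<lambda>z. 1 - z :: complex) has_field_derivative -1) (at z)"
      by (auto intro!: derivative_eq_intros)
    then show ?thesis using DERIV_chain2[of "Li w" d "\<lambda>z. 1 - z" z "-1" UNIV, OF that] by simp
  qed
  show "((\<lambda>z. Li (Lx # w) (1 - z)) has_field_derivative - 1 / (1 - z) * Li w (1 - z)) (at z)" if "w \<noteq> []"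
    using refl[OF Li_Lx_deriv[of "1 - z" w]] base_ball_in_lens[OF z] w that by simp
  show "((\<lambda>z. Li (Ly # w) (1 - z)) has_field_derivative - 1 / z * Li w (1 - z)) (at z)"
    using refl[OF Li_Ly_deriv[of "1 - z" w]] base_ball_in_lens[OF z] w by simp
qed (auto simp: punctured_def base_ball_in_lens intro!: holomorphic_intros)

text \<open>\<open>cover_identity\<close> supplies the uniqueness behind the definite
  description.\<close>

lemma continuation_props:
  assumes "has_continuation f"
  shows "holomorphic_cover (continuation f)"
    and "0 < t \<Longrightarrow> t < 1 \<Longrightarrow> continuation f (lift01 t) = f (of_real t)"
proof -
  let ?P = "\<lambda>F. holomorphic_cover F \<and> (\<forall>t. 0 < t \<and> t < 1 \<longrightarrow> F (lift01 t) = f (of_real t))"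
  obtain F where F: "holomorphic_cover F" "\<And>z. z \<in> ball (1 / 2) (1 / 2) \<Longrightarrow> F (shift base_pt z) = f z"
    using assms unfolding has_continuation_def by blast
  have PF: "?P F" using F(1) F(2)[OF of_real_in_base_ball] by (simp add: lift01_eq_shift)
  have "G = F" if G: "?P G" for G
  proof
    fix u
    have "G u - F u = 0"
      by (rule cover_identity[OF holomorphic_cover_diff]) (use G PF in auto)
    then show "G u = F u" by simp
  qed
  with PF have "continuation f = F" unfolding continuation_def by (intro the_equality)
  with PF show "holomorphic_cover (continuation f)"
    and "0 < t \<Longrightarrow> t < 1 \<Longrightarrow> continuation f (lift01 t) = f (of_real t)" by auto
qed

lemma holomorphic_cover_G0:
  assumes "\<And>w. w \<in> h1_words \<Longrightarrow> holomorphic_cover (L w)"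
  shows "holomorphic_cover (G0 L k n s)"
proof (cases "k < n + s \<or> n < s \<or> k \<le> 0 \<or> n \<le> 0 \<or> s \<le> 0")
  case True
  then have "G0 L k n s = (\<lambda>_. 0)" by (auto simp: G0_def)
  then show ?thesis by (simp add: holomorphic_cover_const)
next
  case False
  then have "G0 L k n s = (\<lambda>z. \<Sum>w\<in>{w\<in>h0_words. int (length w) = k \<and> int (depth w) = n \<and> int (height w) = s}. L w z)"
    by (intro ext) (simp add: G0_def)
  moreover have "w \<in> h1_words" if "w \<in> h0_words" for w
    using that by (auto simp: h0_words_iff h1_words_def)
  ultimately show ?thesis using assms by (auto intro!: holomorphic_cover_sum)
qed

lemma holomorphic_cover_G1:
  assumes "\<And>w. w \<in> h1_words \<Longrightarrow> holomorphic_cover (L w)"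
  shows "holomorphic_cover (G1 L k n s)"
proof (cases "k < n + s - 1 \<or> n < s \<or> k \<le> 0 \<or> n \<le> 0 \<or> s \<le> 0")
  case True
  then have "G1 L k n s = (\<lambda>_. 0)" by (auto simp: G1_def)
  then show ?thesis by (simp add: holomorphic_cover_const)
next
  case False
  then have "G1 L k n s = (\<lambda>z. \<Sum>w\<in>{w\<in>h1_words. int (length w) = k \<and> int (depth w) = n \<and> int (height w) = s}. L w z)"
    by (intro ext) (simp add: G1_def)
  then show ?thesis using assms by (auto intro!: holomorphic_cover_sum)
qed

lemma holomorphic_cover_lhs_coeff:
  assumes "\<And>w. w \<in> h1_words \<Longrightarrow> holomorphic_cover (L w)" "\<And>w. w \<in> h1_words \<Longrightarrow> holomorphic_cover (L' w)"
  shows "holomorphic_cover (\<lambda>u. lhs_coeff L u L' u k l m)"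
  unfolding lhs_coeff_def Gbar0_def Gbar1_def case_prod_unfold
  by (intro holomorphic_cover_add holomorphic_cover_sum holomorphic_cover_mult holomorphic_cover_diff
      holomorphic_cover_G0 holomorphic_cover_G1 assms)

lemma G0_cong:
  assumes "\<And>w. w \<in> h1_words \<Longrightarrow> L w z = L' w z'"
  shows "G0 L k n s z = G0 L' k n s z'"
proof -
  have "w \<in> h1_words" if "w \<in> h0_words" for w
    using that by (auto simp: h0_words_iff h1_words_def)
  with assms show ?thesis by (auto simp: G0_def intro!: sum.cong)
qed

lemma G1_cong:
  assumes "\<And>w. w \<in> h1_words \<Longrightarrow> L w z = L' w z'"
  shows "G1 L k n s z = G1 L' k n s z'"
  using assms by (auto simp: G1_def intro!: sum.cong)

lemma lhs_coeff_cong: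
  assumes "\<And>w. w \<in> h1_words \<Longrightarrow> L w z = L' w z'" "\<And>w. w \<in> h1_words \<Longrightarrow> M w y = M' w y'"
  shows "lhs_coeff L z M y k l m = lhs_coeff L' z' M' y' k l m"
  using G0_cong[of L z L' z', OF assms(1)] G1_cong[of L z L' z', OF assms(1)]
    G0_cong[of M y M' y', OF assms(2)] G1_cong[of M y M' y', OF assms(2)]
  unfolding lhs_coeff_def Gbar0_def Gbar1_def by simp

theorem lhs_coeff_Li_cover:
  assumes "(k, l, m) \<noteq> (0, 0, 0)"
  shows "lhs_coeff Li_cover u Li_refl_cover u k l m = rhs_coeff k l m"
proof -
  note props = continuation_props[OF Li_has_continuation] continuation_props[OF Li_refl_has_continuation]
  have "lhs_coeff Li_cover u Li_refl_cover u k l m - rhs_coeff k l m = 0"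
  proof (rule cover_identity)
    show "holomorphic_cover (\<lambda>u. lhs_coeff Li_cover u Li_refl_cover u k l m - rhs_coeff k l m)"
      by (intro holomorphic_cover_diff holomorphic_cover_lhs_coeff holomorphic_cover_const)
         (simp_all add: Li_cover_def Li_refl_cover_def props)
    fix t :: real assume t: "0 < t" "t < 1"
    have "lhs_coeff Li_cover (lift01 t) Li_refl_cover (lift01 t) k l m = lhs_coeff Li (of_real t) Li (1 - of_real t) k l m"
      by (rule lhs_coeff_cong) (simp_all add: Li_cover_def Li_refl_cover_def props t)
    then show "lhs_coeff Li_cover (lift01 t) Li_refl_cover (lift01 t) k l m - rhs_coeff k l m = 0"
      using lhs_coeff_Li[OF t assms] by simp
  qed
  then show ?thesis by simp
qed

theorem theorem14:
  fixes k l m :: nat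
  assumes "(k, l, m) \<noteq> (0, 0, 0)"
  defines "rhs \<equiv>
    (\<Sum>i\<le>k. \<Sum>j\<le>l. \<Sum>\<mu>\<le>m.
       of_nat ((i + j) choose i)
       * P_exp (k - i) zeta_seq * P_exp (l - j) zeta_seq
       * P_exp \<mu> (\<lambda>n. - zeta_seq n) * P_exp (i + j + 2 * m - \<mu>) (\<lambda>n. - zeta_seq n)
       * of_int (N_coeff (int (i + j)) (int m - int \<mu>)))"
  shows
   "(\<forall>z :: ucover.
       Gbar0 Li_cover (int (k + l + 2 * m)) (int (l + m)) (int m) z
       + Gbar0 Li_refl_cover (int (k + l + 2 * m)) (int (k + m)) (int m) z
       + (\<Sum>(k', k'')\<in>{(k', k''). k' + k'' = k}.
          \<Sum>(l', l'')\<in>{(l', l''). l' + l'' = l}.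
          \<Sum>(m', m'')\<in>{(m', m''). m' + m'' = m}.
            Gbar0 Li_cover (int (k' + l' + 2 * m')) (int (l' + m')) (int m') z
            * Gbar0 Li_refl_cover (int (k'' + l'' + 2 * m'')) (int (k'' + m'')) (int m'') z
            + Gbar1 Li_cover (int (k' + l' + 2 * m') - 1) (int (l' + m')) (int m') z
            * G1 Li_refl_cover (int (k'' + l'' + 2 * m'' + 1)) (int (k'' + m'' + 1)) (int (m'' + 1)) z)
       = rhs)
    \<and> (\<forall>t :: real. 0 < t \<and> t < 1 \<longrightarrow>
       Gbar0 Li (int (k + l + 2 * m)) (int (l + m)) (int m) (of_real t)
       + Gbar0 Li (int (k + l + 2 * m)) (int (k + m)) (int m) (1 - of_real t)
       + (\<Sum>(k', k'')\<in>{(k', k''). k' + k'' = k}.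
          \<Sum>(l', l'')\<in>{(l', l''). l' + l'' = l}.
          \<Sum>(m', m'')\<in>{(m', m''). m' + m'' = m}.
            Gbar0 Li (int (k' + l' + 2 * m')) (int (l' + m')) (int m') (of_real t)
            * Gbar0 Li (int (k'' + l'' + 2 * m'')) (int (k'' + m'')) (int m'') (1 - of_real t)
            + Gbar1 Li (int (k' + l' + 2 * m') - 1) (int (l' + m')) (int m') (of_real t)
            * G1 Li (int (k'' + l'' + 2 * m'' + 1)) (int (k'' + m'' + 1)) (int (m'' + 1)) (1 - of_real t))
       = rhs)"
  using lhs_coeff_Li_cover[OF assms(1)] lhs_coeff_Li[OF _ _ assms(1)]
  unfolding lhs_coeff_def rhs_coeff_def rhs_def by blast

end
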